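(* Assume: (1) $(X_i,Y_i)_{i=1}^n$ are i.i.d. copies of $(X,Y)$, where $Y=\langle\beta,X\rangle+\varepsilon$ with $\mathbb{E}[\varepsilon X]=0$, $\mathbb{E}[X]=0$, $\mathbb{E}\|X\|^4<\infty$ and $\mathbb{E}[\varepsilon^2\mid X]\le\sigma^2<\infty$; (2) the covariance operator $K=\mathbb{E}[X\otimes X]$ has no zero eigenvalues; (3) for some $\mu,R,C>0$, $\sum_{j\ge1}\langle\beta,v_j\rangle^2/\lambda_j^{2\mu}\le R^2$ and $\sum_{j\ge1}\lambda_j\le C$; (4) the number of PLS components is selected by the early stopping rule $$\hat m=\min\left\{m\ge0:\ \left\|\hat r-\hat K\hat\beta_m\right\|\le\tau\sigma\sqrt{\frac{2\mathbb{E}\|X\|^2}{\delta n}}\right\}$$ for some $\tau>1$ and $\delta\in(0,1)$ with $\delta\ge1/n$. Then for every $s\in[0,1]$, with probability at least $1-\delta$, $$\left\|K^s(\hat\beta_{\hat m}-\beta)\right\|^2=O\left((\delta n)^{-\frac{\mu+s}{\mu+1}}\right),$$ where the constant in $O(\cdot)$ does not depend on $n$ or $\delta$.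
   Context: $(\mathbb{H},\langle\cdot,\cdot\rangle)$ is a separable real Hilbert space with norm $\|\cdot\|$; $X,\beta\in\mathbb{H}$, $Y,\varepsilon\in\mathbb{R}$. For $x\in\mathbb{H}$, $(x\otimes x)b=\langle x,b\rangle x$. $K=\mathbb{E}[X\otimes X]=\sum_{j\ge1}\lambda_jv_j\otimes v_j$, with eigenvalues $\lambda_1\ge\lambda_2\ge\dots\ge0$ and orthonormal eigenvectors $v_j$; $K^s=\sum_j\lambda_j^sv_j\otimes v_j$ with $K^0=I$. Sample quantities: $\hat r=\frac1n\sum_{i=1}^nY_iX_i$, $\hat K=\frac1n\sum_{i=1}^nX_i\otimes X_i$. PLS estimator: $\hat\beta_0=0$ and, for $m\ge1$, $\hat\beta_m$ is the minimizer of $\|\hat r-\hat Kb\|^2$ over $b$ in the Krylov subspace $\mathbb{H}_m=\mathrm{span}\{\hat r,\hat K\hat r,\dots,\hat K^{m-1}\hat r\}$. The level $\delta$ is allowed to depend on $n$. *)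

theory Defs
  imports "HOL-Probability.Probability"
begin

text \<open>
  The operator-valued expectation of \<open>X \<otimes> X\<close> is taken pointwise, since the space of bounded
  operators is not separable and hence not in the scope of the Bochner integral of the library.
\<close>

definition covariance_op ::
  "'a measure \<Rightarrow> ('a \<Rightarrow> 'h::{real_inner,banach,second_countable_topology}) \<Rightarrow> 'h \<Rightarrow> 'h" where
  "covariance_op M X b = (\<integral>\<omega>. (X \<omega> \<bullet> b) *\<^sub>R X \<omega> \<partial>M)"

definition is_eigenvalue :: "('h::real_vector \<Rightarrow> 'h) \<Rightarrow> real \<Rightarrow> bool" where
  "is_eigenvalue A c \<longleftrightarrow> (\<exists>b. b \<noteq> 0 \<and> A b = c *\<^sub>R b)"

text \<open>
  Spectral decomposition \<open>A = (\<Sum>j\<ge>1. l j * v j \<otimes> v j)\<close>. The Hilbert space may have finite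
  dimension \<open>d\<close>, so the index set \<open>J\<close> is either all of the positive integers or an initial segment.
\<close>

definition eigen_decomposition ::
  "('h::real_inner \<Rightarrow> 'h) \<Rightarrow> nat set \<Rightarrow> (nat \<Rightarrow> real) \<Rightarrow> (nat \<Rightarrow> 'h) \<Rightarrow> bool" where
  "eigen_decomposition A J l v \<longleftrightarrow>
     (J = {1..} \<or> (\<exists>d. J = {1..d})) \<and>
     (\<forall>i\<in>J. \<forall>j\<in>J. i \<le> j \<longrightarrow> l j \<le> l i) \<and>
     (\<forall>j\<in>J. 0 \<le> l j) \<and>
     (\<forall>i\<in>J. \<forall>j\<in>J. v i \<bullet> v j = (if i = j then 1 else 0)) \<and>
     (\<forall>j\<in>J. A (v j) = l j *\<^sub>R v j) \<and>
     (\<forall>b. ((\<lambda>j. (l j * (v j \<bullet> b)) *\<^sub>R v j) has_sum A b) J)"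

definition spectral_power ::
  "nat set \<Rightarrow> (nat \<Rightarrow> real) \<Rightarrow> (nat \<Rightarrow> 'h::real_inner) \<Rightarrow> real \<Rightarrow> 'h \<Rightarrow> 'h" where
  "spectral_power J l v s b =
     (if s = 0 then b else (\<Sum>\<^sub>\<infinity>j\<in>J. (l j powr s * (v j \<bullet> b)) *\<^sub>R v j))"

definition sample_cross_cov :: "nat \<Rightarrow> (nat \<Rightarrow> 'h::real_vector) \<Rightarrow> (nat \<Rightarrow> real) \<Rightarrow> 'h" where
  "sample_cross_cov n x y = (1 / real n) *\<^sub>R (\<Sum>i=1..n. y i *\<^sub>R x i)"

definition sample_cov :: "nat \<Rightarrow> (nat \<Rightarrow> 'h::real_inner) \<Rightarrow> 'h \<Rightarrow> 'h" where
  "sample_cov n x b = (1 / real n) *\<^sub>R (\<Sum>i=1..n. (x i \<bullet> b) *\<^sub>R x i)"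

definition krylov :: "('h::real_vector \<Rightarrow> 'h) \<Rightarrow> 'h \<Rightarrow> nat \<Rightarrow> 'h set" where
  "krylov A r m = span ((\<lambda>k. (A ^^ k) r) ` {..<m})"

text \<open>
  The minimizer exists and is unique for every sample: the Krylov space lies in the span of
  \<open>x 1, \<dots>, x n\<close>, which has finite dimension and on which \<open>sample_cov n x\<close> is injective.
  For the same reason the residual vanishes for large \<open>m\<close>, so the minimum
  in \<open>stopping_index\<close> is over a nonempty set whenever the threshold \<open>t\<close> is nonnegative.
\<close>

definition pls_estimator ::
  "nat \<Rightarrow> (nat \<Rightarrow> 'h::real_inner) \<Rightarrow> (nat \<Rightarrow> real) \<Rightarrow> nat \<Rightarrow> 'h" where
  "pls_estimator n x y m =
     (if m = 0 then 0
      else arg_min_on (\<lambda>b. (norm (sample_cross_cov n x y - sample_cov n x b))\<^sup>2)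
             (krylov (sample_cov n x) (sample_cross_cov n x y) m))"

definition stopping_index ::
  "nat \<Rightarrow> (nat \<Rightarrow> 'h::real_inner) \<Rightarrow> (nat \<Rightarrow> real) \<Rightarrow> real \<Rightarrow> nat" where
  "stopping_index n x y t =
     (LEAST m. norm (sample_cross_cov n x y - sample_cov n x (pls_estimator n x y m)) \<le> t)"

definition iid_copies ::
  "'b measure \<Rightarrow> nat \<Rightarrow> (nat \<Rightarrow> 'b \<Rightarrow> 'h::{real_inner,second_countable_topology}) \<Rightarrow> (nat \<Rightarrow> 'b \<Rightarrow> real) \<Rightarrow>
   'a measure \<Rightarrow> ('a \<Rightarrow> 'h) \<Rightarrow> ('a \<Rightarrow> real) \<Rightarrow> bool" where
  "iid_copies N n Xs Ys M X Y \<longleftrightarrow>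
     prob_space N \<and>
     prob_space.indep_vars N (\<lambda>_. borel) (\<lambda>i \<omega>. (Xs i \<omega>, Ys i \<omega>)) {1..n} \<and>
     (\<forall>i\<in>{1..n}. distr N borel (\<lambda>\<omega>. (Xs i \<omega>, Ys i \<omega>)) = distr M borel (\<lambda>\<omega>. (X \<omega>, Y \<omega>)))"

end

theory Submission
  imports Defs "HOL-Computational_Algebra.Polynomial"
begin

text \<open>
  Write \<open>A\<close> for the sample covariance operator, \<open>r\<close> for the sample cross covariance,
  \<open>b m\<close> for the PLS iterates and \<open>e = (\<delta> n) powr (- 1/2)\<close>. The sample enters through two deviations
  only, the noise \<open>r - A \<beta>\<close> and the operator error \<open>A - K\<close>. The first is the mean of \<open>n\<close> independent
  centered vectors, and so is each column \<open>(A - K) (v j)\<close> of the second; their mean squares, summed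
  over \<open>j\<close> for the second, are of order \<open>1/n\<close> (\<open>cross_cov_deviation\<close>, \<open>covariance_deviation\<close>).
  Markov's inequality then bounds both deviations by multiples of \<open>e\<close>, outside an event of probability
  \<open>\<delta>\<close>, and the first of these multiples is the threshold of the stopping rule up to the
  factor \<open>\<tau>\<close>. What remains is a deterministic statement, \<open>pls_rate\<close>.
\<close>

text \<open>
  The iterates have the form \<open>b m = q\<^sub>m(A) r\<close>, with residual \<open>p\<^sub>m(A) r\<close> for \<open>p\<^sub>m(t) = 1 - t q\<^sub>m(t)\<close>.
  On the finite spectrum of \<open>A\<close>, the polynomial \<open>p\<^sub>m\<close> minimizes a weighted sum of squares subject to
  \<open>p\<^sub>m(0) = 1\<close>, so it is orthogonal with respect to a discrete measure and, as long as the residual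
  does not vanish, has \<open>m\<close> positive roots (\<open>residual_poly_roots\<close>). The sum \<open>\<kappa>\<^sub>m\<close> of the reciprocal roots governs the regularization: on
  \<open>[0, 1/\<kappa>\<^sub>m]\<close> the filter \<open>q\<^sub>m\<close> is at most \<open>\<kappa>\<^sub>m\<close> and \<open>p\<^sub>m\<close> lies in \<open>[0, 1]\<close> (\<open>prod_list_linear_bound\<close>),
  and the residual is at most the norm of \<open>exp(- \<kappa>\<^sub>m A / 2) r\<close> (\<open>residual_norm_exp_bound\<close>, an
  estimate of Nemirovskii).

  The smoothness of \<open>\<beta>\<close> refers to \<open>K\<close>, while the filters are functions of \<open>A\<close>. Cutting the expansion of \<open>\<beta>\<close>
  off at an eigenvalue level \<open>\<alpha>\<close> gives \<open>\<beta> = K\<^sup>k w + \<rho>\<close> with the integer \<open>k = \<lceil>\<mu>\<rceil>\<close> (\<open>source_cutoff\<close>),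
  and integer powers of \<open>A\<close> and \<open>K\<close> are compared by telescoping (\<open>operator_power_diff\<close>). Hence no
  fractional power of \<open>A\<close> has to be estimated; the result is \<open>source_filter_bound\<close>.

  While the residual exceeds the threshold, these bounds force \<open>\<kappa>\<^sub>m \<le> 1/a\<close> for a level \<open>a\<close> of order
  \<open>e powr (1/(\<mu>+1))\<close> (\<open>not_stopped_kappa\<close>). The stopped iterate lies one step further, where \<open>\<kappa>\<close> could
  be much larger. However, the direction of that step is the reproducing kernel at \<open>0\<close> of the measure
  with density \<open>t\<close>, which is a convex combination of \<open>p\<^sub>0, \<dots>, p\<^sub>m\<^sub>-\<^sub>1\<close> (\<open>residual_poly_update\<close>). It is thus at most
  \<open>1\<close> on \<open>[0, a]\<close>, and the length of the step is \<open>O(1/a)\<close>, since a step changes the residual by no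
  more than its norm (\<open>stopped_filter\<close>). So the filter of the stopped iterate is \<open>O(1/a)\<close> on \<open>[0, a]\<close>. The part
  of the error below frequency \<open>a\<close> is bounded through the filter, the part above it by the residual divided
  by \<open>a\<close> (\<open>stopped_error\<close>). With threshold \<open>0\<close> the iteration ends at an exact solution instead, and
  only the component of \<open>\<beta>\<close> in the kernel of \<open>A\<close> is left (\<open>noiseless_error\<close>). This is the case \<open>s = 0\<close>; the residual itself gives the case \<open>s = 1\<close>, and
  \<open>spectral_power_interpolation\<close> gives the exponents in between.

  The measure of a non-measurable set is \<open>0\<close> by convention, so the event has to be shown measurable; this
  rests on a closed formula for the iterates (\<open>pls_estimator_formula\<close>).
\<close>

section \<open>Orthonormal families\<close>

definition orthonormal_family :: "'i set \<Rightarrow> ('i \<Rightarrow> 'h::real_inner) \<Rightarrow> bool" where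
  "orthonormal_family J v \<longleftrightarrow> (\<forall>i\<in>J. \<forall>j\<in>J. v i \<bullet> v j = (if i = j then 1 else 0))"

lemma orthonormal_family_subset:
  "orthonormal_family J v \<Longrightarrow> F \<subseteq> J \<Longrightarrow> orthonormal_family F v"
  unfolding orthonormal_family_def by blast

lemma norm_orthonormal: "orthonormal_family J v \<Longrightarrow> j \<in> J \<Longrightarrow> norm (v j) = 1"
  by (simp add: orthonormal_family_def norm_eq_sqrt_inner)

lemma inner_orthonormal_sum:
  assumes "orthonormal_family F v" "finite F" "i \<in> F"
  shows "v i \<bullet> (\<Sum>j\<in>F. c j *\<^sub>R v j) = c i"
proof -
  have "v i \<bullet> (\<Sum>j\<in>F. c j *\<^sub>R v j) = (\<Sum>j\<in>F. if j = i then c j else 0)"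
    unfolding inner_sum_right
    by (rule sum.cong) (use assms in \<open>auto simp: orthonormal_family_def\<close>)
  then show ?thesis using assms by simp
qed

lemma inner_orthonormal_sums:
  assumes "orthonormal_family F v" "finite F"
  shows "(\<Sum>j\<in>F. c j *\<^sub>R v j) \<bullet> (\<Sum>j\<in>F. d j *\<^sub>R v j) = (\<Sum>j\<in>F. c j * d j)"
  using inner_orthonormal_sum[OF assms] by (simp add: inner_sum_left)

lemma norm_orthonormal_sum:
  assumes "orthonormal_family F v" "finite F"
  shows "(norm (\<Sum>j\<in>F. c j *\<^sub>R v j))\<^sup>2 = (\<Sum>j\<in>F. (c j)\<^sup>2)"
  using inner_orthonormal_sums[OF assms, of c c]
  by (simp add: power2_norm_eq_inner) (simp add: power2_eq_square)

lemma orthonormal_pythagoras: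
  assumes "orthonormal_family F v" "finite F"
  shows "(norm b)\<^sup>2 = (\<Sum>j\<in>F. (v j \<bullet> b)\<^sup>2) + (norm (b - (\<Sum>j\<in>F. (v j \<bullet> b) *\<^sub>R v j)))\<^sup>2"
proof -
  let ?p = "\<Sum>j\<in>F. (v j \<bullet> b) *\<^sub>R v j"
  have bp: "?p \<bullet> b = (\<Sum>j\<in>F. (v j \<bullet> b)\<^sup>2)"
    by (simp add: inner_sum_left power2_eq_square)
  have pp: "?p \<bullet> ?p = (\<Sum>j\<in>F. (v j \<bullet> b)\<^sup>2)"
    using inner_orthonormal_sums[OF assms] by (simp add: power2_eq_square)
  have "(norm (b - ?p))\<^sup>2 = b \<bullet> b - 2 * (?p \<bullet> b) + ?p \<bullet> ?p"
    by (simp add: power2_norm_eq_inner inner_diff_left inner_diff_right inner_commute)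
  then show ?thesis using bp pp by (simp add: power2_norm_eq_inner)
qed

lemma bessel_finite:
  assumes "orthonormal_family F v" "finite F"
  shows "(\<Sum>j\<in>F. (v j \<bullet> b)\<^sup>2) \<le> (norm b)\<^sup>2"
  using orthonormal_pythagoras[OF assms, of b] by simp

lemma bessel_summable:
  assumes "orthonormal_family J v"
  shows "(\<lambda>j. (v j \<bullet> b)\<^sup>2) summable_on J"
  by (rule nonneg_bdd_above_summable_on)
     (use bessel_finite[OF orthonormal_family_subset[OF assms]] in \<open>auto intro!: bdd_aboveI\<close>)

text \<open>
  Completeness of the space enters here: the finite partial sums of \<open>\<Sum> c\<^sub>j v\<^sub>j\<close> form a Cauchy
  net, because the norm of the difference of two of them is a tail of \<open>\<Sum> c\<^sub>j\<^sup>2\<close>.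
\<close>

lemma orthonormal_series_summable:
  fixes v :: "'i \<Rightarrow> 'h::{real_inner,banach}"
  assumes on: "orthonormal_family J v" and sq: "(\<lambda>j. (c j)\<^sup>2) summable_on J"
  shows "(\<lambda>j. c j *\<^sub>R v j) summable_on J"
proof -
  let ?f = "\<lambda>j. c j *\<^sub>R v j"
  define S where "S = (\<Sum>\<^sub>\<infinity>j\<in>J. (c j)\<^sup>2)"
  have lim: "(sum (\<lambda>j. (c j)\<^sup>2) \<longlongrightarrow> S) (finite_subsets_at_top J)"
    unfolding S_def by (rule infsum_tendsto[OF sq])
  have "\<exists>P. eventually P (finite_subsets_at_top J) \<and>
              (\<forall>F G. P F \<and> P G \<longrightarrow> dist (sum ?f F) (sum ?f G) < e)" if "e > 0" for e
  proof -
    have "\<forall>\<^sub>F F in finite_subsets_at_top J. dist (sum (\<lambda>j. (c j)\<^sup>2) F) S < e\<^sup>2 / 8"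
      using \<open>e > 0\<close> by (intro tendstoD[OF lim]) auto
    then obtain F0 where F0: "finite F0" "F0 \<subseteq> J"
      and close: "\<And>F. finite F \<Longrightarrow> F0 \<subseteq> F \<Longrightarrow> F \<subseteq> J \<Longrightarrow> dist (sum (\<lambda>j. (c j)\<^sup>2) F) S < e\<^sup>2 / 8"
      unfolding eventually_finite_subsets_at_top by metis
    have near: "norm (sum ?f F - sum ?f F0) < e / 2"
      if F: "finite F" "F0 \<subseteq> F" "F \<subseteq> J" for F
    proof -
      have "sum ?f F - sum ?f F0 = sum ?f (F - F0)"
        using F F0 by (simp add: sum_diff)
      then have "(norm (sum ?f F - sum ?f F0))\<^sup>2 = (\<Sum>j\<in>F - F0. (c j)\<^sup>2)"
        using norm_orthonormal_sum[OF orthonormal_family_subset[OF on], of "F - F0"] F by auto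
      also have "\<dots> = sum (\<lambda>j. (c j)\<^sup>2) F - sum (\<lambda>j. (c j)\<^sup>2) F0"
        using F F0 by (simp add: sum_diff)
      also have "\<dots> < e\<^sup>2 / 4"
        using close[OF F] close[OF F0(1) order.refl F0(2)] unfolding dist_real_def by linarith
      also have "\<dots> = (e / 2)\<^sup>2" by (simp add: power2_eq_square)
      finally show ?thesis
        by (rule power_less_imp_less_base) (use \<open>e > 0\<close> in auto)
    qed
    let ?P = "\<lambda>F. finite F \<and> F0 \<subseteq> F \<and> F \<subseteq> J"
    have ev: "eventually ?P (finite_subsets_at_top J)"
      unfolding eventually_finite_subsets_at_top using F0 by blast
    have "dist (sum ?f F) (sum ?f G) < e" if F: "?P F" and G: "?P G" for F G
    proof (rule dist_triangle_half_l)
      show "dist (sum ?f F) (sum ?f F0) < e / 2"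
        unfolding dist_norm using F by (intro near) blast+
      show "dist (sum ?f G) (sum ?f F0) < e / 2"
        unfolding dist_norm using G by (intro near) blast+
    qed
    then have "\<forall>F G. ?P F \<and> ?P G \<longrightarrow> dist (sum ?f F) (sum ?f G) < e" by iprover
    with ev show ?thesis by (intro exI[of _ ?P] conjI)
  qed
  then have "cauchy_filter (filtermap (sum ?f) (finite_subsets_at_top J))"
    by (simp add: cauchy_filter_metric_filtermap)
  then obtain L where "(sum ?f \<longlongrightarrow> L) (finite_subsets_at_top J)"
    using complete_uniform[THEN iffD1, OF complete_UNIV] by (force simp: filterlim_def)
  then show ?thesis
    unfolding summable_on_def has_sum_def by blast
qed

lemma has_sum_inner_left:
  assumes "(f has_sum S) J"
  shows "((\<lambda>j. x \<bullet> f j) has_sum (x \<bullet> S)) J"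
  using has_sum_bounded_linear[OF bounded_linear_inner_right assms] by (simp add: o_def)

lemma orthonormal_series_coeff:
  assumes on: "orthonormal_family J v" and S: "((\<lambda>j. c j *\<^sub>R v j) has_sum S) J" and i: "i \<in> J"
  shows "v i \<bullet> S = c i"
proof -
  have "((\<lambda>j. v i \<bullet> (c j *\<^sub>R v j)) has_sum (v i \<bullet> S)) J"
    by (rule has_sum_inner_left[OF S])
  moreover have "((\<lambda>j. v i \<bullet> (c j *\<^sub>R v j)) has_sum c i) J"
    by (rule has_sum_finite_neutralI[where B = "{i}"]) (use on i in \<open>auto simp: orthonormal_family_def\<close>)
  ultimately show ?thesis by (rule has_sum_unique)
qed

lemma norm_orthonormal_series:
  assumes on: "orthonormal_family J v" and S: "((\<lambda>j. c j *\<^sub>R v j) has_sum S) J"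
  shows "((\<lambda>j. (c j)\<^sup>2) has_sum (norm S)\<^sup>2) J"
proof -
  have "((\<lambda>j. S \<bullet> (c j *\<^sub>R v j)) has_sum (S \<bullet> S)) J"
    by (rule has_sum_inner_left[OF S])
  moreover have "S \<bullet> (c j *\<^sub>R v j) = (c j)\<^sup>2" if "j \<in> J" for j
    using orthonormal_series_coeff[OF on S that] by (simp add: inner_commute[of S] power2_eq_square)
  ultimately show ?thesis
    unfolding power2_norm_eq_inner by (simp cong: has_sum_cong del: inner_scaleR_right)
qed

text \<open>
  The expansion converges since its coefficients are square summable. Its difference to \<open>b\<close> is
  orthogonal to the whole family.
\<close>

lemma complete_orthonormal_expansion:
  fixes v :: "'i \<Rightarrow> 'h::{real_inner,banach}"
  assumes on: "orthonormal_family J v" and total: "\<And>b. (\<forall>j\<in>J. v j \<bullet> b = 0) \<Longrightarrow> b = 0"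
  shows "((\<lambda>j. (v j \<bullet> b) *\<^sub>R v j) has_sum b) J"
proof -
  obtain S where S: "((\<lambda>j. (v j \<bullet> b) *\<^sub>R v j) has_sum S) J"
    using orthonormal_series_summable[OF on bessel_summable[OF on]] unfolding summable_on_def by blast
  have "b - S = 0"
    by (rule total) (use orthonormal_series_coeff[OF on S] in \<open>simp add: inner_diff_right\<close>)
  with S show ?thesis by simp
qed

lemma parseval:
  fixes v :: "'i \<Rightarrow> 'h::{real_inner,banach}"
  assumes on: "orthonormal_family J v" and total: "\<And>b. (\<forall>j\<in>J. v j \<bullet> b = 0) \<Longrightarrow> b = 0"
  shows "((\<lambda>j. (v j \<bullet> b)\<^sup>2) has_sum (norm b)\<^sup>2) J"
  by (rule norm_orthonormal_series[OF on complete_orthonormal_expansion[OF on total]])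

section \<open>Spectral theorem on finite-dimensional invariant subspaces\<close>

lemma orthonormal_set_independent:
  assumes "orthonormal_family E (\<lambda>x. x)" shows "independent E"
proof -
  have "pairwise orthogonal E"
    using assms by (auto simp: orthonormal_family_def pairwise_def orthogonal_def)
  moreover have "0 \<notin> E"
    using assms unfolding orthonormal_family_def by (metis inner_zero_left zero_neq_one)
  ultimately show ?thesis
    by (rule pairwise_orthogonal_independent)
qed

text \<open>
  Orthonormal sets are independent, which bounds their cardinality inside the span of a finite set, so
  there is a largest one that satisfies \<open>P\<close>. With \<open>P\<close> trivial it is a basis of the span; with
  \<open>P\<close> saying that \<open>e\<close> is an eigenvector it will be an eigenbasis.
\<close>

lemma maximal_orthonormal_set:
  fixes B :: "'h::real_inner set"
  assumes "finite B"
  shows "\<exists>E. finite E \<and> E \<subseteq> span B \<and> (\<forall>e\<in>E. P e) \<and> orthonormal_family E (\<lambda>x. x) \<and>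
    (\<forall>e\<in>span B. norm e = 1 \<longrightarrow> P e \<longrightarrow> (\<exists>f\<in>E. f \<bullet> e \<noteq> 0))"
proof -
  define Q where "Q = (\<lambda>E. finite E \<and> E \<subseteq> span B \<and> (\<forall>e\<in>E. P e) \<and> orthonormal_family E (\<lambda>x. x))"
  have bd: "card E \<le> card B" if "Q E" for E
    using independent_span_bound[OF assms orthonormal_set_independent, of E] that unfolding Q_def by blast
  have "Q {}" by (simp add: Q_def orthonormal_family_def)
  then obtain E where E: "Q E" and max: "\<And>E'. Q E' \<Longrightarrow> card E' \<le> card E"
  proof -
    have "\<exists>E. Q E \<and> (\<forall>E'. Q E' \<longrightarrow> card E' \<le> card E)"
      by (rule ex_has_greatest_nat[of Q "{}" card "Suc (card B)"]) (use \<open>Q {}\<close> bd in \<open>auto simp: less_Suc_eq_le\<close>)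
    then show ?thesis using that by blast
  qed
  show ?thesis
  proof (intro exI[of _ E] conjI ballI impI)
    show "finite E" "E \<subseteq> span B" "orthonormal_family E (\<lambda>x. x)" "\<And>e. e \<in> E \<Longrightarrow> P e"
      using E by (simp_all add: Q_def)
    fix e assume e: "e \<in> span B" "norm e = 1" "P e"
    show "\<exists>f\<in>E. f \<bullet> e \<noteq> 0"
    proof (rule ccontr)
      assume "\<not> (\<exists>f\<in>E. f \<bullet> e \<noteq> 0)"
      then have orth: "\<And>f. f \<in> E \<Longrightarrow> f \<bullet> e = 0 \<and> e \<bullet> f = 0" by (metis inner_commute)
      have ee: "e \<bullet> e = 1" using e(2) by (simp add: norm_eq_1)
      then have "e \<notin> E" using orth by (metis zero_neq_one)
      have "orthonormal_family (insert e E) (\<lambda>x. x)"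
        using E orth ee \<open>e \<notin> E\<close> unfolding Q_def orthonormal_family_def by auto
      then have "Q (insert e E)" using E e unfolding Q_def by simp
      from max[OF this] show False using E \<open>e \<notin> E\<close> by (simp add: Q_def)
    qed
  qed
qed

lemma orthonormal_basis_of_span:
  fixes B :: "'h::real_inner set"
  assumes "finite B"
  shows "\<exists>E. finite E \<and> E \<subseteq> span B \<and> orthonormal_family E (\<lambda>x. x) \<and>
    (\<forall>b\<in>span B. (\<Sum>e\<in>E. (e \<bullet> b) *\<^sub>R e) = b)"
proof -
  obtain E where E: "finite E" "E \<subseteq> span B" "orthonormal_family E (\<lambda>x. x)"
    and max: "\<And>e. e \<in> span B \<Longrightarrow> norm e = 1 \<Longrightarrow> \<exists>f\<in>E. f \<bullet> e \<noteq> 0"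
    using maximal_orthonormal_set[OF assms, of "\<lambda>_. True"] by metis
  have ex: "(\<Sum>e\<in>E. (e \<bullet> b) *\<^sub>R e) = b" if b: "b \<in> span B" for b
  proof (rule ccontr)
    define c where "c = b - (\<Sum>e\<in>E. (e \<bullet> b) *\<^sub>R e)"
    assume "(\<Sum>e\<in>E. (e \<bullet> b) *\<^sub>R e) \<noteq> b"
    then have "c \<noteq> 0" by (simp add: c_def)
    have "c \<in> span B" unfolding c_def
      by (intro span_diff span_sum span_scale b) (use E in auto)
    have "f \<bullet> c = 0" if "f \<in> E" for f
      using inner_orthonormal_sum[OF E(3) E(1) that] by (simp add: c_def inner_diff_right)
    then show False
      using max[of "c /\<^sub>R norm c"] \<open>c \<in> span B\<close> \<open>c \<noteq> 0\<close> by (auto simp: span_scale)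
  qed
  with E show ?thesis by blast
qed

lemma compact_box_span:
  fixes E :: "'h::real_inner set"
  assumes "finite E"
  shows "compact {\<Sum>e\<in>E. c e *\<^sub>R e | c. \<forall>e\<in>E. \<bar>c e\<bar> \<le> (1::real)}"
  using assms
proof induction
  case empty
  show ?case by simp
next
  case (insert x E)
  let ?S = "\<lambda>E. {\<Sum>e\<in>E. c e *\<^sub>R e | c. \<forall>e\<in>E. \<bar>c e\<bar> \<le> (1::real)}"
  have "compact ((\<lambda>a. a *\<^sub>R x) ` {-1..1})"
    by (intro compact_continuous_image continuous_intros compact_Icc)
  from compact_sums[OF this insert.IH]
  have "compact {y + z | y z. y \<in> (\<lambda>a. a *\<^sub>R x) ` {-1..1} \<and> z \<in> ?S E}" .
  also have "{y + z | y z. y \<in> (\<lambda>a. a *\<^sub>R x) ` {-1..1} \<and> z \<in> ?S E} = ?S (insert x E)"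
  proof (intro equalityI subsetI)
    fix u assume "u \<in> {y + z | y z. y \<in> (\<lambda>a. a *\<^sub>R x) ` {-1..1} \<and> z \<in> ?S E}"
    then obtain a c where a: "\<bar>a\<bar> \<le> 1" and c: "\<forall>e\<in>E. \<bar>c e\<bar> \<le> 1"
      and u: "u = a *\<^sub>R x + (\<Sum>e\<in>E. c e *\<^sub>R e)" by (auto simp: abs_le_iff)
    have "(\<Sum>e\<in>E. c e *\<^sub>R e) = (\<Sum>e\<in>E. (c(x := a)) e *\<^sub>R e)"
      by (rule sum.cong) (use insert.hyps in auto)
    then have "u = (\<Sum>e\<in>insert x E. (c(x := a)) e *\<^sub>R e)" using u insert.hyps by simp
    moreover have "\<forall>e\<in>insert x E. \<bar>(c(x := a)) e\<bar> \<le> 1" using a c by simp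
    ultimately show "u \<in> ?S (insert x E)" by blast
  next
    fix u assume "u \<in> ?S (insert x E)"
    then obtain c where c: "\<forall>e\<in>insert x E. \<bar>c e\<bar> \<le> 1" "u = (\<Sum>e\<in>insert x E. c e *\<^sub>R e)" by blast
    then have "u = c x *\<^sub>R x + (\<Sum>e\<in>E. c e *\<^sub>R e)" using insert.hyps by simp
    moreover have "c x *\<^sub>R x \<in> (\<lambda>a. a *\<^sub>R x) ` {-1..1}" using c by (auto simp: abs_le_iff)
    moreover have "(\<Sum>e\<in>E. c e *\<^sub>R e) \<in> ?S E" using c by auto
    ultimately show "u \<in> {y + z | y z. y \<in> (\<lambda>a. a *\<^sub>R x) ` {-1..1} \<and> z \<in> ?S E}" by blast
  qed
  finally show ?case .
qed

text \<open>
  The coefficients of a unit vector with respect to an orthonormal basis lie in a box, so the sphere is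
  a closed part of the compact image of that box.
\<close>

lemma compact_span_sphere:
  fixes B :: "'h::real_inner set"
  assumes "finite B"
  shows "compact {b \<in> span B. norm b = 1}"
proof -
  obtain E where E: "finite E" "E \<subseteq> span B" "orthonormal_family E (\<lambda>x. x)"
    and ex: "\<And>b. b \<in> span B \<Longrightarrow> (\<Sum>e\<in>E. (e \<bullet> b) *\<^sub>R e) = b"
    using orthonormal_basis_of_span[OF assms] by blast
  let ?Q = "{\<Sum>e\<in>E. c e *\<^sub>R e | c. \<forall>e\<in>E. \<bar>c e\<bar> \<le> (1::real)}"
  have "{b \<in> span B. norm b = 1} = ?Q \<inter> {b. norm b = 1}"
  proof (intro equalityI subsetI)
    fix b assume b: "b \<in> {b \<in> span B. norm b = 1}"
    have "\<bar>e \<bullet> b\<bar> \<le> 1" if "e \<in> E" for e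
      using Cauchy_Schwarz_ineq2[of e b] norm_orthonormal[OF E(3) that] b by simp
    then show "b \<in> ?Q \<inter> {b. norm b = 1}" using ex[of b] b by (auto intro!: exI[of _ "\<lambda>e. e \<bullet> b"])
  next
    fix b assume b: "b \<in> ?Q \<inter> {b. norm b = 1}"
    then obtain c where "b = (\<Sum>e\<in>E. c e *\<^sub>R e)" by blast
    moreover have "(\<Sum>e\<in>E. c e *\<^sub>R e) \<in> span B"
      by (intro span_sum span_scale) (use E in auto)
    ultimately show "b \<in> {b \<in> span B. norm b = 1}" using b by simp
  qed
  moreover have "closed {b::'h. norm b = 1}"
    by (intro closed_Collect_eq continuous_intros)
  ultimately show ?thesis using compact_box_span[OF E(1)] by (simp add: compact_Int_closed)
qed

lemma linear_coeff_zero_of_quadratic_bound: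
  fixes a c :: real
  assumes "\<And>t. 2 * t * a + t\<^sup>2 * c \<le> 0"
  shows "a = 0"
proof (rule ccontr)
  assume "a \<noteq> 0"
  define s where "s = inverse (1 + \<bar>c\<bar>)"
  have s: "s > 0" "s * \<bar>c\<bar> < 1" by (simp_all add: s_def field_simps)
  have "2 * (s * a) * a + (s * a)\<^sup>2 * c = s * a\<^sup>2 * (2 + s * c)"
    by (simp add: power2_eq_square algebra_simps)
  moreover have "2 + s * c > 0"
    using s abs_ge_minus_self[of "s * c"] by (simp add: abs_mult)
  ultimately show False
    using assms[of "s * a"] s \<open>a \<noteq> 0\<close> by (simp add: mult_le_0_iff not_less)
qed

text \<open>
  A maximizer of the Rayleigh quotient over the unit sphere of an invariant subspace is an
  eigenvector: the first variation of the quotient vanishes there.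
\<close>

lemma eigenvector_in_invariant_subspace:
  fixes A :: "'h::real_inner \<Rightarrow> 'h"
  assumes lin: "linear A" and sym: "\<And>b c. A b \<bullet> c = b \<bullet> A c"
    and W: "subspace W" "\<And>b. b \<in> W \<Longrightarrow> A b \<in> W"
    and cpt: "compact {b \<in> W. norm b = 1}" and cont: "continuous_on UNIV A"
    and ne: "w \<in> W" "w \<noteq> 0"
  obtains e c where "e \<in> W" "norm e = 1" "A e = c *\<^sub>R e"
proof -
  have "w /\<^sub>R norm w \<in> {b \<in> W. norm b = 1}" using W ne by (simp add: subspace_scale)
  then have "{b \<in> W. norm b = 1} \<noteq> {}" by blast
  moreover have "continuous_on {b \<in> W. norm b = 1} (\<lambda>b. A b \<bullet> b)"
    by (intro continuous_intros continuous_on_subset[OF cont]) auto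
  ultimately obtain e where e: "e \<in> W" "norm e = 1"
    and max: "\<And>b. b \<in> W \<Longrightarrow> norm b = 1 \<Longrightarrow> A b \<bullet> b \<le> A e \<bullet> e"
    using continuous_attains_sup[OF cpt] by blast
  define c where "c = A e \<bullet> e"
  have max': "A b \<bullet> b \<le> c * (b \<bullet> b)" if "b \<in> W" for b
  proof (cases "b = 0")
    case False
    have "A (b /\<^sub>R norm b) \<bullet> (b /\<^sub>R norm b) \<le> c"
      using max[of "b /\<^sub>R norm b"] W that False unfolding c_def by (simp add: subspace_scale)
    then have "(A b \<bullet> b) / (norm b)\<^sup>2 \<le> c"
      by (simp add: linear_scale[OF lin] power2_eq_square divide_inverse mult_ac)
    then show ?thesis using False by (simp add: pos_divide_le_eq power2_norm_eq_inner)
  qed (simp add: linear_0[OF lin])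
  have ee: "e \<bullet> e = 1" using e by (simp add: norm_eq_1)
  have orth: "(A e - c *\<^sub>R e) \<bullet> f = 0" if "f \<in> W" for f
  proof (rule linear_coeff_zero_of_quadratic_bound[of _ "A f \<bullet> f - c * (f \<bullet> f)"])
    fix t :: real
    have "A (e + t *\<^sub>R f) \<bullet> (e + t *\<^sub>R f) \<le> c * ((e + t *\<^sub>R f) \<bullet> (e + t *\<^sub>R f))"
      by (rule max') (use W e that in \<open>simp add: subspace_add subspace_scale\<close>)
    moreover have "A f \<bullet> e = A e \<bullet> f" using sym[of f e] by (simp add: inner_commute)
    ultimately show "2 * t * ((A e - c *\<^sub>R e) \<bullet> f) + t\<^sup>2 * (A f \<bullet> f - c * (f \<bullet> f)) \<le> 0"
      by (simp add: linear_add[OF lin] linear_scale[OF lin] inner_add_left inner_add_right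
          inner_diff_left inner_commute[of f e] power2_eq_square algebra_simps ee flip: c_def)
  qed
  have "A e - c *\<^sub>R e \<in> W" using W e by (simp add: subspace_diff subspace_scale)
  from orth[OF this] have "A e = c *\<^sub>R e" by simp
  with e that show ?thesis by blast
qed

text \<open>
  The eigenvectors found one after another in the orthogonal complements of the previous ones
  exhaust the subspace: a maximal orthonormal set of eigenvectors has trivial complement.
\<close>

lemma finite_spectral_theorem:
  fixes A :: "'h::real_inner \<Rightarrow> 'h"
  assumes lin: "linear A" and sym: "\<And>b c. A b \<bullet> c = b \<bullet> A c" and cont: "continuous_on UNIV A"
    and B: "finite B" "\<And>b. b \<in> span B \<Longrightarrow> A b \<in> span B"
  shows "\<exists>E. finite E \<and> E \<subseteq> span B \<and> orthonormal_family E (\<lambda>x. x) \<and>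
    (\<forall>e\<in>E. \<exists>c. A e = c *\<^sub>R e) \<and> (\<forall>b\<in>span B. (\<Sum>e\<in>E. (e \<bullet> b) *\<^sub>R e) = b)"
proof -
  obtain E where E: "finite E" "E \<subseteq> span B" "\<forall>e\<in>E. \<exists>c. A e = c *\<^sub>R e" "orthonormal_family E (\<lambda>x. x)"
    and max: "\<And>e. e \<in> span B \<Longrightarrow> norm e = 1 \<Longrightarrow> \<exists>c. A e = c *\<^sub>R e \<Longrightarrow> \<exists>f\<in>E. f \<bullet> e \<noteq> 0"
    using maximal_orthonormal_set[OF B(1), of "\<lambda>e. \<exists>c. A e = c *\<^sub>R e"] by metis
  have ex: "(\<Sum>e\<in>E. (e \<bullet> b) *\<^sub>R e) = b" if b: "b \<in> span B" for b
  proof (rule ccontr)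
    define W where "W = {b \<in> span B. \<forall>e\<in>E. e \<bullet> b = 0}"
    define w where "w = b - (\<Sum>e\<in>E. (e \<bullet> b) *\<^sub>R e)"
    assume "(\<Sum>e\<in>E. (e \<bullet> b) *\<^sub>R e) \<noteq> b"
    then have w0: "w \<noteq> 0" by (simp add: w_def)
    have "w \<in> span B" unfolding w_def
      by (intro span_diff span_sum span_scale b) (use E in auto)
    moreover have "e \<bullet> w = 0" if "e \<in> E" for e
      using inner_orthonormal_sum[OF E(4,1) that] by (simp add: w_def inner_diff_right)
    ultimately have wW: "w \<in> W" by (simp add: W_def)
    have sub: "subspace W"
      unfolding subspace_def W_def
      by (auto simp: span_zero span_add span_scale inner_add_right)
    have inv: "A b \<in> W" if "b \<in> W" for b
    proof -
      have "e \<bullet> A b = 0" if "e \<in> E" for e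
      proof -
        obtain c where "A e = c *\<^sub>R e" using bspec[OF E(3) \<open>e \<in> E\<close>] by (rule exE)
        then have "e \<bullet> A b = c * (e \<bullet> b)" using sym[of e b] by simp
        then show ?thesis using \<open>b \<in> W\<close> that by (simp add: W_def)
      qed
      then show ?thesis using that B(2) by (simp add: W_def)
    qed
    have "{b \<in> W. norm b = 1} = {b \<in> span B. norm b = 1} \<inter> (\<Inter>e\<in>E. {b. e \<bullet> b = 0})"
      by (auto simp: W_def)
    moreover have "closed (\<Inter>e\<in>E. {b. e \<bullet> b = 0})"
      by (intro closed_INT ballI closed_Collect_eq continuous_intros)
    ultimately have cpt: "compact {b \<in> W. norm b = 1}"
      using compact_span_sphere[OF B(1)] by (simp add: compact_Int_closed)
    obtain e c where e: "e \<in> W" "norm e = 1" "A e = c *\<^sub>R e"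
      by (rule eigenvector_in_invariant_subspace[OF lin sym sub inv cpt cont wW w0])
    have "\<exists>f\<in>E. f \<bullet> e \<noteq> 0" by (rule max) (use e in \<open>auto simp: W_def\<close>)
    then show False using e by (simp add: W_def)
  qed
  then show ?thesis using E by (intro exI[of _ E]) simp
qed

section \<open>Functional calculus of finite rank operators\<close>

text \<open>
  An operator of finite rank, given by its nonzero eigenvalues \<open>t e\<close> and eigenvectors \<open>e \<in> E\<close>. The
  operator \<open>fcalc f\<close> is \<open>f(A)\<close>; the orthogonal complement of \<open>E\<close> is the kernel of \<open>A\<close>, on which
  \<open>f(A)\<close> is multiplication by \<open>f 0\<close>.
\<close>

locale finite_spectral =
  fixes A :: "'h::real_inner \<Rightarrow> 'h" and E :: "'h set" and t :: "'h \<Rightarrow> real"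
  assumes finE: "finite E" and onE: "orthonormal_family E (\<lambda>x. x)"
    and tpos: "\<And>e. e \<in> E \<Longrightarrow> 0 < t e"
    and A_eq: "\<And>b. A b = (\<Sum>e\<in>E. (t e * (e \<bullet> b)) *\<^sub>R e)"
begin

definition proj :: "'h \<Rightarrow> 'h" where "proj b = (\<Sum>e\<in>E. (e \<bullet> b) *\<^sub>R e)"

definition fcalc :: "(real \<Rightarrow> real) \<Rightarrow> 'h \<Rightarrow> 'h" where
  "fcalc f b = (\<Sum>e\<in>E. (f (t e) * (e \<bullet> b)) *\<^sub>R e) + f 0 *\<^sub>R (b - proj b)"

lemma inner_proj: "e \<in> E \<Longrightarrow> e \<bullet> proj b = e \<bullet> b"
  unfolding proj_def by (rule inner_orthonormal_sum[OF onE finE])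

lemma inner_fcalc: "e \<in> E \<Longrightarrow> e \<bullet> fcalc f b = f (t e) * (e \<bullet> b)"
  using inner_orthonormal_sum[OF onE finE, of e "\<lambda>e. f (t e) * (e \<bullet> b)"]
  by (simp add: fcalc_def inner_add_right inner_diff_right inner_proj)

lemma proj_fcalc: "proj (fcalc f b) = (\<Sum>e\<in>E. (f (t e) * (e \<bullet> b)) *\<^sub>R e)"
  unfolding proj_def by (rule sum.cong) (simp_all add: inner_fcalc)

lemma fcalc_add: "fcalc f (b + c) = fcalc f b + fcalc f c"
  by (simp add: fcalc_def proj_def inner_add_right algebra_simps sum.distrib scaleR_add_left
      scaleR_add_right)

lemma fcalc_scale: "fcalc f (a *\<^sub>R b) = a *\<^sub>R fcalc f b"
  by (simp add: fcalc_def proj_def scaleR_sum_right scaleR_add_right scaleR_diff_right mult_ac)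

lemma fcalc_diff: "fcalc f (b - c) = fcalc f b - fcalc f c"
  using fcalc_add[of f b "- c"] fcalc_scale[of f "-1" c] by simp

lemma fcalc_add_fun: "fcalc (\<lambda>x. f x + g x) b = fcalc f b + fcalc g b"
  by (simp add: fcalc_def algebra_simps sum.distrib scaleR_add_left)

lemma fcalc_scale_fun: "fcalc (\<lambda>x. a * f x) b = a *\<^sub>R fcalc f b"
  by (simp add: fcalc_def scaleR_sum_right scaleR_add_right mult_ac)

lemma fcalc_diff_fun: "fcalc (\<lambda>x. f x - g x) b = fcalc f b - fcalc g b"
  using fcalc_add_fun[of f "\<lambda>x. -1 * g x" b] fcalc_scale_fun[of "-1" g b] by simp

lemma fcalc_one: "fcalc (\<lambda>_. 1) b = b"
  by (simp add: fcalc_def proj_def)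

lemma fcalc_id: "fcalc (\<lambda>x. x) b = A b"
  by (simp add: fcalc_def A_eq)

lemma fcalc_comp: "fcalc f (fcalc g b) = fcalc (\<lambda>x. f x * g x) b"
proof -
  have "fcalc g b - proj (fcalc g b) = g 0 *\<^sub>R (b - proj b)"
    unfolding proj_fcalc by (simp add: fcalc_def)
  moreover have "(\<Sum>e\<in>E. (f (t e) * (e \<bullet> fcalc g b)) *\<^sub>R e)
      = (\<Sum>e\<in>E. ((f (t e) * g (t e)) * (e \<bullet> b)) *\<^sub>R e)"
    by (rule sum.cong) (simp_all add: inner_fcalc)
  ultimately show ?thesis
    unfolding fcalc_def[of f "fcalc g b"] fcalc_def[of "\<lambda>x. f x * g x"] by simp
qed

lemma fcalc_A: "fcalc f (A b) = A (fcalc f b)"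
  unfolding fcalc_id[symmetric] fcalc_comp by (simp add: mult.commute)

lemma A_fcalc: "A (fcalc f b) = fcalc (\<lambda>x. x * f x) b"
  unfolding fcalc_id[symmetric] fcalc_comp ..

lemma A_diff: "A (b - c) = A b - A c"
  unfolding fcalc_id[symmetric] by (rule fcalc_diff)

lemma norm_fcalc:
  "(norm (fcalc f b))\<^sup>2 = (\<Sum>e\<in>E. (f (t e))\<^sup>2 * (e \<bullet> b)\<^sup>2) + (f 0)\<^sup>2 * (norm (b - proj b))\<^sup>2"
proof -
  have "fcalc f b - proj (fcalc f b) = f 0 *\<^sub>R (b - proj b)"
    unfolding proj_fcalc by (simp add: fcalc_def)
  then have "(norm (fcalc f b - proj (fcalc f b)))\<^sup>2 = (f 0)\<^sup>2 * (norm (b - proj b))\<^sup>2"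
    by (simp add: power_mult_distrib)
  moreover have "(\<Sum>e\<in>E. (e \<bullet> fcalc f b)\<^sup>2) = (\<Sum>e\<in>E. (f (t e))\<^sup>2 * (e \<bullet> b)\<^sup>2)"
    by (rule sum.cong) (simp_all add: inner_fcalc power_mult_distrib)
  ultimately show ?thesis
    using orthonormal_pythagoras[OF onE finE, of "fcalc f b"] by (simp add: proj_def)
qed

lemma norm_fcalc_mono:
  assumes "\<And>e. e \<in> E \<Longrightarrow> \<bar>f (t e)\<bar> \<le> \<bar>g (t e)\<bar>" and "\<bar>f 0\<bar> \<le> \<bar>g 0\<bar>"
  shows "norm (fcalc f b) \<le> norm (fcalc g b)"
proof -
  have "(norm (fcalc f b))\<^sup>2 \<le> (norm (fcalc g b))\<^sup>2"
    unfolding norm_fcalc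
    by (intro add_mono sum_mono mult_right_mono) (use assms in \<open>auto simp: abs_le_square_iff\<close>)
  then show ?thesis by (rule power2_le_imp_le) simp
qed

lemma norm_fcalc_bound:
  assumes "\<And>e. e \<in> E \<Longrightarrow> \<bar>f (t e)\<bar> \<le> B" and "\<bar>f 0\<bar> \<le> B"
  shows "norm (fcalc f b) \<le> B * norm b"
proof -
  have B: "B \<ge> 0" using assms(2) by linarith
  have "norm (fcalc f b) \<le> norm (fcalc (\<lambda>x. B * 1) b)"
    by (rule norm_fcalc_mono) (use assms in \<open>auto intro: order_trans[OF _ abs_ge_self]\<close>)
  then show ?thesis unfolding fcalc_scale_fun fcalc_one using B by simp
qed

text \<open>
  A vector in the range of \<open>A\<close> has no component in the kernel, so only the values of \<open>f\<close> at
  eigenvalues that occur in \<open>b\<close> enter.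
\<close>

lemma fcalc_cong_range:
  assumes "proj b = b" and "\<And>e. e \<in> E \<Longrightarrow> (e \<bullet> b) = 0 \<or> f (t e) = g (t e)"
  shows "fcalc f b = fcalc g b"
  unfolding fcalc_def using assms by (auto intro!: sum.cong)

lemma norm_fcalc_bound_range:
  assumes "proj b = b" and "\<And>e. e \<in> E \<Longrightarrow> \<bar>f (t e)\<bar> \<le> B" and "B \<ge> 0"
  shows "norm (fcalc f b) \<le> B * norm b"
proof -
  let ?g = "\<lambda>x. if x = 0 then 0 else f x"
  have "fcalc f b = fcalc ?g b" by (rule fcalc_cong_range[OF assms(1)]) (use tpos in force)
  also have "norm \<dots> \<le> B * norm b" by (rule norm_fcalc_bound) (use assms in auto)
  finally show ?thesis .
qed

lemma inner_fcalc_range: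
  assumes "proj b = b"
  shows "fcalc f b \<bullet> fcalc g b = (\<Sum>e\<in>E. (e \<bullet> b)\<^sup>2 * f (t e) * g (t e))"
  unfolding fcalc_def using assms
  by (simp add: inner_orthonormal_sums[OF onE finE] power2_eq_square mult_ac)

lemma norm_fcalc_range:
  assumes "proj b = b"
  shows "(norm (fcalc f b))\<^sup>2 = (\<Sum>e\<in>E. (e \<bullet> b)\<^sup>2 * (f (t e))\<^sup>2)"
  by (simp add: norm_fcalc assms mult.commute)

lemma proj_fcalc_range:
  assumes "proj b = b" shows "proj (fcalc f b) = fcalc f b"
  unfolding proj_fcalc unfolding fcalc_def using assms by simp

lemma proj_A: "proj (A b) = A b"
  unfolding fcalc_id[symmetric] proj_fcalc unfolding fcalc_def by simp

lemma proj_diff: "proj (b - c) = proj b - proj c"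
  by (simp add: proj_def inner_diff_right scaleR_diff_left sum_subtractf)

lemma A_pow: "(A ^^ k) b = fcalc (\<lambda>x. x ^ k) b"
  by (induction k) (simp_all add: fcalc_one A_fcalc)

lemma fcalc_sum_fun: "finite I \<Longrightarrow> fcalc (\<lambda>x. \<Sum>i\<in>I. f i x) b = (\<Sum>i\<in>I. fcalc (f i) b)"
proof (induction I rule: finite_induct)
  case empty
  show ?case by (simp add: fcalc_def)
next
  case (insert i I)
  then show ?case by (simp add: fcalc_add_fun)
qed

lemma fcalc_poly: "fcalc (poly q) b = (\<Sum>i\<le>degree q. coeff q i *\<^sub>R (A ^^ i) b)"
proof -
  have "fcalc (poly q) b = fcalc (\<lambda>x. \<Sum>i\<le>degree q. coeff q i * x ^ i) b"
    by (simp add: poly_altdef[abs_def])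
  then show ?thesis by (simp add: fcalc_sum_fun fcalc_scale_fun A_pow)
qed

text \<open>
  The degree bound is expressed by vanishing coefficients, so that it admits the zero polynomial,
  also for \<open>m = 0\<close>.
\<close>

lemma krylov_iff_poly:
  "c \<in> krylov A r m \<longleftrightarrow> (\<exists>q. (\<forall>i\<ge>m. coeff q i = 0) \<and> c = fcalc (poly q) r)"
proof
  assume "c \<in> krylov A r m"
  then show "\<exists>q. (\<forall>i\<ge>m. coeff q i = 0) \<and> c = fcalc (poly q) r"
    unfolding krylov_def
  proof (induction rule: span_induct_alt)
    case base
    show ?case by (intro exI[of _ 0]) (simp add: fcalc_def)
  next
    case (step a x y)
    then obtain k q where k: "k < m" "x = (A ^^ k) r"
      and q: "\<forall>i\<ge>m. coeff q i = 0" "y = fcalc (poly q) r" by auto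
    have "poly (monom a k + q) = (\<lambda>x. a * x ^ k + poly q x)"
      by (rule ext) (simp add: poly_monom)
    then have "a *\<^sub>R x + y = fcalc (poly (monom a k + q)) r"
      unfolding k q A_pow by (simp add: fcalc_add_fun fcalc_scale_fun)
    moreover have "\<forall>i\<ge>m. coeff (monom a k + q) i = 0" using k q by simp
    ultimately show ?case by blast
  qed
next
  assume "\<exists>q. (\<forall>i\<ge>m. coeff q i = 0) \<and> c = fcalc (poly q) r"
  then obtain q where q: "\<forall>i\<ge>m. coeff q i = 0" "c = fcalc (poly q) r" by blast
  show "c \<in> krylov A r m"
    unfolding q fcalc_poly krylov_def
  proof (rule span_sum)
    fix i
    show "coeff q i *\<^sub>R (A ^^ i) r \<in> span ((\<lambda>k. (A ^^ k) r) ` {..<m})"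
    proof (cases "i < m")
      case True
      then show ?thesis by (intro span_scale span_base imageI) simp
    next
      case False
      then show ?thesis using q by (simp add: span_zero)
    qed
  qed
qed

end

lemma bounded_linear_sample_cov: "bounded_linear (sample_cov n x)"
  unfolding sample_cov_def
  by (intro bounded_linear_const_scaleR bounded_linear_sum bounded_linear_scaleR_const
      bounded_linear_inner_right)

lemma linear_sample_cov: "linear (sample_cov n x)"
  using bounded_linear_sample_cov by (rule bounded_linear.linear)

lemma sample_cov_symmetric: "sample_cov n x b \<bullet> c = b \<bullet> sample_cov n x c"
  by (simp add: sample_cov_def inner_sum_left inner_sum_right inner_commute mult_ac)

lemma sample_cov_in_span: "sample_cov n x b \<in> span (x ` {1..n})"
  unfolding sample_cov_def by (intro span_scale span_sum span_base imageI) auto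

lemma sample_cross_cov_in_span: "sample_cross_cov n x y \<in> span (x ` {1..n})"
  unfolding sample_cross_cov_def by (intro span_scale span_sum span_base imageI) auto

lemma inner_sample_cov_self: "sample_cov n x b \<bullet> b = (1 / real n) * (\<Sum>i=1..n. (x i \<bullet> b)\<^sup>2)"
  by (simp add: sample_cov_def inner_sum_left power2_eq_square)

lemma sample_cov_eq_0_iff:
  "sample_cov n x b = 0 \<longleftrightarrow> (\<forall>i\<in>{1..n}. x i \<bullet> b = 0)"
proof
  assume "sample_cov n x b = 0"
  then have "(1 / real n) * (\<Sum>i=1..n. (x i \<bullet> b)\<^sup>2) = 0"
    using inner_sample_cov_self[of n x b] by simp
  then show "\<forall>i\<in>{1..n}. x i \<bullet> b = 0"
    by (auto simp: sum_nonneg_eq_0_iff)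
qed (simp add: sample_cov_def)

lemma inner_zero_span:
  assumes "\<forall>b\<in>B. b \<bullet> c = 0" "d \<in> span B"
  shows "d \<bullet> c = 0"
  using assms(2)
  by (induction rule: span_induct_alt) (use assms(1) in \<open>auto simp: inner_add_left\<close>)

lemma sample_cov_injective_on_span:
  assumes "b \<in> span (x ` {1..n})" "sample_cov n x b = 0"
  shows "b = 0"
  using inner_zero_span[of "x ` {1..n}" b b] assms by (auto simp: sample_cov_eq_0_iff)

text \<open>
  The sample covariance maps into the span of the sample and is injective there, so the eigenvalues
  on the span are positive; the complement of the span is the kernel.
\<close>

lemma sample_cov_spectral:
  "\<exists>E t. finite_spectral (sample_cov n x) E t \<and>
     (\<forall>b\<in>span (x ` {1..n}). (\<Sum>e\<in>E. (e \<bullet> b) *\<^sub>R e) = b) \<and> E \<subseteq> span (x ` {1..n})"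
proof -
  let ?A = "sample_cov n x" and ?V = "span (x ` {1..n})"
  have "continuous_on UNIV ?A"
    using linear_continuous_on[OF bounded_linear_sample_cov] .
  from finite_spectral_theorem[OF linear_sample_cov sample_cov_symmetric this, of "x ` {1..n}"]
  obtain E where E: "finite E" "E \<subseteq> ?V" "orthonormal_family E (\<lambda>x. x)" "\<forall>e\<in>E. \<exists>c. ?A e = c *\<^sub>R e"
    and ex: "\<forall>b\<in>?V. (\<Sum>e\<in>E. (e \<bullet> b) *\<^sub>R e) = b"
    using sample_cov_in_span[of n x] by (auto simp del: One_nat_def)
  from E(4) obtain t where t: "\<forall>e\<in>E. ?A e = t e *\<^sub>R e" by metis
  have pos: "0 < t e" if e: "e \<in> E" for e
  proof -
    have ee: "e \<bullet> e = 1" using E(3) e by (simp add: orthonormal_family_def)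
    have "t e = ?A e \<bullet> e" using t e ee by simp
    then have "t e \<ge> 0" unfolding inner_sample_cov_self by (simp add: sum_nonneg)
    moreover have "t e \<noteq> 0"
      using sample_cov_injective_on_span[of e x n] t e E(2) ee by auto
    ultimately show ?thesis by simp
  qed
  have "?A b = (\<Sum>e\<in>E. (t e * (e \<bullet> b)) *\<^sub>R e)" for b
  proof -
    have "(\<Sum>e\<in>E. (e \<bullet> ?A b) *\<^sub>R e) = ?A b" using ex sample_cov_in_span by blast
    moreover have "e \<bullet> ?A b = t e * (e \<bullet> b)" if "e \<in> E" for e
      using sample_cov_symmetric[of n x e b] t that by simp
    ultimately show ?thesis by (simp cong: sum.cong)
  qed
  then interpret finite_spectral ?A E t
    using E pos by unfold_locales auto
  show ?thesis
    using finite_spectral_axioms ex E(2) by (intro exI[of _ E] exI[of _ t]) simp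
qed

section \<open>Residual polynomials of a discrete measure\<close>

text \<open>
  Once all positive roots are divided out, the intermediate value theorem fixes the sign of the
  cofactor on \<open>[0, \<infinity>)\<close>.
\<close>

lemma poly_split_positive_roots:
  fixes p :: "real poly"
  assumes "poly p 0 > 0"
  shows "\<exists>xs g. (\<forall>x\<in>set xs. 0 < x) \<and> p = (\<Prod>x\<leftarrow>xs. [:1, - (1 / x):]) * g \<and>
           (\<forall>t\<ge>0. 0 < poly g t)"
  using assms
proof (induction "degree p" arbitrary: p rule: less_induct)
  case (less p)
  show ?case
  proof (cases "\<exists>x>0. poly p x = 0")
    case True
    then obtain x where x: "x > 0" "poly p x = 0" by blast
    then obtain h where h: "p = [:- x, 1:] * h" by (metis dvdE poly_eq_0_iff_dvd)
    define h' where "h' = smult (- x) h"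
    have "[:- x, 1:] = smult (- x) [:1, - (1 / x):]" using x by simp
    then have ph: "p = [:1, - (1 / x):] * h'"
      unfolding h h'_def by (simp only: mult_smult_left mult_smult_right)
    have "p \<noteq> 0" using less.prems by auto
    then have "h' \<noteq> 0" using ph by auto
    then have "degree h' < degree p" unfolding ph using x by (subst degree_mult_eq) auto
    moreover have "poly h' 0 > 0" using less.prems unfolding ph by simp
    ultimately obtain xs g where "\<forall>x\<in>set xs. 0 < x" "h' = (\<Prod>x\<leftarrow>xs. [:1, - (1 / x):]) * g"
      "\<forall>t\<ge>0. 0 < poly g t"
      using less.hyps by blast
    then show ?thesis
      using x ph by (intro exI[of _ "x # xs"] exI[of _ g])
        (simp add: mult.assoc del: mult_pCons_left)
  next
    case False
    have "0 < poly p t" if "t \<ge> 0" for t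
    proof (rule ccontr)
      assume neg: "\<not> 0 < poly p t"
      then have "t > 0" using less.prems that by (cases "t = 0") auto
      have "\<exists>x\<ge>0. x \<le> t \<and> poly p x = 0"
        by (rule IVT2) (use neg less.prems that in \<open>auto simp: poly_isCont\<close>)
      then obtain x where "0 \<le> x" "poly p x = 0" by blast
      then show False using False less.prems by (cases "x = 0") auto
    qed
    then show ?thesis by (intro exI[of _ "[]"] exI[of _ p]) auto
  qed
qed

lemma poly_root_product: "poly (\<Prod>x\<leftarrow>xs. [:1, - (1 / x):]) t = (\<Prod>x\<leftarrow>xs. 1 - t / x)" for t :: real
  by (induction xs) (simp_all add: algebra_simps)

lemma root_product_at_0 [simp]: "(\<Prod>x\<leftarrow>xs. 1 - 0 / x) = (1::real)"
  by (induction xs) simp_all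

lemma degree_root_product:
  "\<forall>x\<in>set xs. 0 < (x::real) \<Longrightarrow> degree (\<Prod>x\<leftarrow>xs. [:1, - (1 / x):]) = length xs \<and>
     (\<Prod>x\<leftarrow>xs. [:1, - (1 / x):]) \<noteq> 0"
proof (induction xs)
  case (Cons a xs)
  then show ?case by (simp add: degree_mult_eq del: mult_pCons_left)
qed simp

text \<open>
  Degree less than \<open>m\<close>, with the zero polynomial included also for \<open>m = 0\<close>.
\<close>

definition below_deg :: "nat \<Rightarrow> real poly \<Rightarrow> bool" where
  "below_deg m q \<longleftrightarrow> (\<forall>i\<ge>m. coeff q i = 0)"

lemma below_deg_mono: "below_deg m q \<Longrightarrow> m \<le> k \<Longrightarrow> below_deg k q"
  by (simp add: below_deg_def)

lemma below_deg_pCons: "below_deg (Suc m) (pCons c q) \<longleftrightarrow> below_deg m q"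
  unfolding below_deg_def by (auto simp: coeff_pCons split: nat.splits)

lemma below_deg_diff: "below_deg m p \<Longrightarrow> below_deg m q \<Longrightarrow> below_deg m (p - q)"
  by (simp add: below_deg_def)

lemma below_deg_smult: "below_deg m p \<Longrightarrow> below_deg m (smult c p)"
  by (simp add: below_deg_def)

lemma below_deg_minus: "below_deg m p \<Longrightarrow> below_deg m (- p)"
  by (simp add: below_deg_def)

lemma below_deg_sum: "(\<And>i. i \<in> I \<Longrightarrow> below_deg m (f i)) \<Longrightarrow> below_deg m (sum f I)"
  by (simp add: below_deg_def coeff_sum)

text \<open>
  A measure with masses \<open>\<rho> e\<close> at the points \<open>t e\<close>. It will be the spectral measure of the data, with
  \<open>\<rho> e = (e \<bullet> r)\<^sup>2\<close>, so that \<open>wsum f g\<close> is the inner product of \<open>f(A) r\<close> and \<open>g(A) r\<close>.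
\<close>

locale discrete_measure =
  fixes E :: "'e set" and \<rho> t :: "'e \<Rightarrow> real"
  assumes finite_E: "finite E" and rho_nonneg: "\<And>e. e \<in> E \<Longrightarrow> 0 \<le> \<rho> e"
    and t_pos: "\<And>e. e \<in> E \<Longrightarrow> 0 < t e"
begin

definition wsum :: "(real \<Rightarrow> real) \<Rightarrow> (real \<Rightarrow> real) \<Rightarrow> real" where
  "wsum f g = (\<Sum>e\<in>E. \<rho> e * f (t e) * g (t e))"

text \<open>
  The optimality conditions for minimizing the sum of squares over the polynomials of degree at most
  \<open>k\<close> with value \<open>1\<close> at \<open>0\<close>: the admissible variations are the multiples \<open>x g\<close> with \<open>g\<close> of degree
  less than \<open>k\<close>.
\<close>

definition residual_poly :: "nat \<Rightarrow> real poly \<Rightarrow> bool" where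
  "residual_poly k p \<longleftrightarrow> poly p 0 = 1 \<and> below_deg (Suc k) p \<and>
     (\<forall>g. below_deg k g \<longrightarrow> wsum (poly p) (\<lambda>x. x * poly g x) = 0)"

text \<open>
  If there were fewer than \<open>k\<close> positive roots, their product \<open>q\<close> would be an admissible test
  polynomial. Since \<open>p q\<close> is nonnegative on \<open>[0, \<infinity>)\<close>, the orthogonality relation would be a vanishing
  sum of nonnegative terms, and \<open>p\<close> would vanish on the support of the measure.
\<close>

lemma residual_poly_roots:
  assumes p: "residual_poly k p" and pos: "wsum (poly p) (poly p) > 0"
  shows "\<exists>xs. length xs = k \<and> (\<forall>x\<in>set xs. 0 < x) \<and> p = (\<Prod>x\<leftarrow>xs. [:1, - (1 / x):])"
proof -
  have p0: "poly p 0 = 1" using p by (simp add: residual_poly_def)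
  obtain xs g where xs: "\<forall>x\<in>set xs. 0 < x" and pg: "p = (\<Prod>x\<leftarrow>xs. [:1, - (1 / x):]) * g"
    and g: "\<forall>t\<ge>0. 0 < poly g t"
    using poly_split_positive_roots[of p] p0 by auto
  define q where "q = (\<Prod>x\<leftarrow>xs. [:1, - (1 / x):])"
  have q: "degree q = length xs" "q \<noteq> 0" using degree_root_product[OF xs] by (auto simp: q_def)
  have pq: "p = q * g" using pg q_def by simp
  have "g \<noteq> 0" using g by (metis order_refl less_irrefl poly_0)
  have "\<not> length xs < k"
  proof
    assume "length xs < k"
    then have "below_deg k q" using q by (simp add: below_deg_def coeff_eq_0)
    then have "wsum (poly p) (\<lambda>x. x * poly q x) = 0" using p by (simp add: residual_poly_def)
    then have "(\<Sum>e\<in>E. \<rho> e * t e * poly g (t e) * (poly q (t e))\<^sup>2) = 0"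
      unfolding wsum_def pq by (simp add: power2_eq_square mult_ac)
    moreover have nn: "\<forall>e\<in>E. 0 \<le> \<rho> e * t e * poly g (t e) * (poly q (t e))\<^sup>2"
      using rho_nonneg t_pos g by (auto intro!: mult_nonneg_nonneg simp: less_imp_le)
    ultimately have "\<forall>e\<in>E. \<rho> e * t e * poly g (t e) * (poly q (t e))\<^sup>2 = 0"
      using finite_E by (simp add: sum_nonneg_eq_0_iff)
    moreover have "t e \<noteq> 0 \<and> poly g (t e) \<noteq> 0" if "e \<in> E" for e
      using t_pos[OF that] g by (metis less_imp_le less_irrefl)
    ultimately have "\<forall>e\<in>E. \<rho> e = 0 \<or> poly q (t e) = 0" by auto
    then have "wsum (poly p) (poly p) = 0"
      unfolding wsum_def pq by (intro sum.neutral) auto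
    with pos show False by simp
  qed
  moreover have "degree p \<le> k" using p unfolding residual_poly_def below_deg_def
    by (intro degree_le) auto
  moreover have "degree p = length xs + degree g"
    unfolding pq using q \<open>g \<noteq> 0\<close> by (simp add: degree_mult_eq)
  ultimately have "length xs = k" "degree g = 0" by auto
  then obtain c where c: "g = [:c:]" by (metis degree_eq_zeroE)
  have "poly q 0 = 1" unfolding q_def poly_root_product by (rule root_product_at_0)
  then have "c = 1" using p0 unfolding pq c by simp
  then have "p = q" using pq c by simp
  with \<open>length xs = k\<close> xs show ?thesis unfolding q_def by blast
qed

end

lemma prod_list_exp_bound:
  fixes xs :: "real list"
  assumes "\<forall>x\<in>set xs. 0 < x" "\<forall>x\<in>set xs. t \<le> x"
  shows "0 \<le> (\<Prod>x\<leftarrow>xs. 1 - t / x)" "(\<Prod>x\<leftarrow>xs. 1 - t / x) \<le> exp (- (t * (\<Sum>x\<leftarrow>xs. 1 / x)))"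
proof -
  have "0 \<le> (\<Prod>x\<leftarrow>xs. 1 - t / x) \<and> (\<Prod>x\<leftarrow>xs. 1 - t / x) \<le> exp (- (t * (\<Sum>x\<leftarrow>xs. 1 / x)))"
    using assms
  proof (induction xs)
    case (Cons a xs)
    have a: "0 \<le> 1 - t / a" using Cons.prems by (simp add: field_simps)
    have "1 - t / a \<le> exp (- (t / a))" using exp_ge_add_one_self[of "- (t / a)"] by simp
    then have "(1 - t / a) * (\<Prod>x\<leftarrow>xs. 1 - t / x)
        \<le> exp (- (t / a)) * exp (- (t * (\<Sum>x\<leftarrow>xs. 1 / x)))"
      using a Cons by (intro mult_mono) auto
    also have "\<dots> = exp (- (t * (\<Sum>x\<leftarrow>a # xs. 1 / x)))"
      by (simp add: exp_add[symmetric] algebra_simps)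
    finally show ?case using a Cons by auto
  qed simp
  then show "0 \<le> (\<Prod>x\<leftarrow>xs. 1 - t / x)" "(\<Prod>x\<leftarrow>xs. 1 - t / x) \<le> exp (- (t * (\<Sum>x\<leftarrow>xs. 1 / x)))"
    by auto
qed

text \<open>
  The Weierstrass product inequality. For a residual polynomial \<open>1 - t q(t)\<close> the lower bound says
  that the filter \<open>q(t)\<close> is at most the sum of the reciprocal roots.
\<close>

lemma prod_list_linear_bound:
  fixes xs :: "real list"
  assumes "\<forall>x\<in>set xs. 0 < x" "0 \<le> t" "t * (\<Sum>x\<leftarrow>xs. 1 / x) \<le> 1"
  shows "1 - t * (\<Sum>x\<leftarrow>xs. 1 / x) \<le> (\<Prod>x\<leftarrow>xs. 1 - t / x) \<and> (\<Prod>x\<leftarrow>xs. 1 - t / x) \<le> 1"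
  using assms
proof (induction xs)
  case (Cons a xs)
  let ?S = "\<Sum>x\<leftarrow>xs. 1 / x" and ?P = "\<Prod>x\<leftarrow>xs. 1 - t / x"
  have S: "?S \<ge> 0" using Cons.prems by (intro sum_list_nonneg) auto
  have ta: "0 \<le> t / a" using Cons.prems by simp
  have le: "t / a + t * ?S \<le> 1" using Cons.prems by (simp add: algebra_simps)
  moreover have "0 \<le> t * ?S" using S Cons.prems by simp
  ultimately have "t * ?S \<le> 1" "t / a \<le> 1" using ta by linarith+
  then have IH: "1 - t * ?S \<le> ?P" "?P \<le> 1" using Cons by auto
  have "0 \<le> ?P" using IH \<open>t * ?S \<le> 1\<close> by linarith
  have "(1 - t / a) * ?P \<le> 1 * 1"
    using IH ta \<open>t / a \<le> 1\<close> \<open>0 \<le> ?P\<close> by (intro mult_mono) auto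
  moreover have "(1 - t / a) * (1 - t * ?S) \<le> (1 - t / a) * ?P"
    using IH \<open>t / a \<le> 1\<close> by (intro mult_left_mono) auto
  moreover have "0 \<le> (t / a) * (t * ?S)" using ta S Cons.prems by (intro mult_nonneg_nonneg) auto
  ultimately show ?case by (simp add: algebra_simps)
qed simp


context discrete_measure
begin

lemma wsum_sum_left: "wsum (\<lambda>x. \<Sum>i\<in>I. f i x) g = (\<Sum>i\<in>I. wsum (f i) g)"
  unfolding wsum_def by (subst sum.swap) (simp add: sum_distrib_left sum_distrib_right)

lemma wsum_diff_left: "wsum (\<lambda>x. f x - h x) g = wsum f g - wsum h g"
  unfolding wsum_def by (simp add: algebra_simps sum_subtractf)

lemma wsum_scale_left: "wsum (\<lambda>x. c * f x) g = c * wsum f g"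
  unfolding wsum_def by (simp add: sum_distrib_left mult_ac)

lemma wsum_nonneg_zero:
  assumes "wsum f (\<lambda>x. h x * f x) = 0" "\<And>e. e \<in> E \<Longrightarrow> 0 < h (t e)" "e \<in> E"
  shows "\<rho> e = 0 \<or> f (t e) = 0"
proof -
  have "(\<Sum>e\<in>E. \<rho> e * h (t e) * (f (t e))\<^sup>2) = 0"
    using assms(1) unfolding wsum_def by (simp add: power2_eq_square mult_ac)
  moreover have "\<forall>e\<in>E. 0 \<le> \<rho> e * h (t e) * (f (t e))\<^sup>2"
    using rho_nonneg assms(2) by (auto intro!: mult_nonneg_nonneg simp: less_imp_le)
  ultimately have "\<rho> e * h (t e) * (f (t e))\<^sup>2 = 0"
    using finite_E assms(3) by (simp add: sum_nonneg_eq_0_iff)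
  then show ?thesis using assms(2)[OF assms(3)] by auto
qed

lemma wsum_weighted_nonneg:
  assumes "\<And>e. e \<in> E \<Longrightarrow> 0 < h (t e)"
  shows "0 \<le> wsum f (\<lambda>x. h x * f x)"
proof -
  have "wsum f (\<lambda>x. h x * f x) = (\<Sum>e\<in>E. \<rho> e * h (t e) * (f (t e))\<^sup>2)"
    unfolding wsum_def by (simp add: power2_eq_square mult_ac)
  also have "\<dots> \<ge> 0"
    using rho_nonneg assms by (auto intro!: sum_nonneg mult_nonneg_nonneg simp: less_imp_le)
  finally show ?thesis .
qed

lemma wsum_weighted_pos:
  assumes "wsum f f > 0" "\<And>e. e \<in> E \<Longrightarrow> 0 < h (t e)"
  shows "0 < wsum f (\<lambda>x. h x * f x)"
proof -
  have "wsum f (\<lambda>x. h x * f x) \<noteq> 0"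
  proof
    assume "wsum f (\<lambda>x. h x * f x) = 0"
    from wsum_nonneg_zero[OF this assms(2)] have "wsum f f = 0"
      unfolding wsum_def by (intro sum.neutral) auto
    with assms(1) show False by simp
  qed
  moreover have "0 \<le> wsum f (\<lambda>x. h x * f x)"
    by (rule wsum_weighted_nonneg) (fact assms(2))
  ultimately show ?thesis by (simp add: less_le)
qed

text \<open>
  Let \<open>z\<close> be the smallest root and \<open>p(x) = (1 - x/z) u(x)\<close>. Orthogonality against \<open>x u\<close> permits
  replacing the square of \<open>1 - x/z\<close> by its first power in the sum of squares. This makes all terms
  beyond \<open>z\<close> negative, and below \<open>z\<close> every factor satisfies \<open>0 \<le> 1 - x/x\<^sub>i \<le> exp (- x/x\<^sub>i)\<close>.
\<close>

lemma residual_norm_exp_bound: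
  assumes p: "residual_poly k p" and len: "length xs = k" and pos: "\<forall>x\<in>set xs. 0 < x"
    and pxs: "p = (\<Prod>x\<leftarrow>xs. [:1, - (1 / x):])"
  shows "wsum (poly p) (poly p) \<le> (\<Sum>e\<in>E. \<rho> e * exp (- (t e * (\<Sum>x\<leftarrow>xs. 1 / x))))"
proof (cases "xs = []")
  case True
  then show ?thesis unfolding wsum_def pxs by simp
next
  case False
  define z where "z = Min (set xs)"
  define ys where "ys = remove1 z xs"
  have z: "z \<in> set xs" "\<And>x. x \<in> set xs \<Longrightarrow> z \<le> x" "z > 0"
    using False pos by (auto simp: z_def)
  have ys: "set ys \<subseteq> set xs" "length ys = k - 1"
    using z len by (auto simp: ys_def length_remove1 set_remove1_subset)
  have kpos: "k > 0" using False len by auto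
  define u where "u = (\<Prod>x\<leftarrow>ys. [:1, - (1 / x):])"
  have mset: "mset xs = mset (z # ys)" using z by (simp add: ys_def)
  have prodmset: "(\<Prod>x\<leftarrow>xs. f x) = f z * (\<Prod>x\<leftarrow>ys. f x)" for f :: "real \<Rightarrow> real poly"
    using arg_cong[OF mset, of "\<lambda>M. prod_mset (image_mset f M)"] by (simp flip: prod_mset_prod_list)
  have summset: "(\<Sum>x\<leftarrow>xs. f x) = f z + (\<Sum>x\<leftarrow>ys. f x)" for f :: "real \<Rightarrow> real"
    using arg_cong[OF mset, of "\<lambda>M. sum_mset (image_mset f M)"] by (simp flip: sum_mset_sum_list)
  have pu: "poly p x = (1 - x / z) * poly u x" for x
    unfolding pxs prodmset u_def poly_mult by simp
  have "degree u = k - 1" using degree_root_product[of ys] ys pos unfolding u_def by auto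
  then have "below_deg k u"
    using kpos unfolding below_deg_def by (auto intro!: coeff_eq_0)
  then have "wsum (poly p) (\<lambda>x. x * poly u x) = 0" using p by (simp add: residual_poly_def)
  then have "(\<Sum>e\<in>E. \<rho> e * ((1 - t e / z) * poly u (t e)) * (t e * poly u (t e))) = 0"
    unfolding wsum_def pu .
  moreover have "(\<Sum>e\<in>E. \<rho> e * ((t e / z) * (1 - t e / z) * (poly u (t e))\<^sup>2))
      = (1 / z) * (\<Sum>e\<in>E. \<rho> e * ((1 - t e / z) * poly u (t e)) * (t e * poly u (t e)))"
    by (simp add: sum_distrib_left power2_eq_square mult_ac)
  ultimately have orth: "(\<Sum>e\<in>E. \<rho> e * ((t e / z) * (1 - t e / z) * (poly u (t e))\<^sup>2)) = 0"
    by simp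
  have "wsum (poly p) (poly p) = (\<Sum>e\<in>E. \<rho> e * ((1 - t e / z)\<^sup>2 * (poly u (t e))\<^sup>2))"
    unfolding wsum_def pu by (simp add: power2_eq_square mult_ac)
  also have "\<dots> = (\<Sum>e\<in>E. \<rho> e * ((1 - t e / z)\<^sup>2 * (poly u (t e))\<^sup>2))
      + (\<Sum>e\<in>E. \<rho> e * ((t e / z) * (1 - t e / z) * (poly u (t e))\<^sup>2))"
    unfolding orth by simp
  also have "\<dots> = (\<Sum>e\<in>E. \<rho> e * ((1 - t e / z) * (poly u (t e))\<^sup>2))"
    unfolding sum.distrib[symmetric]
    by (rule sum.cong) (simp_all add: power2_eq_square algebra_simps)
  also have "\<dots> \<le> (\<Sum>e\<in>E. \<rho> e * exp (- (t e * (\<Sum>x\<leftarrow>xs. 1 / x))))"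
  proof (intro sum_mono mult_left_mono rho_nonneg)
    fix e assume e: "e \<in> E"
    show "(1 - t e / z) * (poly u (t e))\<^sup>2 \<le> exp (- (t e * (\<Sum>x\<leftarrow>xs. 1 / x)))"
    proof (cases "t e \<le> z")
      case False
      then have "(1 - t e / z) * (poly u (t e))\<^sup>2 \<le> 0"
        using z by (intro mult_nonpos_nonneg) (auto simp: field_simps)
      then show ?thesis by (rule order_trans) simp
    next
      case True
      let ?k = "t e * (\<Sum>x\<leftarrow>ys. 1 / x)"
      have "\<forall>x\<in>set ys. t e \<le> x" using True z ys by force
      then have u: "0 \<le> poly u (t e)" "poly u (t e) \<le> exp (- ?k)"
        unfolding u_def poly_root_product
        using prod_list_exp_bound[of ys "t e"] ys pos by auto
      have "0 \<le> (\<Sum>x\<leftarrow>ys. 1 / x)" using ys pos by (intro sum_list_nonneg) (auto simp: subset_iff less_imp_le)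
      then have "exp (- ?k) \<le> 1" using t_pos[OF e] by simp
      then have "(poly u (t e))\<^sup>2 \<le> exp (- ?k)"
        using mult_mono[OF u(2) order_trans[OF u(2) \<open>exp (- ?k) \<le> 1\<close>]] u(1)
        by (simp add: power2_eq_square)
      moreover have "1 - t e / z \<le> exp (- (t e / z))"
        using exp_ge_add_one_self[of "- (t e / z)"] by simp
      ultimately have "(1 - t e / z) * (poly u (t e))\<^sup>2 \<le> exp (- (t e / z)) * exp (- ?k)"
        using True z by (intro mult_mono) auto
      also have "\<dots> = exp (- (t e * (\<Sum>x\<leftarrow>xs. 1 / x)))"
        unfolding summset by (simp add: exp_add[symmetric] algebra_simps)
      finally show ?thesis .
    qed
  qed
  finally show ?thesis .
qed

text \<open>
  The polynomials \<open>p 0, \<dots>, p k\<close> are orthogonal with respect to the density \<open>x\<close> and have value \<open>1\<close>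
  at \<open>0\<close>, so the left-hand side is the value at \<open>0\<close> of the expansion of \<open>f\<close> in this basis.
\<close>

lemma reproducing_kernel_at_0:
  assumes "\<And>j. j \<le> k \<Longrightarrow> residual_poly j (p j)"
    and "\<And>j. j \<le> k \<Longrightarrow> wsum (poly (p j)) (poly (p j)) > 0"
    and "below_deg (Suc k) f"
  shows "(\<Sum>j\<le>k. wsum (poly (p j)) (\<lambda>x. x * poly f x) / wsum (poly (p j)) (\<lambda>x. x * poly (p j) x)) = poly f 0"
  using assms
proof (induction k arbitrary: f)
  case 0
  have "degree f \<le> 0" "degree (p 0) \<le> 0"
    using 0(3) 0(1)[of 0] unfolding residual_poly_def below_deg_def
    by (auto intro!: degree_le simp del: le_zero_eq)
  then obtain c d where c: "f = [:c:]" and d: "p 0 = [:d:]" by (metis degree_eq_zeroE le_zero_eq)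
  have "d = 1" using 0(1)[of 0] d by (simp add: residual_poly_def)
  have "wsum (poly (p 0)) (\<lambda>x. x * poly (p 0) x) > 0"
    by (rule wsum_weighted_pos) (use 0 t_pos in auto)
  moreover have "poly (p 0) = (\<lambda>x. 1)" "poly f = (\<lambda>x. c)"
    using c d \<open>d = 1\<close> by (simp_all add: fun_eq_iff)
  moreover have "wsum (\<lambda>x. 1) (\<lambda>x. x * c) = c * wsum (\<lambda>x. 1) (\<lambda>x. x)"
    unfolding wsum_def by (simp add: sum_distrib_left mult_ac)
  ultimately show ?case by simp
next
  case (Suc k)
  let ?h = "\<lambda>j. wsum (poly (p j)) (\<lambda>x. x * poly (p j) x)"
  let ?c = "\<lambda>j f. wsum (poly (p j)) (\<lambda>x. x * poly f x)"
  have h: "?h j > 0" if "j \<le> Suc k" for j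
    by (rule wsum_weighted_pos) (use Suc.prems that t_pos in auto)
  define P where "P = p (Suc k)"
  have P: "residual_poly (Suc k) P" using Suc.prems by (simp add: P_def)
  \<comment> \<open>otherwise \<open>P\<close> itself would be an admissible test polynomial and \<open>P\<close> would vanish on the support\<close>
  have lead: "coeff P (Suc k) \<noteq> 0"
  proof
    assume "coeff P (Suc k) = 0"
    then have "below_deg (Suc k) P"
      using P unfolding residual_poly_def below_deg_def by (metis Suc_leI le_less)
    then have "?c (Suc k) P = 0" using P unfolding residual_poly_def P_def by blast
    with h[of "Suc k"] show False by (simp add: P_def)
  qed
  define a where "a = coeff f (Suc k) / coeff P (Suc k)"
  define f' where "f' = f - smult a P"
  have f': "below_deg (Suc k) f'"
    unfolding below_deg_def
  proof (intro allI impI)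
    fix i assume "i \<ge> Suc k"
    then show "coeff f' i = 0"
      using Suc.prems(3) P lead unfolding below_deg_def residual_poly_def f'_def a_def
      by (cases "i = Suc k") auto
  qed
  have f: "poly f x = a * poly P x + poly f' x" for x by (simp add: f'_def)
  have lin: "?c j f = a * ?c j P + ?c j f'" for j
    unfolding wsum_def f by (simp add: algebra_simps sum.distrib sum_distrib_left)
  have zero: "?c j P = 0" if "j \<le> k" for j
  proof -
    have "below_deg (Suc k) (p j)"
      using Suc.prems(1)[of j] that by (auto simp: residual_poly_def elim!: below_deg_mono)
    then have "wsum (poly P) (\<lambda>x. x * poly (p j) x) = 0" using P by (simp add: residual_poly_def)
    then show ?thesis unfolding wsum_def by (simp add: mult_ac)
  qed
  have "(\<Sum>j\<le>Suc k. ?c j f / ?h j)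
      = (\<Sum>j\<le>k. ?c j f' / ?h j) + (a * ?h (Suc k) + ?c (Suc k) f') / ?h (Suc k)"
  proof -
    have "(\<Sum>j\<le>k. ?c j f / ?h j) = (\<Sum>j\<le>k. ?c j f' / ?h j)"
      by (rule sum.cong) (simp_all add: lin zero)
    then show ?thesis using lin[of "Suc k"] by (simp add: P_def)
  qed
  also have "(\<Sum>j\<le>k. ?c j f' / ?h j) = poly f' 0"
    using Suc.prems f' by (intro Suc.IH) auto
  also have "?c (Suc k) f' = 0"
    using P f' by (simp add: residual_poly_def P_def)
  finally show ?case
    using h[of "Suc k"] P f[of 0] by (simp add: residual_poly_def)
qed

text \<open>
  The reproducing kernel at \<open>0\<close> of the preceding lemma, normalized to the value \<open>1\<close> at \<open>0\<close>. It is a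
  convex combination of residual polynomials, hence bounded wherever they are, and it is orthogonal
  with respect to the density \<open>x\<^sup>2\<close>, hence the direction of the next minimal residual step.
\<close>

definition kernel_poly :: "(nat \<Rightarrow> real poly) \<Rightarrow> nat \<Rightarrow> real poly" where
  "kernel_poly p k = smult (1 / (\<Sum>j\<le>k. 1 / wsum (poly (p j)) (\<lambda>x. x * poly (p j) x)))
     (\<Sum>j\<le>k. smult (1 / wsum (poly (p j)) (\<lambda>x. x * poly (p j) x)) (p j))"

lemma kernel_poly_props:
  assumes res: "\<And>j. j \<le> k \<Longrightarrow> residual_poly j (p j)"
    and pos: "\<And>j. j \<le> k \<Longrightarrow> wsum (poly (p j)) (poly (p j)) > 0"
  shows kernel_poly_at_0: "poly (kernel_poly p k) 0 = 1"
    and below_deg_kernel_poly: "below_deg (Suc k) (kernel_poly p k)"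
    and abs_kernel_poly_le: "\<And>x c. (\<And>j. j \<le> k \<Longrightarrow> \<bar>poly (p j) x\<bar> \<le> c) \<Longrightarrow> \<bar>poly (kernel_poly p k) x\<bar> \<le> c"
    and kernel_poly_orthogonal:
      "\<And>g. below_deg k g \<Longrightarrow> wsum (poly (kernel_poly p k)) (\<lambda>x. x * (x * poly g x)) = 0"
proof -
  let ?h = "\<lambda>j. wsum (poly (p j)) (\<lambda>x. x * poly (p j) x)"
  define H where "H = (\<Sum>j\<le>k. 1 / ?h j)"
  have h: "?h j > 0" if "j \<le> k" for j
    by (rule wsum_weighted_pos) (use pos that t_pos in auto)
  have "H > 0" unfolding H_def by (intro sum_pos) (use h in auto)
  have kp: "poly (kernel_poly p k) x = (1 / H) * (\<Sum>j\<le>k. (1 / ?h j) * poly (p j) x)" for x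
    unfolding kernel_poly_def H_def by (simp add: poly_sum)
  show "poly (kernel_poly p k) 0 = 1"
  proof -
    have "(\<Sum>j\<le>k. (1 / ?h j) * poly (p j) 0) = H"
      unfolding H_def by (rule sum.cong) (use res in \<open>auto simp: residual_poly_def\<close>)
    then show ?thesis unfolding kp using \<open>H > 0\<close> by simp
  qed
  show "below_deg (Suc k) (kernel_poly p k)"
    unfolding kernel_poly_def
    by (intro below_deg_smult below_deg_sum) (use res below_deg_mono in \<open>fastforce simp: residual_poly_def\<close>)
  show "\<bar>poly (kernel_poly p k) x\<bar> \<le> c" if c: "\<And>j. j \<le> k \<Longrightarrow> \<bar>poly (p j) x\<bar> \<le> c" for x c
  proof -
    have "\<bar>\<Sum>j\<le>k. (1 / ?h j) * poly (p j) x\<bar> \<le> (\<Sum>j\<le>k. (1 / ?h j) * c)"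
    proof (rule order_trans[OF sum_abs], rule sum_mono)
      fix j assume "j \<in> {..k}"
      then have j: "j \<le> k" by simp
      show "\<bar>(1 / ?h j) * poly (p j) x\<bar> \<le> (1 / ?h j) * c"
        unfolding abs_mult using c[OF j] h[OF j] by (intro mult_mono) auto
    qed
    also have "\<dots> = H * c" unfolding H_def by (simp add: sum_distrib_right)
    finally show ?thesis unfolding kp using \<open>H > 0\<close> by (simp add: abs_mult field_simps)
  qed
  show "wsum (poly (kernel_poly p k)) (\<lambda>x. x * (x * poly g x)) = 0" if g: "below_deg k g" for g
  proof -
    have "below_deg (Suc k) (pCons 0 g)" using g by (simp add: below_deg_pCons)
    from reproducing_kernel_at_0[OF res pos this]
    have "(\<Sum>j\<le>k. (1 / ?h j) * wsum (poly (p j)) (\<lambda>x. x * (x * poly g x))) = 0" by simp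
    then have "wsum (\<lambda>x. (1 / H) * (\<Sum>j\<le>k. (1 / ?h j) * poly (p j) x)) (\<lambda>x. x * (x * poly g x)) = 0"
      unfolding wsum_scale_left wsum_sum_left by simp
    then show ?thesis unfolding kp[abs_def] .
  qed
qed

text \<open>
  Let \<open>x d\<close> be the difference of the two residual polynomials. Like the kernel polynomial, \<open>d\<close> is
  orthogonal to lower degrees with respect to the density \<open>x\<^sup>2\<close>. Subtracting the multiple of the kernel
  with the same value at \<open>0\<close> leaves a polynomial \<open>x g'\<close> that is orthogonal to \<open>g'\<close>, so \<open>g'\<close> vanishes
  on the support of the measure.
\<close>

lemma residual_poly_update:
  assumes res: "\<And>j. j \<le> k \<Longrightarrow> residual_poly j (p j)"
    and pos: "\<And>j. j \<le> k \<Longrightarrow> wsum (poly (p j)) (poly (p j)) > 0"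
    and p': "residual_poly (Suc k) p'"
  shows "\<exists>c. \<forall>e\<in>E. \<rho> e = 0 \<or>
    poly (p k) (t e) - poly p' (t e) = c * t e * poly (kernel_poly p k) (t e)"
proof -
  let ?s = "kernel_poly p k"
  have pk: "residual_poly k (p k)" using res by simp
  have "poly (p k - p') 0 = 0" using pk p' by (simp add: residual_poly_def)
  then obtain d where d: "p k - p' = pCons 0 d"
    by (metis mult_pCons_left add.left_neutral add_0 dvdE minus_zero mult_zero_left pCons_0_0 poly_eq_0_iff_dvd smult_0_left smult_1_left)
  have "below_deg (Suc (Suc k)) (p k - p')"
    using pk p' by (intro below_deg_diff) (auto simp: residual_poly_def elim: below_deg_mono)
  then have bd: "below_deg (Suc k) d" unfolding d by (simp add: below_deg_pCons)
  define c where "c = poly d 0"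
  define g where "g = d - smult c ?s"
  have "poly g 0 = 0" unfolding g_def c_def using kernel_poly_at_0[OF res pos] by simp
  then obtain g' where g': "g = pCons 0 g'"
    by (metis mult_pCons_left add.left_neutral add_0 dvdE minus_zero mult_zero_left pCons_0_0 poly_eq_0_iff_dvd smult_0_left smult_1_left)
  have "below_deg (Suc k) g" unfolding g_def
    by (intro below_deg_diff below_deg_smult bd below_deg_kernel_poly[OF res pos])
  then have bg: "below_deg k g'" unfolding g' by (simp add: below_deg_pCons)
  have "wsum (poly (p k)) (\<lambda>x. x * poly g' x) = 0" "wsum (poly p') (\<lambda>x. x * poly g' x) = 0"
    using pk p' bg below_deg_mono[OF bg] by (auto simp: residual_poly_def)
  then have "wsum (poly (p k - p')) (\<lambda>x. x * poly g' x) = 0"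
    using wsum_diff_left[of "poly (p k)" "poly p'"] by (simp add: poly_diff[abs_def] cong: if_cong)
  then have 1: "wsum (poly d) (\<lambda>x. x * (x * poly g' x)) = 0"
    unfolding d wsum_def by (simp add: mult_ac)
  have 2: "wsum (poly ?s) (\<lambda>x. x * (x * poly g' x)) = 0"
    by (rule kernel_poly_orthogonal[OF res pos bg])
  have "wsum (poly g) (\<lambda>x. x * (x * poly g' x)) = 0"
  proof -
    have "poly g = (\<lambda>x. poly d x - c * poly ?s x)" by (rule ext) (simp add: g_def)
    then show ?thesis using 1 2 by (simp add: wsum_diff_left wsum_scale_left)
  qed
  then have "wsum (poly g') (\<lambda>x. x ^ 3 * poly g' x) = 0"
    unfolding g' wsum_def by (simp add: power3_eq_cube mult_ac)
  then have "\<rho> e = 0 \<or> poly g' (t e) = 0" if "e \<in> E" for e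
    by (rule wsum_nonneg_zero) (use t_pos that in auto)
  moreover have "poly (p k) (t e) - poly p' (t e) = t e * (c * poly ?s (t e) + t e * poly g' (t e))" for e
  proof -
    have "poly (p k) (t e) - poly p' (t e) = t e * poly d (t e)"
      using arg_cong[OF d, of "\<lambda>q. poly q (t e)"] by simp
    moreover have "poly d (t e) = c * poly ?s (t e) + t e * poly g' (t e)"
      using arg_cong[OF g', of "\<lambda>q. poly q (t e)"] by (simp add: g_def algebra_simps)
    ultimately show ?thesis by simp
  qed
  ultimately show ?thesis by (intro exI[of _ c]) (force simp: mult_ac)
qed

end

section \<open>Normal equations and measurability of the iterates\<close>

lemma krylov_subset_span: "krylov (sample_cov n x) (sample_cross_cov n x y) m \<subseteq> span (x ` {1..n})"
proof -
  have "(sample_cov n x ^^ k) (sample_cross_cov n x y) \<in> span (x ` {1..n})" for k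
    by (cases k) (simp_all add: sample_cov_in_span sample_cross_cov_in_span del: One_nat_def)
  then show ?thesis unfolding krylov_def by (intro span_minimal subspace_span) auto
qed

text \<open>
  The normal equations determine the minimizer, since the sample covariance is injective on the
  Krylov space.
\<close>

lemma pls_estimator_eqI:
  fixes n m :: nat and x :: "nat \<Rightarrow> 'h::real_inner" and y :: "nat \<Rightarrow> real"
  defines "A \<equiv> sample_cov n x" and "r \<equiv> sample_cross_cov n x y"
  assumes b: "b \<in> krylov A r m" and orth: "\<And>f. f \<in> krylov A r m \<Longrightarrow> (r - A b) \<bullet> A f = 0"
  shows "pls_estimator n x y m = b"
proof (cases "m = 0")
  case True
  then show ?thesis using b by (simp add: pls_estimator_def krylov_def)
next
  case False
  have lin: "linear A" unfolding A_def by (rule linear_sample_cov)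
  have pyth: "(norm (r - A c))\<^sup>2 = (norm (r - A b))\<^sup>2 + (norm (A (b - c)))\<^sup>2" if "c \<in> krylov A r m" for c
  proof -
    have "b - c \<in> krylov A r m" using b that unfolding krylov_def by (rule span_diff)
    from orth[OF this] have "(norm ((r - A b) + A (b - c)))\<^sup>2 = (norm (r - A b))\<^sup>2 + (norm (A (b - c)))\<^sup>2"
      unfolding power2_norm_eq_inner by (simp add: inner_add_left inner_add_right inner_commute)
    then show ?thesis by (simp add: linear_diff[OF lin])
  qed
  have min: "(norm (r - A b))\<^sup>2 \<le> (norm (r - A c))\<^sup>2" if "c \<in> krylov A r m" for c
    using pyth[OF that] by simp
  have "is_arg_min (\<lambda>b. (norm (r - A b))\<^sup>2) (\<lambda>b. b \<in> krylov A r m) c \<longleftrightarrow> c = b" for c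
  proof
    assume c: "is_arg_min (\<lambda>b. (norm (r - A b))\<^sup>2) (\<lambda>b. b \<in> krylov A r m) c"
    then have ck: "c \<in> krylov A r m" by (simp add: is_arg_min_def)
    have "\<not> (norm (r - A b))\<^sup>2 < (norm (r - A c))\<^sup>2"
      using c b unfolding is_arg_min_def by blast
    then have "(norm (A (b - c)))\<^sup>2 \<le> 0" using pyth[OF ck] by linarith
    then have "A (b - c) = 0" by simp
    moreover have "b - c \<in> krylov A r m" using b ck unfolding krylov_def by (rule span_diff)
    ultimately have "b - c = 0"
      using sample_cov_injective_on_span krylov_subset_span unfolding A_def r_def by blast
    then show "c = b" by simp
  next
    assume "c = b"
    then show "is_arg_min (\<lambda>b. (norm (r - A b))\<^sup>2) (\<lambda>b. b \<in> krylov A r m) c"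
      unfolding is_arg_min_def using b min by (metis leD)
  qed
  then have "(SOME c. is_arg_min (\<lambda>b. (norm (r - A b))\<^sup>2) (\<lambda>b. b \<in> krylov A r m) c) = b"
    by (intro some_equality) simp_all
  with False show ?thesis
    unfolding pls_estimator_def arg_min_on_def arg_min_def A_def r_def by (simp only: if_False)
qed

declare sum.cong [fundef_cong]

text \<open>
  Gram-Schmidt orthogonalization of the images \<open>A (w k)\<close>, with every step carried out on the vectors
  \<open>w k\<close> themselves.
\<close>

fun image_gram_schmidt :: "('h::real_inner \<Rightarrow> 'h) \<Rightarrow> (nat \<Rightarrow> 'h) \<Rightarrow> nat \<Rightarrow> 'h" where
  "image_gram_schmidt A w k = w k - (\<Sum>j<k.
     ((A (w k) \<bullet> A (image_gram_schmidt A w j)) /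
      (A (image_gram_schmidt A w j) \<bullet> A (image_gram_schmidt A w j))) *\<^sub>R image_gram_schmidt A w j)"

declare image_gram_schmidt.simps [simp del]

lemma image_gram_schmidt_orthogonal:
  assumes lin: "linear A" and "i \<noteq> k"
  shows "A (image_gram_schmidt A w k) \<bullet> A (image_gram_schmidt A w i) = 0"
proof -
  let ?d = "image_gram_schmidt A w"
  have *: "\<forall>i<k. A (?d k) \<bullet> A (?d i) = 0" for k
  proof (induction k rule: less_induct)
    case (less k)
    show ?case
    proof (intro allI impI)
      fix i assume i: "i < k"
      have orth: "A (?d j) \<bullet> A (?d i) = 0" if "j < k" "j \<noteq> i" for j
        using less.IH[of i] less.IH[of j] i that by (metis inner_commute linorder_neqE_nat)
      let ?c = "\<lambda>j. (A (w k) \<bullet> A (?d j)) / (A (?d j) \<bullet> A (?d j))"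
      have "A (?d k) \<bullet> A (?d i) = A (w k) \<bullet> A (?d i) - (\<Sum>j<k. ?c j * (A (?d j) \<bullet> A (?d i)))"
        by (subst image_gram_schmidt.simps)
           (simp add: linear_diff[OF lin] linear_sum[OF lin] linear_scale[OF lin]
             inner_diff_left inner_sum_left)
      also have "(\<Sum>j<k. ?c j * (A (?d j) \<bullet> A (?d i))) = (\<Sum>j<k. if j = i then A (w k) \<bullet> A (?d i) else 0)"
        by (rule sum.cong) (use orth in auto)
      finally show "A (?d k) \<bullet> A (?d i) = 0" using i by simp
    qed
  qed
  then show ?thesis using \<open>i \<noteq> k\<close> by (metis inner_commute linorder_neqE_nat)
qed

lemma span_image_gram_schmidt:
  "span (image_gram_schmidt A w ` {..<m}) = span (w ` {..<m})"
proof (induction m)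
  case (Suc m)
  let ?d = "image_gram_schmidt A w"
  have sub: "(\<Sum>j<m. c j *\<^sub>R ?d j) \<in> span (?d ` {..<m})" for c
    by (intro span_sum span_scale span_base imageI) auto
  define c where "c = (\<lambda>j. (A (w m) \<bullet> A (?d j)) / (A (?d j) \<bullet> A (?d j)))"
  define s where "s = (\<Sum>j<m. c j *\<^sub>R ?d j)"
  have dm: "?d m = w m - s"
    unfolding s_def c_def by (rule image_gram_schmidt.simps)
  have up: "span S \<subseteq> span (insert a S)" for a and S :: "'a set" by (intro span_mono subset_insertI)
  have s: "s \<in> span (?d ` {..<m})" unfolding s_def by (rule sub)
  have s': "s \<in> span (w ` {..<m})" using s by (simp only: Suc)
  have "?d m \<in> span (insert (w m) (w ` {..<m}))"
    unfolding dm by (rule span_diff[OF span_base[OF insertI1] subsetD[OF up s']])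
  moreover have "?d m + s \<in> span (insert (?d m) (?d ` {..<m}))"
    by (rule span_add[OF span_base[OF insertI1] subsetD[OF up s]])
  then have "w m \<in> span (insert (?d m) (?d ` {..<m}))" by (simp add: dm)
  moreover have "w ` {..<m} \<subseteq> span (insert (?d m) (?d ` {..<m}))"
    by (rule order_trans[OF _ up]) (simp add: Suc span_superset)
  moreover have "?d ` {..<m} \<subseteq> span (insert (w m) (w ` {..<m}))"
    by (rule order_trans[OF _ up]) (simp add: Suc[symmetric] span_superset)
  ultimately have "span (insert (?d m) (?d ` {..<m})) = span (insert (w m) (w ` {..<m}))"
    by (intro subset_antisym span_minimal subspace_span) auto
  then show ?case by (simp add: lessThan_Suc)
qed simp

lemma inner_linear_span_zero:
  assumes lin: "linear A" and "\<And>d. d \<in> D \<Longrightarrow> b \<bullet> A d = 0" and "f \<in> span D"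
  shows "b \<bullet> A f = 0"
  using assms(3)
  by (induction rule: span_induct_alt)
     (simp_all add: assms(2) linear_0[OF lin] linear_add[OF lin] linear_scale[OF lin] inner_add_right)

text \<open>
  Orthogonalizing the images of the Krylov vectors, with the same coefficients applied to the
  vectors themselves, gives a closed formula for the minimizer. Where an image vanishes, the convention
  \<open>a / 0 = 0\<close> gives the coefficient \<open>0\<close>, which is a correct choice.
\<close>

lemma pls_estimator_formula:
  fixes n m :: nat and x :: "nat \<Rightarrow> 'h::real_inner" and y :: "nat \<Rightarrow> real"
  defines "A \<equiv> sample_cov n x" and "r \<equiv> sample_cross_cov n x y"
  defines "d \<equiv> image_gram_schmidt A (\<lambda>k. (A ^^ k) r)"
  defines "b \<equiv> (\<Sum>k<m. ((r \<bullet> A (d k)) / (A (d k) \<bullet> A (d k))) *\<^sub>R d k)"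
  shows "pls_estimator n x y m = b" and "b \<in> krylov A r m"
    and "\<And>f. f \<in> krylov A r m \<Longrightarrow> (r - A b) \<bullet> A f = 0"
proof -
  have lin: "linear A" unfolding A_def by (rule linear_sample_cov)
  have kry: "krylov A r m = span (d ` {..<m})"
    unfolding krylov_def d_def by (rule span_image_gram_schmidt[symmetric])
  show b: "b \<in> krylov A r m"
    unfolding b_def kry by (intro span_sum span_scale span_base imageI) auto
  show orth: "(r - A b) \<bullet> A f = 0" if "f \<in> krylov A r m" for f
  proof (rule inner_linear_span_zero[OF lin _ that[unfolded kry]])
    fix e assume "e \<in> d ` {..<m}"
    then obtain i where i: "i < m" "e = d i" by auto
    let ?c = "\<lambda>j. (r \<bullet> A (d j)) / (A (d j) \<bullet> A (d j))"
    have "A b \<bullet> A (d i) = (\<Sum>j<m. ?c j * (A (d j) \<bullet> A (d i)))"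
      by (simp add: b_def linear_sum[OF lin] linear_scale[OF lin] inner_sum_left)
    also have "\<dots> = (\<Sum>j<m. if j = i then r \<bullet> A (d i) else 0)"
      by (rule sum.cong) (use image_gram_schmidt_orthogonal[OF lin] in \<open>auto simp: d_def\<close>)
    finally show "(r - A b) \<bullet> A e = 0" using i by (simp add: inner_diff_left)
  qed
  show "pls_estimator n x y m = b"
    using b orth unfolding A_def r_def by (rule pls_estimator_eqI)
qed

lemma pls_estimator_in_krylov:
  "pls_estimator n x y m \<in> krylov (sample_cov n x) (sample_cross_cov n x y) m"
  using pls_estimator_formula(1,2)[where n = n and x = x and y = y and m = m] by simp

lemma pls_residual_orthogonal:
  "f \<in> krylov (sample_cov n x) (sample_cross_cov n x y) m \<Longrightarrow>
   (sample_cross_cov n x y - sample_cov n x (pls_estimator n x y m)) \<bullet> sample_cov n x f = 0"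
  using pls_estimator_formula(1,3)[where n = n and x = x and y = y and m = m] by simp

lemma measurable_sample_cov:
  fixes Xs :: "nat \<Rightarrow> 'b \<Rightarrow> 'h::{real_inner,second_countable_topology}"
  assumes "\<And>i. i \<in> {1..n} \<Longrightarrow> Xs i \<in> borel_measurable N" and "g \<in> borel_measurable N"
  shows "(\<lambda>\<omega>. sample_cov n (\<lambda>i. Xs i \<omega>) (g \<omega>)) \<in> borel_measurable N"
  unfolding sample_cov_def
  by (intro borel_measurable_scaleR borel_measurable_const borel_measurable_sum
      borel_measurable_inner assms) auto

lemma measurable_sample_cross_cov:
  fixes Xs :: "nat \<Rightarrow> 'b \<Rightarrow> 'h::{real_inner,second_countable_topology}"
  assumes "\<And>i. i \<in> {1..n} \<Longrightarrow> Xs i \<in> borel_measurable N" "\<And>i. i \<in> {1..n} \<Longrightarrow> Ys i \<in> borel_measurable N"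
  shows "(\<lambda>\<omega>. sample_cross_cov n (\<lambda>i. Xs i \<omega>) (\<lambda>i. Ys i \<omega>)) \<in> borel_measurable N"
  unfolding sample_cross_cov_def
  by (intro borel_measurable_scaleR borel_measurable_const borel_measurable_sum assms)

text \<open>
  The closed formula is built from sums, inner products and quotients; a description as an
  \<open>arg_min\<close> gives no access to measurability.
\<close>

lemma measurable_pls_estimator:
  fixes Xs :: "nat \<Rightarrow> 'b \<Rightarrow> 'h::{real_inner,second_countable_topology}"
  assumes X: "\<And>i. i \<in> {1..n} \<Longrightarrow> Xs i \<in> borel_measurable N"
    and Y: "\<And>i. i \<in> {1..n} \<Longrightarrow> Ys i \<in> borel_measurable N"
  shows "(\<lambda>\<omega>. pls_estimator n (\<lambda>i. Xs i \<omega>) (\<lambda>i. Ys i \<omega>) m) \<in> borel_measurable N"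
proof -
  let ?A = "\<lambda>\<omega>. sample_cov n (\<lambda>i. Xs i \<omega>)" and ?r = "\<lambda>\<omega>. sample_cross_cov n (\<lambda>i. Xs i \<omega>) (\<lambda>i. Ys i \<omega>)"
  let ?d = "\<lambda>\<omega>. image_gram_schmidt (?A \<omega>) (\<lambda>k. (?A \<omega> ^^ k) (?r \<omega>))"
  have A: "(\<lambda>\<omega>. ?A \<omega> (g \<omega>)) \<in> borel_measurable N" if "g \<in> borel_measurable N" for g
    by (rule measurable_sample_cov[where Xs = Xs]; fact)
  have r: "?r \<in> borel_measurable N" by (rule measurable_sample_cross_cov[where Xs = Xs and Ys = Ys]; fact)
  have pow: "(\<lambda>\<omega>. (?A \<omega> ^^ k) (?r \<omega>)) \<in> borel_measurable N" for k
    by (induction k) (simp_all add: r A)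
  have d: "(\<lambda>\<omega>. ?d \<omega> k) \<in> borel_measurable N" for k
  proof (induction k rule: less_induct)
    case (less k)
    show ?case
      apply (subst image_gram_schmidt.simps)
      apply (rule borel_measurable_diff[OF pow])
      apply (rule borel_measurable_sum)
      apply (rule borel_measurable_scaleR)
       apply (rule borel_measurable_divide)
        apply (rule borel_measurable_inner[OF A[OF pow] A[OF less]])
        apply simp
       apply (rule borel_measurable_inner[OF A[OF less] A[OF less]])
        apply simp
       apply simp
      apply (rule less)
      apply simp
      done
  qed
  show ?thesis
    unfolding pls_estimator_formula(1)
    by (rule borel_measurable_sum, rule borel_measurable_scaleR, rule borel_measurable_divide,
        (rule borel_measurable_inner r A d)+)
qed

lemma measurable_pls_stopped:
  fixes Xs :: "nat \<Rightarrow> 'b \<Rightarrow> 'h::{real_inner,second_countable_topology}"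
  assumes X: "\<And>i. i \<in> {1..n} \<Longrightarrow> Xs i \<in> borel_measurable N"
    and Y: "\<And>i. i \<in> {1..n} \<Longrightarrow> Ys i \<in> borel_measurable N"
  shows "(\<lambda>\<omega>. pls_estimator n (\<lambda>i. Xs i \<omega>) (\<lambda>i. Ys i \<omega>)
     (stopping_index n (\<lambda>i. Xs i \<omega>) (\<lambda>i. Ys i \<omega>) t)) \<in> borel_measurable N"
proof (rule measurable_compose_countable[where g = "\<lambda>\<omega>. stopping_index n (\<lambda>i. Xs i \<omega>) (\<lambda>i. Ys i \<omega>) t"])
  show pls: "(\<lambda>\<omega>. pls_estimator n (\<lambda>i. Xs i \<omega>) (\<lambda>i. Ys i \<omega>) m) \<in> borel_measurable N" for m
    by (rule measurable_pls_estimator[where Xs = Xs and Ys = Ys]; fact)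
  have r: "(\<lambda>\<omega>. sample_cross_cov n (\<lambda>i. Xs i \<omega>) (\<lambda>i. Ys i \<omega>)) \<in> borel_measurable N"
    by (rule measurable_sample_cross_cov[where Xs = Xs and Ys = Ys]; fact)
  have A: "(\<lambda>\<omega>. sample_cov n (\<lambda>i. Xs i \<omega>)
      (pls_estimator n (\<lambda>i. Xs i \<omega>) (\<lambda>i. Ys i \<omega>) m)) \<in> borel_measurable N" for m
    by (rule measurable_sample_cov[where Xs = Xs]) (fact X pls)+
  have "Measurable.pred N (\<lambda>\<omega>. norm (sample_cross_cov n (\<lambda>i. Xs i \<omega>) (\<lambda>i. Ys i \<omega>) -
      sample_cov n (\<lambda>i. Xs i \<omega>) (pls_estimator n (\<lambda>i. Xs i \<omega>) (\<lambda>i. Ys i \<omega>) m)) \<le> t)" for m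
    using measurable_compose[OF borel_measurable_diff[OF r A] borel_measurable_norm] by simp
  then show "(\<lambda>\<omega>. stopping_index n (\<lambda>i. Xs i \<omega>) (\<lambda>i. Ys i \<omega>) t) \<in> measurable N (count_space UNIV)"
    unfolding stopping_index_def by (rule measurable_Least)
qed

section \<open>Minimal residual iteration with the discrepancy principle\<close>

lemma power_le_fact_exp:
  assumes "0 \<le> (x::real)" shows "x ^ i \<le> fact i * exp x"
proof -
  have "x ^ i / fact i \<le> exp x"
    unfolding exp_def using assms
      sum_le_suminf[OF summable_exp_generic[of x], of "{i}"]
    by (simp add: divide_inverse mult.commute)
  then show ?thesis by (simp add: field_simps)
qed

lemma power_times_exp_le:
  assumes "0 \<le> (x::real)" "0 < \<alpha>"
  shows "x ^ i * exp (- (x / \<alpha>) / 2) \<le> fact i * (2 * \<alpha>) ^ i"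
proof -
  let ?z = "x / (2 * \<alpha>)"
  have z: "0 \<le> ?z" "x = (2 * \<alpha>) * ?z" "- (x / \<alpha>) / 2 = - ?z" using assms by simp_all
  have "?z ^ i * exp (- ?z) \<le> (fact i * exp ?z) * exp (- ?z)"
    by (intro mult_right_mono power_le_fact_exp z) simp
  also have "\<dots> = fact i" by (simp add: mult.assoc exp_minus_inverse)
  finally have "(2 * \<alpha>) ^ i * (?z ^ i * exp (- ?z)) \<le> (2 * \<alpha>) ^ i * fact i"
    using assms by (intro mult_left_mono) auto
  moreover have "x ^ i = (2 * \<alpha>) ^ i * ?z ^ i" by (subst z(2)) (rule power_mult_distrib)
  ultimately show ?thesis unfolding z(3) by (simp only: mult.assoc mult.commute[of "fact i"])
qed

text \<open>
  A common constant for the bounds \<open>x exp (- x/(2 \<alpha>)) \<le> c \<alpha>\<close> and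
  \<open>x\<^sup>k\<^sup>+\<^sup>1 exp (- x/(2 \<alpha>)) \<le> c \<alpha>\<^sup>k\<^sup>+\<^sup>1\<close>, see \<open>power_times_exp_le\<close>.
\<close>

definition filter_const :: "nat \<Rightarrow> real" where "filter_const k = 2 ^ Suc k * fact (Suc k)"

lemma filter_const_ge: "2 \<le> filter_const k"
proof -
  have "2 * 1 \<le> (2::real) ^ Suc k * fact (Suc k)"
    by (rule mult_mono[OF _ fact_ge_1]) simp_all
  then show ?thesis by (simp add: filter_const_def)
qed

text \<open>
  Here \<open>N\<close> is the norm of the last residual above the threshold, \<open>L\<close> its low frequency part, \<open>M\<close> the
  norm of the image of the search direction and \<open>c\<close> the step size. Since \<open>L\<close> is only a fixed fraction
  of \<open>N\<close>, the direction has a large image, and a long step would change the residual by more than \<open>N\<close>.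
\<close>

lemma step_size_bound:
  fixes \<tau> a N M L \<Delta> c :: real
  assumes "\<tau> > 1" "a > 0" "N > 0" "\<tau> * \<Delta> < N" "L \<le> (\<tau> + 1) / 2 * \<Delta>" "N \<le> L + M / a" "c * M \<le> N" "c \<ge> 0"
  shows "c \<le> 2 * \<tau> / (\<tau> - 1) / a"
proof -
  define P where "P = a * ((\<tau> - 1) / (2 * \<tau>))"
  have P: "P > 0" using assms(1,2) by (simp add: P_def)
  have "\<Delta> \<le> N / \<tau>" using assms(1,4) by (simp add: pos_le_divide_eq mult.commute)
  then have "(\<tau> + 1) / 2 * \<Delta> \<le> (\<tau> + 1) / 2 * (N / \<tau>)"
    using assms(1) by (intro mult_left_mono) auto
  then have "N - (\<tau> + 1) / 2 * (N / \<tau>) \<le> M / a" using assms(5,6) by linarith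
  moreover have "N - (\<tau> + 1) / 2 * (N / \<tau>) = N * ((\<tau> - 1) / (2 * \<tau>))"
    using assms(1) by (simp add: field_simps)
  ultimately have "N * ((\<tau> - 1) / (2 * \<tau>)) * a \<le> M"
    using pos_le_divide_eq[OF assms(2)] by metis
  then have "c * (N * P) \<le> c * M" using assms(8) by (intro mult_left_mono) (simp_all add: P_def mult_ac)
  then have "(c * P) * N \<le> 1 * N" using assms(7) by (simp add: mult_ac)
  then have "c * P \<le> 1" by (rule mult_right_le_imp_le) (rule assms(3))
  then have "c \<le> 1 / P" using pos_le_divide_eq[OF P] by blast
  also have "1 / P = 2 * \<tau> / (\<tau> - 1) / a" by (simp add: P_def)
  finally show ?thesis .
qed

locale minimal_residual = finite_spectral A E t
  for A :: "'h::real_inner \<Rightarrow> 'h" and E t +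
  fixes r :: 'h and b :: "nat \<Rightarrow> 'h"
  assumes proj_r: "proj r = r"
    and b_krylov: "\<And>m. b m \<in> krylov A r m"
    and orth: "\<And>m f. f \<in> krylov A r m \<Longrightarrow> (r - A (b m)) \<bullet> A f = 0"
begin

sublocale discrete_measure E "\<lambda>e. (e \<bullet> r)\<^sup>2" t
  by unfold_locales (simp_all add: finE tpos)

lemma wsum_eq: "wsum f g = fcalc f r \<bullet> fcalc g r"
  by (simp add: wsum_def inner_fcalc_range[OF proj_r])

lemma b_poly:
  obtains q where "below_deg m q" "b m = fcalc (poly q) r"
  using b_krylov[of m] unfolding krylov_iff_poly below_deg_def by blast

lemma residual_fcalc: "r - A (fcalc f r) = fcalc (\<lambda>x. 1 - x * f x) r"
  by (simp add: A_fcalc fcalc_diff_fun fcalc_one)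

lemma poly_residual: "poly (pCons 1 (- q)) = (\<lambda>x. 1 - x * poly q x)" for q :: "real poly"
  by (rule ext) simp

lemma residual_poly_of:
  assumes "below_deg m q" "b m = fcalc (poly q) r"
  shows "residual_poly m (pCons 1 (- q))"
  unfolding residual_poly_def
proof (intro conjI allI impI)
  show "below_deg (Suc m) (pCons 1 (- q))"
    using assms by (simp add: below_deg_pCons below_deg_minus)
  fix g assume "below_deg m g"
  then have "fcalc (poly g) r \<in> krylov A r m" unfolding krylov_iff_poly below_deg_def by blast
  from orth[OF this] show "wsum (poly (pCons 1 (- q))) (\<lambda>x. x * poly g x) = 0"
    unfolding wsum_eq poly_residual A_fcalc assms(2) residual_fcalc[symmetric] by simp
qed simp

lemma residual_pythagoras:
  assumes "c \<in> krylov A r m"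
  shows "(norm (r - A c))\<^sup>2 = (norm (r - A (b m)))\<^sup>2 + (norm (A (b m) - A c))\<^sup>2"
proof -
  have "b m - c \<in> krylov A r m"
    using b_krylov assms unfolding krylov_def by (rule span_diff)
  from orth[OF this] have "(norm ((r - A (b m)) + (A (b m) - A c)))\<^sup>2
      = (norm (r - A (b m)))\<^sup>2 + (norm (A (b m) - A c))\<^sup>2"
    unfolding power2_norm_eq_inner A_diff
    by (simp only: inner_add_left inner_add_right inner_commute)
  then show ?thesis by simp
qed

lemma residual_le:
  assumes "c \<in> krylov A r m" shows "norm (r - A (b m)) \<le> norm (r - A c)"
proof (rule power2_le_imp_le)
  show "(norm (r - A (b m)))\<^sup>2 \<le> (norm (r - A c))\<^sup>2"
    unfolding residual_pythagoras[OF assms] by (rule le_add_same_cancel1[THEN iffD2]) simp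
qed simp

lemma krylov_mono: "m \<le> k \<Longrightarrow> krylov A r m \<subseteq> krylov A r k"
  unfolding krylov_def by (intro span_mono image_mono) auto

lemma residual_step: "norm (A (b (Suc m)) - A (b m)) \<le> norm (r - A (b m))"
proof -
  have "b m \<in> krylov A r (Suc m)" using subsetD[OF krylov_mono[of m "Suc m"] b_krylov] by simp
  from residual_pythagoras[OF this]
  have "(norm (A (b (Suc m)) - A (b m)))\<^sup>2 \<le> (norm (r - A (b m)))\<^sup>2"
    by (simp only:) (rule le_add_same_cancel2[THEN iffD2, OF zero_le_power2])
  then show ?thesis by (rule power2_le_imp_le) simp
qed

lemma residual_minimal:
  assumes "below_deg (Suc m) s" "poly s 0 = 1"
  shows "norm (r - A (b m)) \<le> norm (fcalc (poly s) r)"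
proof -
  obtain c h where ch: "s = pCons c h" by (cases s)
  define g where "g = - h"
  have s: "s = pCons 1 (- g)" using assms(2) by (simp add: ch g_def)
  then have "below_deg m g"
    using assms(1) below_deg_minus[of m "- g"] by (simp add: below_deg_pCons)
  then have "fcalc (poly g) r \<in> krylov A r m" unfolding krylov_iff_poly below_deg_def by blast
  then have "norm (r - A (b m)) \<le> norm (r - A (fcalc (poly g) r))" by (rule residual_le)
  then show ?thesis by (simp only: s poly_residual residual_fcalc)
qed

text \<open>
  The polynomial that vanishes at all eigenvalues annihilates the data, so the stopping rule applies
  to a nonempty set of indices even if the threshold is \<open>0\<close>.
\<close>

lemma residual_vanishes: "\<exists>m. r - A (b m) = 0"
proof -
  define s where "s = (\<Prod>e\<in>E. [:1, - (1 / t e):])"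
  have "degree s \<le> (\<Sum>e\<in>E. degree [:1, - (1 / t e):])"
    unfolding s_def using degree_prod_sum_le[OF finE, of "\<lambda>e. [:1, - (1 / t e):]"] by (simp only: o_def)
  also have "\<dots> \<le> (\<Sum>e\<in>E. 1)" by (intro sum_mono) simp
  finally have "below_deg (Suc (card E)) s" by (simp add: below_deg_def coeff_eq_0)
  moreover have "poly s 0 = 1" by (simp add: s_def poly_prod)
  ultimately have "norm (r - A (b (card E))) \<le> norm (fcalc (poly s) r)" by (rule residual_minimal)
  moreover have "fcalc (poly s) r = fcalc (\<lambda>_. 0) r"
  proof (rule fcalc_cong_range[OF proj_r], rule disjI2)
    fix e assume e: "e \<in> E"
    show "poly s (t e) = 0"
      unfolding s_def poly_prod
    proof (rule prod_zero[OF finE])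
      show "\<exists>a\<in>E. poly [:1, - (1 / t a):] (t e) = 0"
        by (rule bexI[OF _ e]) (use tpos[OF e] in simp)
    qed
  qed
  moreover have "fcalc (\<lambda>_. 0) r = 0" by (simp add: fcalc_def)
  ultimately show ?thesis by (intro exI[of _ "card E"]) simp
qed

text \<open>
  Everything that is used of an iterate before the residual vanishes: its filter \<open>q\<close> and the sum
  \<open>\<kappa>\<close> of the reciprocal roots of its residual polynomial.
\<close>

lemma residual_data:
  assumes "r - A (b m) \<noteq> 0"
  shows "\<exists>q \<kappa>. below_deg m q \<and> b m = fcalc (poly q) r \<and>
    wsum (poly (pCons 1 (- q))) (poly (pCons 1 (- q))) > 0 \<and>
    0 \<le> \<kappa> \<and> norm (r - A (b m)) \<le> norm (fcalc (\<lambda>x. exp (- (x * \<kappa>) / 2)) r) \<and>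
    (\<forall>x\<ge>0. x * \<kappa> \<le> 1 \<longrightarrow> \<bar>1 - x * poly q x\<bar> \<le> 1 \<and> x * \<bar>poly q x\<bar> \<le> x * \<kappa>)"
proof -
  obtain q where q: "below_deg m q" "b m = fcalc (poly q) r" by (rule b_poly)
  let ?p = "pCons 1 (- q)"
  have res: "residual_poly m ?p" by (rule residual_poly_of[OF q])
  have rp: "r - A (b m) = fcalc (poly ?p) r" unfolding q residual_fcalc poly_residual ..
  have "wsum (poly ?p) (poly ?p) = (norm (r - A (b m)))\<^sup>2"
    unfolding wsum_eq rp power2_norm_eq_inner ..
  then have pos: "wsum (poly ?p) (poly ?p) > 0" and nrm: "(norm (r - A (b m)))\<^sup>2 = wsum (poly ?p) (poly ?p)"
    using assms by simp_all
  obtain xs where xs: "length xs = m" "\<forall>x\<in>set xs. 0 < x" "?p = (\<Prod>x\<leftarrow>xs. [:1, - (1 / x):])"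
    using residual_poly_roots[OF res pos] by blast
  define \<kappa> where "\<kappa> = (\<Sum>x\<leftarrow>xs. 1 / x)"
  have k0: "0 \<le> \<kappa>" unfolding \<kappa>_def using xs(2) by (intro sum_list_nonneg) (auto simp: less_imp_le)
  have "(norm (r - A (b m)))\<^sup>2 \<le> (\<Sum>e\<in>E. (e \<bullet> r)\<^sup>2 * exp (- (t e * \<kappa>)))"
    unfolding nrm \<kappa>_def by (rule residual_norm_exp_bound[OF res xs])
  also have "\<dots> = (norm (fcalc (\<lambda>x. exp (- (x * \<kappa>) / 2)) r))\<^sup>2"
    unfolding norm_fcalc_range[OF proj_r]
    by (rule sum.cong) (simp_all add: power2_eq_square exp_add[symmetric])
  finally have nb: "norm (r - A (b m)) \<le> norm (fcalc (\<lambda>x. exp (- (x * \<kappa>) / 2)) r)"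
    by (rule power2_le_imp_le) simp
  have "\<bar>1 - x * poly q x\<bar> \<le> 1 \<and> x * \<bar>poly q x\<bar> \<le> x * \<kappa>" if x: "0 \<le> x" "x * \<kappa> \<le> 1" for x
  proof -
    have "1 - x * poly q x = (\<Prod>z\<leftarrow>xs. 1 - x / z)"
      using arg_cong[OF xs(3), of "\<lambda>p. poly p x"] by (simp add: poly_root_product)
    then have b: "1 - x * \<kappa> \<le> 1 - x * poly q x" "1 - x * poly q x \<le> 1"
      using prod_list_linear_bound[OF xs(2) x(1)] x(2) unfolding \<kappa>_def by auto
    then have "\<bar>x * poly q x\<bar> \<le> x * \<kappa>" by simp
    then show ?thesis using b x by (simp add: abs_mult)
  qed
  with q pos k0 nb show ?thesis by (intro exI[of _ q] exI[of _ \<kappa>] conjI allI impI) simp_all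
qed

end

text \<open>
  The condition \<open>source\<close> is the abstract form of smoothness of \<open>\<beta>\<close>: a filter that is bounded by \<open>B\<close>
  and decays like \<open>B (\<alpha>/x)\<^sup>k\<close> reduces \<open>\<beta>\<close> to \<open>B G(\<alpha>)\<close>.
\<close>

locale minimal_residual_source = minimal_residual A E t r b
  for A :: "'h::real_inner \<Rightarrow> 'h" and E t r b +
  fixes \<beta> :: 'h and k :: nat and G :: "real \<Rightarrow> real" and \<Delta> \<tau> :: real
  assumes noise: "norm (r - A \<beta>) \<le> \<Delta>" and tau: "\<tau> > 1" and kpos: "k > 0"
    and source: "\<And>f B \<alpha>. 0 < \<alpha> \<Longrightarrow>
      (\<And>x. 0 \<le> x \<Longrightarrow> \<bar>f x\<bar> \<le> B \<and> \<bar>f x\<bar> * x ^ k \<le> B * \<alpha> ^ k) \<Longrightarrow> norm (fcalc f \<beta>) \<le> B * G \<alpha>"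
begin

lemma Delta_nonneg: "0 \<le> \<Delta>" using noise norm_ge_zero[of "r - A \<beta>"] by linarith

lemma G_nonneg: "0 < \<alpha> \<Longrightarrow> 0 \<le> G \<alpha>"
  using order_trans[OF norm_ge_zero source[of \<alpha> "\<lambda>_. 0" 1]] by simp

lemma proj_noise: "proj (r - A \<beta>) = r - A \<beta>"
  by (simp add: proj_diff proj_r proj_A)

lemma fcalc_r_split: "fcalc f r = fcalc f (r - A \<beta>) + fcalc (\<lambda>x. x * f x) \<beta>"
  using fcalc_diff[of f r "A \<beta>"] by (simp add: fcalc_A A_fcalc)

context
  fixes a :: real
  assumes a: "0 < a" and Ga: "\<And>\<alpha>. 0 < \<alpha> \<Longrightarrow> \<alpha> \<le> a \<Longrightarrow> filter_const k * \<alpha> * G \<alpha> \<le> (\<tau> - 1) / 2 * \<Delta>"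
begin

text \<open>
  The residual is at most \<open>\<Delta>\<close> plus the norm of \<open>x exp (- \<kappa> x/2)\<close> applied to \<open>\<beta>\<close>. If \<open>\<alpha> = 1/\<kappa>\<close> were
  less than \<open>a\<close>, smoothness would make the second term too small for the residual to exceed \<open>\<tau> \<Delta>\<close>.
\<close>

lemma not_stopped_kappa:
  assumes big: "norm (r - A (b m)) > \<tau> * \<Delta>"
    and \<kappa>: "0 \<le> \<kappa>" "norm (r - A (b m)) \<le> norm (fcalc (\<lambda>x. exp (- (x * \<kappa>) / 2)) r)"
  shows "a * \<kappa> \<le> 1"
proof (rule ccontr)
  assume "\<not> a * \<kappa> \<le> 1"
  then have "\<kappa> > 0" using \<kappa> by (cases "\<kappa> = 0") auto
  define \<alpha> where "\<alpha> = 1 / \<kappa>"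
  have \<alpha>: "0 < \<alpha>" "\<alpha> \<le> a" "\<kappa> = 1 / \<alpha>"
    using \<open>\<not> a * \<kappa> \<le> 1\<close> \<open>\<kappa> > 0\<close> by (auto simp: \<alpha>_def field_simps)
  let ?f = "\<lambda>x. exp (- (x * \<kappa>) / 2)"
  have "norm (fcalc ?f (r - A \<beta>)) \<le> 1 * norm (r - A \<beta>)"
    by (rule norm_fcalc_bound_range[OF proj_noise]) (use tpos \<open>\<kappa> > 0\<close> in \<open>auto simp: less_imp_le\<close>)
  moreover have "norm (fcalc (\<lambda>x. x * ?f x) \<beta>) \<le> (filter_const k * \<alpha>) * G \<alpha>"
  proof (rule source[OF \<alpha>(1)])
    fix x :: real assume x: "0 \<le> x"
    have f: "?f x = exp (- (x / \<alpha>) / 2)" by (simp add: \<alpha>(3))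
    have "x ^ 1 * ?f x \<le> fact 1 * (2 * \<alpha>) ^ 1"
      unfolding f by (rule power_times_exp_le[OF x \<alpha>(1)])
    also have "\<dots> \<le> filter_const k * \<alpha>" using filter_const_ge[of k] \<alpha> by simp
    finally have 1: "x * ?f x \<le> filter_const k * \<alpha>" by simp
    have "x ^ Suc k * ?f x \<le> fact (Suc k) * (2 * \<alpha>) ^ Suc k"
      unfolding f by (rule power_times_exp_le[OF x \<alpha>(1)])
    also have "\<dots> = (filter_const k * \<alpha>) * \<alpha> ^ k" by (simp add: filter_const_def power_mult_distrib)
    finally have 2: "(x * ?f x) * x ^ k \<le> (filter_const k * \<alpha>) * \<alpha> ^ k" by (simp add: mult_ac)
    have "\<bar>x * ?f x\<bar> = x * ?f x" using x by simp
    with 1 2 show "\<bar>x * ?f x\<bar> \<le> filter_const k * \<alpha> \<and> \<bar>x * ?f x\<bar> * x ^ k \<le> filter_const k * \<alpha> * \<alpha> ^ k" by simp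
  qed
  ultimately have "norm (fcalc ?f r) \<le> \<Delta> + (\<tau> - 1) / 2 * \<Delta>"
    unfolding fcalc_r_split[of ?f] using Ga[OF \<alpha>(1,2)] noise
    by (intro norm_triangle_le) linarith
  also have "\<dots> = (\<tau> + 1) / 2 * \<Delta>" by (simp add: field_simps)
  also have "\<dots> \<le> \<tau> * \<Delta>" using tau Delta_nonneg by (intro mult_right_mono) auto
  finally show False using big \<kappa>(2) by linarith
qed

abbreviation "low \<equiv> (\<lambda>x::real. if x \<le> a then 1 else 0::real)"

lemma low_frequency_data: "norm (fcalc low r) \<le> (\<tau> + 1) / 2 * \<Delta>"
proof -
  have "norm (fcalc low (r - A \<beta>)) \<le> 1 * norm (r - A \<beta>)"
    by (rule norm_fcalc_bound_range[OF proj_noise]) auto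
  moreover have "norm (fcalc (\<lambda>x. x * low x) \<beta>) \<le> a * G a"
  proof (rule source[OF a])
    fix x :: real assume x: "0 \<le> x"
    show "\<bar>x * low x\<bar> \<le> a \<and> \<bar>x * low x\<bar> * x ^ k \<le> a * a ^ k"
      using x a by (auto intro!: mult_mono power_mono)
  qed
  moreover have "a * G a \<le> filter_const k * a * G a"
    using filter_const_ge[of k] a G_nonneg[OF a] by (simp add: mult_right_mono mult_le_cancel_right1)
  ultimately have "norm (fcalc low r) \<le> \<Delta> + (\<tau> - 1) / 2 * \<Delta>"
    unfolding fcalc_r_split[of low] using Ga[OF a order_refl] noise
    by (intro norm_triangle_le) linarith
  then show ?thesis by (simp add: field_simps)
qed

text \<open>
  The index before stopping has a filter bounded by \<open>1/a\<close>. The stopped filter differs from it by a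
  multiple of the kernel polynomial, which is at most \<open>1\<close> on \<open>[0, a]\<close>; \<open>step_size_bound\<close> limits the
  multiple. The sum agrees with the polynomial filter of \<open>b m\<close> on the support of the spectral
  measure of \<open>r\<close>, which is enough for the two to produce the same iterate.
\<close>

lemma stopped_filter:
  assumes before: "\<And>j. j < m \<Longrightarrow> norm (r - A (b j)) > \<tau> * \<Delta>"
  shows "\<exists>g. b m = fcalc g r \<and> (\<forall>x. 0 < x \<longrightarrow> x \<le> a \<longrightarrow> \<bar>g x\<bar> \<le> (1 + 2 * \<tau> / (\<tau> - 1)) / a)"
proof (cases m)
  case 0
  have "b 0 = 0" using b_krylov[of 0] by (simp add: krylov_def)
  then show ?thesis using 0 a tau by (intro exI[of _ "\<lambda>_. 0"]) (simp add: fcalc_def)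
next
  case (Suc i)
  have nz: "r - A (b j) \<noteq> 0" if "j \<le> i" for j
  proof -
    have "0 \<le> \<tau> * \<Delta>" using tau Delta_nonneg by simp
    also have "\<dots> < norm (r - A (b j))" using before[of j] that Suc by simp
    finally show ?thesis by simp
  qed
  define Q where "Q = (\<lambda>j q. below_deg j q \<and> b j = fcalc (poly q) r \<and>
      wsum (poly (pCons 1 (- q))) (poly (pCons 1 (- q))) > 0 \<and>
      (\<forall>x. 0 < x \<longrightarrow> x \<le> a \<longrightarrow> \<bar>1 - x * poly q x\<bar> \<le> 1 \<and> \<bar>poly q x\<bar> \<le> 1 / a))"
  have exQ: "\<exists>q. Q j q" if j: "j \<le> i" for j
  proof -
    obtain q \<kappa> where q: "below_deg j q" "b j = fcalc (poly q) r"
      "wsum (poly (pCons 1 (- q))) (poly (pCons 1 (- q))) > 0"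
      and \<kappa>: "0 \<le> \<kappa>" "norm (r - A (b j)) \<le> norm (fcalc (\<lambda>x. exp (- (x * \<kappa>) / 2)) r)"
      and bd: "\<forall>x\<ge>0. x * \<kappa> \<le> 1 \<longrightarrow> \<bar>1 - x * poly q x\<bar> \<le> 1 \<and> x * \<bar>poly q x\<bar> \<le> x * \<kappa>"
      using residual_data[OF nz[OF j]] by (elim exE conjE) (rule that)
    have ak: "a * \<kappa> \<le> 1" by (rule not_stopped_kappa[OF before \<kappa>]) (use j Suc in auto)
    have "\<bar>1 - x * poly q x\<bar> \<le> 1 \<and> \<bar>poly q x\<bar> \<le> 1 / a" if x: "0 < x" "x \<le> a" for x
    proof -
      have "x * \<kappa> \<le> a * \<kappa>" using x \<kappa> by (intro mult_right_mono) auto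
      then have "x * \<kappa> \<le> 1" using ak by simp
      then have bx: "\<bar>1 - x * poly q x\<bar> \<le> 1 \<and> x * \<bar>poly q x\<bar> \<le> x * \<kappa>"
        by (intro bd[rule_format]) (use x in simp)
      then have "\<bar>poly q x\<bar> \<le> \<kappa>" using mult_left_le_imp_le[OF _ x(1)] by blast
      moreover have "\<kappa> \<le> 1 / a"
        using ak a by (simp add: pos_le_divide_eq mult.commute)
      ultimately show ?thesis using bx by linarith
    qed
    with q show ?thesis unfolding Q_def by (intro exI[of _ q]) simp
  qed
  define q where "q = (\<lambda>j. SOME q. Q j q)"
  have Qq: "Q j (q j)" if "j \<le> i" for j unfolding q_def by (rule someI_ex[OF exQ[OF that]])
  have q: "\<And>j. j \<le> i \<Longrightarrow> below_deg j (q j)" "\<And>j. j \<le> i \<Longrightarrow> b j = fcalc (poly (q j)) r"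
    "\<And>j. j \<le> i \<Longrightarrow> wsum (poly (pCons 1 (- q j))) (poly (pCons 1 (- q j))) > 0"
    "\<And>j x. j \<le> i \<Longrightarrow> 0 < x \<Longrightarrow> x \<le> a \<Longrightarrow> \<bar>1 - x * poly (q j) x\<bar> \<le> 1"
    "\<And>j x. j \<le> i \<Longrightarrow> 0 < x \<Longrightarrow> x \<le> a \<Longrightarrow> \<bar>poly (q j) x\<bar> \<le> 1 / a"
    using Qq unfolding Q_def by simp_all
  define p where "p = (\<lambda>j. pCons 1 (- q j))"
  have res: "residual_poly j (p j)" if "j \<le> i" for j
    unfolding p_def by (rule residual_poly_of[OF q(1)[OF that] q(2)[OF that]])
  have pos: "wsum (poly (p j)) (poly (p j)) > 0" if "j \<le> i" for j
    unfolding p_def by (rule q(3)[OF that])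
  have pev: "poly (p j) x = 1 - x * poly (q j) x" for j x by (simp add: p_def)
  obtain q' where q': "below_deg (Suc i) q'" "b (Suc i) = fcalc (poly q') r" by (rule b_poly)
  obtain c where c: "\<forall>e\<in>E. (e \<bullet> r)\<^sup>2 = 0 \<or>
      poly (p i) (t e) - poly (pCons 1 (- q')) (t e) = c * t e * poly (kernel_poly p i) (t e)"
    using residual_poly_update[OF res pos residual_poly_of[OF q']] by blast
  let ?s = "poly (kernel_poly p i)"
  \<comment> \<open>the filter of the next iterate, on the support of the spectral measure\<close>
  have qq: "(e \<bullet> r) = 0 \<or> poly q' (t e) = poly (q i) (t e) + c * ?s (t e)" if e: "e \<in> E" for e
  proof -
    have "t e * poly q' (t e) = t e * (poly (q i) (t e) + c * ?s (t e))" if "e \<bullet> r \<noteq> 0"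
      using bspec[OF c e] that by (simp add: pev algebra_simps)
    then show ?thesis using tpos[OF e] by (metis mult_left_cancel less_irrefl)
  qed
  have bm: "b m = fcalc (\<lambda>x. poly (q i) x + c * ?s x) r"
    unfolding Suc q' by (rule fcalc_cong_range[OF proj_r qq])
  have s1: "\<bar>?s x\<bar> \<le> 1" if "0 < x" "x \<le> a" for x
    by (rule abs_kernel_poly_le[OF res pos]) (use q(4) that in \<open>auto simp: pev\<close>)
  have inc: "A (b (Suc i)) - A (b i) = c *\<^sub>R fcalc (\<lambda>x. x * ?s x) r"
  proof -
    have "(\<lambda>x. x * (poly (q i) x + c * ?s x)) = (\<lambda>x. x * poly (q i) x + c * (x * ?s x))"
      by (rule ext) (simp add: algebra_simps)
    then have "A (b m) = A (b i) + c *\<^sub>R fcalc (\<lambda>x. x * ?s x) r"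
      unfolding bm q(2)[OF order_refl] A_fcalc by (simp only: fcalc_add_fun fcalc_scale_fun)
    then show ?thesis unfolding Suc by (simp only: add_diff_cancel_left')
  qed
  have bk: "below_deg (Suc i) (kernel_poly p i)" by (rule below_deg_kernel_poly[OF res pos])
  have k0: "?s 0 = 1" by (rule kernel_poly_at_0[OF res pos])
  have "norm (r - A (b i)) \<le> norm (fcalc ?s r)" by (rule residual_minimal[OF bk k0])
  also have "fcalc ?s r = fcalc (\<lambda>x. low x * ?s x) r + fcalc (\<lambda>x. (1 - low x) * ?s x) r"
    unfolding fcalc_add_fun[symmetric] by (rule arg_cong[where f = "\<lambda>f. fcalc f r"]) (simp add: fun_eq_iff)
  also have "norm \<dots> \<le> norm (fcalc low r) + norm (fcalc (\<lambda>x. (1 / a) * (x * ?s x)) r)"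
  proof (rule norm_triangle_mono)
    show "norm (fcalc (\<lambda>x. low x * ?s x) r) \<le> norm (fcalc low r)"
    proof (rule norm_fcalc_mono)
      show "\<bar>low 0 * ?s 0\<bar> \<le> \<bar>low 0\<bar>" using k0 a by simp
    qed (use s1 tpos in auto)
    have "\<bar>(1 - low x) * ?s x\<bar> \<le> \<bar>(1 / a) * (x * ?s x)\<bar>" if "0 \<le> x" for x
    proof (cases "x \<le> a")
      case False
      then have "1 * \<bar>?s x\<bar> \<le> (x / a) * \<bar>?s x\<bar>" using a by (intro mult_right_mono) auto
      then show ?thesis using False that a by (simp add: abs_mult)
    qed simp
    then show "norm (fcalc (\<lambda>x. (1 - low x) * ?s x) r) \<le> norm (fcalc (\<lambda>x. (1 / a) * (x * ?s x)) r)"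
      by (intro norm_fcalc_mono) (use tpos a in \<open>auto simp: less_imp_le\<close>)
  qed
  also have "norm (fcalc (\<lambda>x. (1 / a) * (x * ?s x)) r) = norm (fcalc (\<lambda>x. x * ?s x) r) / a"
    unfolding fcalc_scale_fun using a by simp
  finally have split: "norm (r - A (b i)) \<le> norm (fcalc low r) + norm (fcalc (\<lambda>x. x * ?s x) r) / a" .
  have c: "\<bar>c\<bar> \<le> 2 * \<tau> / (\<tau> - 1) / a"
  proof (rule step_size_bound[OF tau a _ _ low_frequency_data split])
    show "0 < norm (r - A (b i))" using nz[of i] by simp
    show "\<tau> * \<Delta> < norm (r - A (b i))" by (rule before) (simp add: Suc)
    show "\<bar>c\<bar> * norm (fcalc (\<lambda>x. x * ?s x) r) \<le> norm (r - A (b i))"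
      using residual_step[of i] unfolding inc norm_scaleR .
  qed simp
  have "\<bar>poly (q i) x + c * ?s x\<bar> \<le> (1 + 2 * \<tau> / (\<tau> - 1)) / a" if x: "0 < x" "x \<le> a" for x
  proof -
    have "\<bar>c * ?s x\<bar> \<le> \<bar>c\<bar> * 1" unfolding abs_mult by (intro mult_left_mono s1[OF x]) simp
    then have "\<bar>poly (q i) x + c * ?s x\<bar> \<le> 1 / a + \<bar>c\<bar>" using q(5)[OF order_refl x] by linarith
    also have "\<dots> \<le> 1 / a + 2 * \<tau> / (\<tau> - 1) / a" using c by linarith
    finally show ?thesis by (simp only: add_divide_distrib)
  qed
  with bm show ?thesis
    by (intro exI[of _ "\<lambda>x. poly (q i) x + c * ?s x"] conjI allI impI)
qed

text \<open>
  Frequencies up to \<open>a\<close> are controlled by the filter, applied to the noise and to \<open>\<beta>\<close>. On the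
  remaining ones \<open>A\<close> is at least \<open>a\<close>, so that the residual bounds the error.
\<close>

lemma stopped_error:
  assumes before: "\<And>j. j < m \<Longrightarrow> norm (r - A (b j)) > \<tau> * \<Delta>"
    and stop: "norm (r - A (b m)) \<le> \<tau> * \<Delta>"
  defines "C \<equiv> 1 + 2 * \<tau> / (\<tau> - 1)"
  shows "norm (b m - \<beta>) \<le> (C + 1 + \<tau>) * (\<Delta> / a) + (1 + C) * G a"
proof -
  have C: "C \<ge> 0"
    unfolding C_def using tau by (intro add_nonneg_nonneg divide_nonneg_nonneg) auto
  have "\<exists>g. b m = fcalc g r \<and> (\<forall>x. 0 < x \<longrightarrow> x \<le> a \<longrightarrow> \<bar>g x\<bar> \<le> C / a)"
    unfolding C_def by (rule stopped_filter[OF before])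
  then obtain g where "b m = fcalc g r \<and> (\<forall>x. 0 < x \<longrightarrow> x \<le> a \<longrightarrow> \<bar>g x\<bar> \<le> C / a)" ..
  then have g: "b m = fcalc g r" "\<And>x. 0 < x \<Longrightarrow> x \<le> a \<Longrightarrow> \<bar>g x\<bar> \<le> C / a" by simp_all
  have "fcalc low (b m - \<beta>) = fcalc (\<lambda>x. low x * g x) (r - A \<beta>) + fcalc (\<lambda>x. low x * (x * g x - 1)) \<beta>"
  proof -
    have "fcalc low (b m - \<beta>) = fcalc (\<lambda>x. low x * g x) r - fcalc low \<beta>"
      by (simp add: fcalc_diff g(1) fcalc_comp)
    also have "fcalc (\<lambda>x. low x * g x) r
        = fcalc (\<lambda>x. low x * g x) (r - A \<beta>) + fcalc (\<lambda>x. x * (low x * g x)) \<beta>" by (rule fcalc_r_split)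
    also have "fcalc (\<lambda>x. x * (low x * g x)) \<beta> = fcalc (\<lambda>x. low x * (x * g x - 1)) \<beta> + fcalc low \<beta>"
      unfolding fcalc_add_fun[symmetric]
      by (rule arg_cong[where f = "\<lambda>f. fcalc f \<beta>"]) (simp add: fun_eq_iff)
    finally show ?thesis by simp
  qed
  moreover have "norm (fcalc (\<lambda>x. low x * g x) (r - A \<beta>)) \<le> C / a * norm (r - A \<beta>)"
    by (rule norm_fcalc_bound_range[OF proj_noise]) (use g(2) tpos a C in auto)
  moreover have "norm (fcalc (\<lambda>x. low x * (x * g x - 1)) \<beta>) \<le> (1 + C) * G a"
  proof (rule source[OF a])
    fix x :: real assume x: "0 \<le> x"
    have "\<bar>x * g x - 1\<bar> \<le> 1 + C" if "x \<le> a"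
    proof (cases "x = 0")
      case False
      then have "\<bar>x * g x\<bar> \<le> a * (C / a)"
        unfolding abs_mult using g(2)[of x] x that a by (intro mult_mono) auto
      then show ?thesis using a by simp
    qed (use C in simp)
    then show "\<bar>low x * (x * g x - 1)\<bar> \<le> 1 + C \<and>
        \<bar>low x * (x * g x - 1)\<bar> * x ^ k \<le> (1 + C) * a ^ k"
      using x a C by (auto intro!: mult_mono power_mono)
  qed
  moreover have "C / a * norm (r - A \<beta>) \<le> C / a * \<Delta>"
    using noise C a by (intro mult_left_mono) auto
  ultimately have 1: "norm (fcalc low (b m - \<beta>)) \<le> C / a * \<Delta> + (1 + C) * G a"
    using norm_triangle_ineq[of "fcalc (\<lambda>x. low x * g x) (r - A \<beta>)"
        "fcalc (\<lambda>x. low x * (x * g x - 1)) \<beta>"] by simp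
  have "norm (fcalc (\<lambda>x. 1 - low x) (b m - \<beta>)) \<le> norm (fcalc (\<lambda>x. (1 / a) * x) (b m - \<beta>))"
  proof (rule norm_fcalc_mono)
    fix e assume "e \<in> E"
    then show "\<bar>1 - low (t e)\<bar> \<le> \<bar>1 / a * t e\<bar>" using a tpos[of e] by auto
  qed (use a in auto)
  also have "\<dots> = norm (A (b m - \<beta>)) / a"
    using a by (simp only: fcalc_scale_fun fcalc_id) simp
  also have "\<dots> \<le> ((1 + \<tau>) * \<Delta>) / a"
  proof (intro divide_right_mono)
    have "A (b m - \<beta>) = (r - A \<beta>) - (r - A (b m))" by (simp add: A_diff)
    then have "norm (A (b m - \<beta>)) \<le> norm (r - A \<beta>) + norm (r - A (b m))"
      using norm_triangle_ineq4 by metis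
    then show "norm (A (b m - \<beta>)) \<le> (1 + \<tau>) * \<Delta>" using noise stop by (simp add: algebra_simps)
  qed (use a in simp)
  finally have 2: "norm (fcalc (\<lambda>x. 1 - low x) (b m - \<beta>)) \<le> (1 + \<tau>) * \<Delta> / a" .
  have "b m - \<beta> = fcalc low (b m - \<beta>) + fcalc (\<lambda>x. 1 - low x) (b m - \<beta>)"
    by (simp add: fcalc_diff_fun fcalc_one)
  then have "norm (b m - \<beta>) \<le> norm (fcalc low (b m - \<beta>)) + norm (fcalc (\<lambda>x. 1 - low x) (b m - \<beta>))"
    by (metis norm_triangle_ineq)
  moreover have "(C + 1 + \<tau>) * (\<Delta> / a) = C / a * \<Delta> + (1 + \<tau>) * \<Delta> / a"
    using a by (simp add: field_simps)
  ultimately show ?thesis using 1 2 by linarith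
qed

end

text \<open>
  With threshold \<open>0\<close> the iteration runs until \<open>b m\<close> is the projection of \<open>\<beta>\<close> onto the range of \<open>A\<close>. The
  error is then the component of \<open>\<beta>\<close> in the kernel, which is a filter concentrated at frequency \<open>0\<close>.
\<close>

lemma noiseless_error:
  assumes "\<Delta> = 0" and stop: "norm (r - A (b m)) \<le> \<tau> * \<Delta>" and \<alpha>: "0 < \<alpha>"
  shows "norm (b m - \<beta>) \<le> G \<alpha>"
proof -
  have "norm (r - A \<beta>) \<le> 0" using noise unfolding assms(1) .
  moreover have "norm (r - A (b m)) \<le> 0" using stop unfolding assms(1) mult_zero_right .
  ultimately have "r = A \<beta>" "r = A (b m)" by auto
  then have "A (b m) = A \<beta>" by metis
  then have A0: "A (b m - \<beta>) = 0" unfolding A_diff by (rule right_minus_eq[THEN iffD2])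
  have e0: "e \<bullet> (b m - \<beta>) = 0" if "e \<in> E" for e
  proof -
    have "e \<bullet> A (b m - \<beta>) = t e * (e \<bullet> (b m - \<beta>))"
      using inner_fcalc[OF that, of "\<lambda>x. x"] by (simp add: fcalc_id)
    then show ?thesis using A0 tpos[OF that] by simp
  qed
  obtain q where q: "b m = fcalc (poly q) r" by (rule b_poly)
  have pb: "proj (b m) = b m" unfolding q by (rule proj_fcalc_range[OF proj_r])
  have "proj (b m - \<beta>) = 0" unfolding proj_def by (intro sum.neutral) (simp add: e0)
  then have "proj \<beta> = b m" unfolding proj_diff pb by simp
  then have "b m - \<beta> = - (\<beta> - proj \<beta>)" by simp
  also have "\<beta> - proj \<beta> = fcalc (\<lambda>x. if x = 0 then 1 else 0) \<beta>"
    unfolding fcalc_def using tpos by (auto intro!: sum.neutral[symmetric] simp: less_le)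
  finally have "norm (b m - \<beta>) = norm (fcalc (\<lambda>x. if x = 0 then 1 else 0) \<beta>)" by simp
  also have "\<dots> \<le> 1 * G \<alpha>" by (rule source[OF \<alpha>]) (use kpos \<alpha> in auto)
  finally show ?thesis by simp
qed

end

section \<open>Covariance operator of the population\<close>

lemma powr_square: "0 < a \<Longrightarrow> (a powr x)\<^sup>2 = a powr (2 * x)" for a x :: real
  by (simp add: power2_eq_square powr_add[symmetric])

locale population =
  fixes K :: "'h::{real_inner,banach} \<Rightarrow> 'h" and J :: "nat set" and l :: "nat \<Rightarrow> real" and v :: "nat \<Rightarrow> 'h"
  assumes dec: "eigen_decomposition K J l v" and inj: "\<not> is_eigenvalue K 0"
    and summable_l: "l summable_on J"
begin

lemma on_v: "orthonormal_family J v"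
  using dec by (simp add: eigen_decomposition_def orthonormal_family_def)

lemma K_v: "j \<in> J \<Longrightarrow> K (v j) = l j *\<^sub>R v j"
  using dec by (simp add: eigen_decomposition_def)

lemma K_has_sum: "((\<lambda>j. (l j * (v j \<bullet> b)) *\<^sub>R v j) has_sum K b) J"
  using dec by (simp add: eigen_decomposition_def)

lemma l_pos: assumes "j \<in> J" shows "0 < l j"
proof -
  have "v j \<noteq> 0" using norm_orthonormal[OF on_v assms] by (metis norm_zero zero_neq_one)
  then have "l j \<noteq> 0" using K_v[OF assms] inj unfolding is_eigenvalue_def by auto
  moreover have "0 \<le> l j" using dec assms by (simp add: eigen_decomposition_def)
  ultimately show ?thesis by simp
qed

lemma K_add: "K (b + c) = K b + K c"
proof (rule has_sum_unique[OF K_has_sum])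
  show "((\<lambda>j. (l j * (v j \<bullet> (b + c))) *\<^sub>R v j) has_sum (K b + K c)) J"
    using has_sum_add[OF K_has_sum[of b] K_has_sum[of c]]
    by (simp add: inner_add_right algebra_simps scaleR_add_left)
qed

lemma K_scale: "K (a *\<^sub>R b) = a *\<^sub>R K b"
proof (rule has_sum_unique[OF K_has_sum])
  show "((\<lambda>j. (l j * (v j \<bullet> (a *\<^sub>R b))) *\<^sub>R v j) has_sum (a *\<^sub>R K b)) J"
    using has_sum_bounded_linear[OF bounded_linear_scaleR_right[of a] K_has_sum[of b]]
    by (simp add: o_def mult_ac)
qed

text \<open>
  A vector orthogonal to all \<open>v j\<close> is in the kernel of \<open>K\<close>, which is trivial since \<open>0\<close> is not an
  eigenvalue.
\<close>

lemma total_v: assumes "\<forall>j\<in>J. v j \<bullet> b = 0" shows "b = 0"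
proof -
  have "((\<lambda>j. (l j * (v j \<bullet> b)) *\<^sub>R v j) has_sum 0) J"
    by (rule has_sum_0) (use assms in simp)
  then have "K b = 0 *\<^sub>R b" using has_sum_unique[OF K_has_sum] by simp
  then show ?thesis using inj unfolding is_eigenvalue_def by blast
qed

lemma inner_v_K: "j \<in> J \<Longrightarrow> v j \<bullet> K b = l j * (v j \<bullet> b)"
  by (rule orthonormal_series_coeff[OF on_v K_has_sum])

lemma K_pow_v: "j \<in> J \<Longrightarrow> (K ^^ k) (v j) = l j ^ k *\<^sub>R v j"
  by (induction k) (simp_all add: K_scale K_v)

lemma linear_K_pow: "linear (K ^^ k)"
proof (rule linearI)
  show "(K ^^ k) (b + c) = (K ^^ k) b + (K ^^ k) c" for b c
    by (induction k) (simp_all add: K_add)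
  show "(K ^^ k) (a *\<^sub>R b) = a *\<^sub>R (K ^^ k) b" for a b
    by (induction k) (simp_all add: K_scale)
qed

text \<open>
  The weights satisfy \<open>x\<^sup>s \<le> \<eta>\<^sup>s (x/\<eta> + 1)\<close> for \<open>x = (l j)\<^sup>2\<close>, so the squared norm is dominated
  termwise by the Parseval sums of \<open>K u\<close> and \<open>u\<close>. An optimal choice of \<open>\<eta>\<close> turns this into the
  interpolation inequality between \<open>s = 0\<close> and \<open>s = 1\<close>.
\<close>

lemma spectral_sum:
  assumes s: "0 < s" "s \<le> 1" and \<eta>: "0 < \<eta>"
  shows "((\<lambda>j. (l j powr s * (v j \<bullet> u)) *\<^sub>R v j) has_sum spectral_power J l v s u) J"
    and "(norm (spectral_power J l v s u))\<^sup>2 \<le> \<eta> powr s * ((norm (K u))\<^sup>2 / \<eta> + (norm u)\<^sup>2)"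
proof -
  let ?c = "\<lambda>j. l j powr s * (v j \<bullet> u)"
  have hs: "((\<lambda>j. \<eta> powr s * ((v j \<bullet> K u)\<^sup>2 * (1 / \<eta>) + (v j \<bullet> u)\<^sup>2))
      has_sum \<eta> powr s * ((norm (K u))\<^sup>2 * (1 / \<eta>) + (norm u)\<^sup>2)) J"
    by (intro has_sum_cmult_right has_sum_add has_sum_cmult_left parseval[OF on_v total_v])
  have le: "(?c j)\<^sup>2 \<le> \<eta> powr s * ((v j \<bullet> K u)\<^sup>2 * (1 / \<eta>) + (v j \<bullet> u)\<^sup>2)" if j: "j \<in> J" for j
  proof -
    have "(l j powr s)\<^sup>2 \<le> \<eta> powr s * ((l j)\<^sup>2 / \<eta> + 1)"
    proof -
      have "(l j powr s)\<^sup>2 = ((l j)\<^sup>2) powr s"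
        using l_pos[OF j] by (simp add: power2_eq_square powr_mult)
      also have "((l j)\<^sup>2) powr s = \<eta> powr s * ((l j)\<^sup>2 / \<eta>) powr s"
        using l_pos[OF j] \<eta> by (simp flip: powr_mult)
      also have "((l j)\<^sup>2 / \<eta>) powr s \<le> (l j)\<^sup>2 / \<eta> + 1"
      proof (cases "(l j)\<^sup>2 / \<eta> \<le> 1")
        case True
        then have "((l j)\<^sup>2 / \<eta>) powr s \<le> 1 powr s" using s \<eta> by (intro powr_mono2) auto
        moreover have "0 \<le> (l j)\<^sup>2 / \<eta>" using \<eta> by simp
        ultimately show ?thesis by simp
      next
        case False
        then have "((l j)\<^sup>2 / \<eta>) powr s \<le> ((l j)\<^sup>2 / \<eta>) powr 1" using s by (intro powr_mono) auto
        then show ?thesis using \<eta> by simp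
      qed
      finally show ?thesis by (simp add: mult_left_mono)
    qed
    then have "(l j powr s)\<^sup>2 * (v j \<bullet> u)\<^sup>2 \<le> \<eta> powr s * ((l j)\<^sup>2 / \<eta> + 1) * (v j \<bullet> u)\<^sup>2"
      by (rule mult_right_mono) simp
    then show ?thesis unfolding inner_v_K[OF j] by (simp add: power_mult_distrib algebra_simps)
  qed
  have sm: "(\<lambda>j. (?c j)\<^sup>2) summable_on J"
    by (rule summable_on_comparison_test[OF has_sum_imp_summable[OF hs]]) (use le in auto)
  have "spectral_power J l v s u = (\<Sum>\<^sub>\<infinity>j\<in>J. ?c j *\<^sub>R v j)"
    using s by (simp add: spectral_power_def)
  then show S: "((\<lambda>j. ?c j *\<^sub>R v j) has_sum spectral_power J l v s u) J"
    using has_sum_infsum[OF orthonormal_series_summable[OF on_v sm]] by simp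
  have "(norm (spectral_power J l v s u))\<^sup>2 \<le> \<eta> powr s * ((norm (K u))\<^sup>2 * (1 / \<eta>) + (norm u)\<^sup>2)"
    by (rule has_sum_mono[OF norm_orthonormal_series[OF on_v S] hs le])
  then show "(norm (spectral_power J l v s u))\<^sup>2 \<le> \<eta> powr s * ((norm (K u))\<^sup>2 / \<eta> + (norm u)\<^sup>2)" by simp
qed

lemma spectral_power_interpolation:
  assumes "0 \<le> s" "s \<le> 1" "0 < \<eta>"
  shows "(norm (spectral_power J l v s u))\<^sup>2 \<le> \<eta> powr s * ((norm (K u))\<^sup>2 / \<eta> + (norm u)\<^sup>2)"
proof (cases "s = 0")
  case True
  then show ?thesis using assms by (simp add: spectral_power_def)
next
  case False
  then show ?thesis using spectral_sum(2)[of s \<eta> u] assms by simp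
qed

lemma bounded_linear_spectral_power:
  assumes s: "0 \<le> s" "s \<le> 1" and L: "\<And>b. norm (K b) \<le> L * norm b"
  shows "bounded_linear (spectral_power J l v s)"
proof (cases "s = 0")
  case True
  then have "spectral_power J l v s = (\<lambda>b. b)" by (simp add: spectral_power_def fun_eq_iff)
  then show ?thesis using bounded_linear_ident by simp
next
  case False
  then have s': "0 < s" using s by simp
  note hs = spectral_sum(1)[OF s' s(2) zero_less_one]
  show ?thesis
  proof (rule bounded_linear_intro[where K = "sqrt (L\<^sup>2 + 1)"])
    fix b c
    show "spectral_power J l v s (b + c) = spectral_power J l v s b + spectral_power J l v s c"
      by (rule has_sum_unique[OF hs])
         (use has_sum_add[OF hs[of b] hs[of c]] in \<open>simp add: inner_add_right algebra_simps scaleR_add_left\<close>)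
    show "spectral_power J l v s (a *\<^sub>R b) = a *\<^sub>R spectral_power J l v s b" for a
      by (rule has_sum_unique[OF hs])
         (use has_sum_bounded_linear[OF bounded_linear_scaleR_right[of a] hs[of b]] in \<open>simp add: o_def mult_ac\<close>)
    have "(norm (spectral_power J l v s b))\<^sup>2 \<le> (norm (K b))\<^sup>2 + (norm b)\<^sup>2"
      using spectral_power_interpolation[OF s zero_less_one, of b] by simp
    also have "\<dots> \<le> (L * norm b)\<^sup>2 + (norm b)\<^sup>2"
      by (intro add_right_mono power_mono L) simp
    also have "\<dots> = (norm b * sqrt (L\<^sup>2 + 1))\<^sup>2"
      by (simp add: power_mult_distrib algebra_simps)
    finally show "norm (spectral_power J l v s b) \<le> norm b * sqrt (L\<^sup>2 + 1)"
      by (rule power2_le_imp_le) simp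
  qed
qed

text \<open>
  The vector \<open>w\<close> collects the finitely many eigenvalues above \<open>\<alpha>\<close> and \<open>\<rho>\<close> the remaining ones. Both
  bounds compare a power of an eigenvalue with the same power of \<open>\<alpha>\<close>; the one for \<open>w\<close> has the
  nonpositive exponent \<open>\<mu> - k\<close>.
\<close>

lemma source_cutoff:
  fixes \<mu> R \<alpha> :: real
  assumes \<mu>: "0 < \<mu>" "\<mu> \<le> real k" and R: "0 < R" and \<alpha>: "0 < \<alpha>"
    and src: "(\<lambda>j. (\<beta> \<bullet> v j)\<^sup>2 / l j powr (2 * \<mu>)) summable_on J"
      "(\<Sum>\<^sub>\<infinity>j\<in>J. (\<beta> \<bullet> v j)\<^sup>2 / l j powr (2 * \<mu>)) \<le> R\<^sup>2"
  shows "\<exists>w \<rho>. \<beta> = (K ^^ k) w + \<rho> \<and> norm w \<le> R * \<alpha> powr (\<mu> - real k) \<and> norm \<rho> \<le> R * \<alpha> powr \<mu>"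
proof -
  define F where "F = {j \<in> J. l j > \<alpha>}"
  have FJ: "F \<subseteq> J" by (auto simp: F_def)
  have "finite F"
  proof (rule ccontr)
    assume inf: "infinite F"
    obtain m :: nat where m: "(\<Sum>\<^sub>\<infinity>j\<in>J. l j) < real m * \<alpha>"
      using reals_Archimedean3[OF \<alpha>] by blast
    obtain G where G: "G \<subseteq> F" "finite G" "card G = m"
      using infinite_arbitrarily_large[OF inf] by metis
    have "real m * \<alpha> = (\<Sum>j\<in>G. \<alpha>)" using G by simp
    also have "\<dots> \<le> (\<Sum>j\<in>G. l j)" using G by (intro sum_mono) (auto simp: F_def less_imp_le)
    also have "\<dots> \<le> (\<Sum>\<^sub>\<infinity>j\<in>J. l j)"
      by (rule finite_sum_le_infsum[OF summable_l G(2)]) (use G FJ l_pos in \<open>auto simp: less_imp_le\<close>)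
    finally show False using m by simp
  qed
  note onF = orthonormal_family_subset[OF on_v FJ]
  let ?q = "\<lambda>j. (\<beta> \<bullet> v j)\<^sup>2 / l j powr (2 * \<mu>)"
  define w where "w = (\<Sum>j\<in>F. ((v j \<bullet> \<beta>) / l j ^ k) *\<^sub>R v j)"
  define \<rho> where "\<rho> = \<beta> - (\<Sum>j\<in>F. (v j \<bullet> \<beta>) *\<^sub>R v j)"
  have "(K ^^ k) w = (\<Sum>j\<in>F. ((v j \<bullet> \<beta>) / l j ^ k) *\<^sub>R (K ^^ k) (v j))"
    unfolding w_def by (simp add: linear_sum[OF linear_K_pow] linear_scale[OF linear_K_pow])
  also have "\<dots> = (\<Sum>j\<in>F. (v j \<bullet> \<beta>) *\<^sub>R v j)"
  proof (rule sum.cong)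
    fix j assume "j \<in> F"
    then have j: "j \<in> J" using FJ by auto
    show "((v j \<bullet> \<beta>) / l j ^ k) *\<^sub>R (K ^^ k) (v j) = (v j \<bullet> \<beta>) *\<^sub>R v j"
      using l_pos[OF j] by (simp add: K_pow_v[OF j])
  qed simp
  finally have eq: "\<beta> = (K ^^ k) w + \<rho>" by (simp add: \<rho>_def)
  have "(norm w)\<^sup>2 = (\<Sum>j\<in>F. ((v j \<bullet> \<beta>) / l j ^ k)\<^sup>2)"
    unfolding w_def by (rule norm_orthonormal_sum[OF onF \<open>finite F\<close>])
  also have "\<dots> \<le> (\<Sum>j\<in>F. \<alpha> powr (2 * (\<mu> - real k)) * ?q j)"
  proof (rule sum_mono)
    fix j assume j: "j \<in> F"
    then have lj: "0 < l j" "\<alpha> < l j" using l_pos FJ by (auto simp: F_def)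
    have "(l j ^ k)\<^sup>2 = l j powr (2 * real k)"
      using powr_square[OF lj(1), of "real k"] powr_realpow[OF lj(1), of k] by simp
    then have eq: "((v j \<bullet> \<beta>) / l j ^ k)\<^sup>2 = l j powr (2 * (\<mu> - real k)) * ?q j"
      using lj by (simp add: power_divide inner_commute[of \<beta>] right_diff_distrib powr_diff)
    have "l j powr (2 * (\<mu> - real k)) \<le> \<alpha> powr (2 * (\<mu> - real k))"
      using \<mu> lj \<alpha> by (intro powr_mono2') auto
    then show "((v j \<bullet> \<beta>) / l j ^ k)\<^sup>2 \<le> \<alpha> powr (2 * (\<mu> - real k)) * ?q j"
      unfolding eq by (rule mult_right_mono) simp
  qed
  also have "\<dots> = \<alpha> powr (2 * (\<mu> - real k)) * (\<Sum>j\<in>F. ?q j)" by (simp add: sum_distrib_left)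
  also have "\<dots> \<le> \<alpha> powr (2 * (\<mu> - real k)) * R\<^sup>2"
    using order_trans[OF finite_sum_le_infsum[OF src(1) \<open>finite F\<close> FJ] src(2)]
    by (intro mult_left_mono) auto
  also have "\<dots> = (R * \<alpha> powr (\<mu> - real k))\<^sup>2"
    unfolding power_mult_distrib powr_square[OF \<alpha>] by (rule mult.commute)
  finally have "(norm w)\<^sup>2 \<le> (R * \<alpha> powr (\<mu> - real k))\<^sup>2" .
  then have w: "norm w \<le> R * \<alpha> powr (\<mu> - real k)"
    by (rule power2_le_imp_le) (use R in simp)
  have coef: "v j \<bullet> \<rho> = (if j \<in> F then 0 else v j \<bullet> \<beta>)" if j: "j \<in> J" for j
  proof (cases "j \<in> F")
    case True
    then show ?thesis
      using inner_orthonormal_sum[OF onF \<open>finite F\<close> True, of "\<lambda>j. v j \<bullet> \<beta>"] by (simp add: \<rho>_def inner_diff_right)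
  next
    case False
    have "v j \<bullet> (\<Sum>i\<in>F. (v i \<bullet> \<beta>) *\<^sub>R v i) = 0"
      unfolding inner_sum_right
      by (rule sum.neutral) (use on_v j False FJ in \<open>auto simp: orthonormal_family_def subset_iff\<close>)
    then show ?thesis using False by (simp add: \<rho>_def inner_diff_right)
  qed
  have "(norm \<rho>)\<^sup>2 \<le> \<alpha> powr (2 * \<mu>) * (\<Sum>\<^sub>\<infinity>j\<in>J. ?q j)"
  proof (rule has_sum_mono[OF parseval[OF on_v total_v] has_sum_cmult_right[OF has_sum_infsum[OF src(1)]]])
    fix j assume j: "j \<in> J"
    show "(v j \<bullet> \<rho>)\<^sup>2 \<le> \<alpha> powr (2 * \<mu>) * ?q j"
    proof (cases "j \<in> F")
      case True
      then show ?thesis by (simp add: coef[OF j])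
    next
      case False
      then have lj: "0 < l j" "l j \<le> \<alpha>" using l_pos[OF j] j by (auto simp: F_def)
      have "v j \<bullet> \<rho> = \<beta> \<bullet> v j" using coef[OF j] False by (simp add: inner_commute[of \<beta>])
      then have "(v j \<bullet> \<rho>)\<^sup>2 = l j powr (2 * \<mu>) * ?q j" using lj by simp
      also have "\<dots> \<le> \<alpha> powr (2 * \<mu>) * ?q j"
        using \<mu> lj by (intro mult_right_mono powr_mono2) auto
      finally show ?thesis .
    qed
  qed
  also have "\<dots> \<le> \<alpha> powr (2 * \<mu>) * R\<^sup>2" by (intro mult_left_mono src(2)) simp
  also have "\<dots> = (R * \<alpha> powr \<mu>)\<^sup>2"
    unfolding power_mult_distrib powr_square[OF \<alpha>] by (rule mult.commute)
  finally have "norm \<rho> \<le> R * \<alpha> powr \<mu>"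
    by (rule power2_le_imp_le) (use R in simp)
  with eq w show ?thesis by blast
qed

end

section \<open>Convergence rate for given deviations\<close>

lemma operator_power_diff:
  fixes A K :: "'h::real_normed_vector \<Rightarrow> 'h"
  assumes lin: "linear A" and A: "\<And>b. norm (A b) \<le> M * norm b" and K: "\<And>b. norm (K b) \<le> M * norm b"
    and M: "1 \<le> M" and d: "\<And>b. norm (A b - K b) \<le> e * norm b" and e: "0 \<le> e"
  shows "norm ((A ^^ k) w - (K ^^ k) w) \<le> real k * M ^ k * e * norm w"
proof (induction k)
  case (Suc k)
  have Kk: "norm ((K ^^ k) w) \<le> M ^ k * norm w"
  proof (induction k)
    case (Suc k)
    have "norm ((K ^^ Suc k) w) \<le> M * norm ((K ^^ k) w)" using K by simp
    also have "\<dots> \<le> M * (M ^ k * norm w)" using Suc M by (intro mult_left_mono) auto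
    finally show ?case by (simp add: mult.assoc)
  qed simp
  have "(A ^^ Suc k) w - (K ^^ Suc k) w = A ((A ^^ k) w - (K ^^ k) w) + (A ((K ^^ k) w) - K ((K ^^ k) w))"
    by (simp add: linear_diff[OF lin])
  then have "norm ((A ^^ Suc k) w - (K ^^ Suc k) w)
      \<le> norm (A ((A ^^ k) w - (K ^^ k) w)) + norm (A ((K ^^ k) w) - K ((K ^^ k) w))"
    by (simp only: norm_triangle_ineq)
  also have "\<dots> \<le> M * (real k * M ^ k * e * norm w) + e * (M ^ k * norm w)"
    using order_trans[OF A mult_left_mono[OF Suc]] order_trans[OF d mult_left_mono[OF Kk e]] M
    by (intro add_mono) auto
  also have "e * (M ^ k * norm w) \<le> M * (e * (M ^ k * norm w))"
    using M e mult_right_mono[of 1 M "e * (M ^ k * norm w)"] by simp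
  also have "M * (real k * M ^ k * e * norm w) + M * (e * (M ^ k * norm w)) = real (Suc k) * M ^ Suc k * e * norm w"
    by (simp add: algebra_simps)
  finally show ?case by simp
qed simp

lemma sample_minimal_residual:
  "\<exists>E t. minimal_residual (sample_cov n x) E t (sample_cross_cov n x y) (pls_estimator n x y)"
proof -
  obtain E t where E: "finite_spectral (sample_cov n x) E t"
    and ex: "\<forall>b\<in>span (x ` {1..n}). (\<Sum>e\<in>E. (e \<bullet> b) *\<^sub>R e) = b"
    using sample_cov_spectral[of n x] by (elim exE conjE) (rule that)
  interpret finite_spectral "sample_cov n x" E t by (rule E)
  have "minimal_residual (sample_cov n x) E t (sample_cross_cov n x y) (pls_estimator n x y)"
  proof unfold_locales
    show "proj (sample_cross_cov n x y) = sample_cross_cov n x y"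
      unfolding proj_def by (rule bspec[OF ex sample_cross_cov_in_span])
  qed (rule pls_estimator_in_krylov, rule pls_residual_orthogonal)
  then show ?thesis by (intro exI)
qed

lemma stopping_index_props:
  fixes n :: nat and x :: "nat \<Rightarrow> 'h::real_inner" and y :: "nat \<Rightarrow> real"
  defines "res \<equiv> \<lambda>m. norm (sample_cross_cov n x y - sample_cov n x (pls_estimator n x y m))"
  assumes "0 \<le> s"
  shows "res (stopping_index n x y s) \<le> s" and "\<And>j. j < stopping_index n x y s \<Longrightarrow> s < res j"
proof -
  obtain E t where "minimal_residual (sample_cov n x) E t (sample_cross_cov n x y) (pls_estimator n x y)"
    using sample_minimal_residual[of n x y] by (elim exE) (rule that)
  from minimal_residual.residual_vanishes[OF this] obtain m where "res m = 0"
    unfolding res_def by auto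
  then have ex: "\<exists>m. res m \<le> s" using assms(2) by (intro exI[of _ m]) simp
  have st: "stopping_index n x y s = (LEAST m. res m \<le> s)"
    unfolding stopping_index_def res_def ..
  show "res (stopping_index n x y s) \<le> s" unfolding st by (rule LeastI_ex[OF ex])
  show "s < res j" if "j < stopping_index n x y s" for j
    using not_less_Least[of j "\<lambda>m. res m \<le> s"] that unfolding st by simp
qed

text \<open>
  The bound for a unit filter at level \<open>\<alpha>\<close>: the first term comes from the smoothness of \<open>\<beta>\<close> with
  respect to \<open>K\<close>, the second one from the difference of the \<open>k\<close>-th powers of the two operators.
\<close>

definition source_modulus :: "real \<Rightarrow> real \<Rightarrow> nat \<Rightarrow> real \<Rightarrow> real \<Rightarrow> real \<Rightarrow> real" where
  "source_modulus R \<mu> k D e \<alpha> = R * (2 * \<alpha> powr \<mu> + D * e * \<alpha> powr (\<mu> - real k))"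

text \<open>
  At levels of order \<open>e powr (1/(\<mu>+1))\<close> the operator error is of no larger order than the smoothness
  term, since \<open>k < \<mu> + 1\<close>.
\<close>

lemma source_modulus_scaled:
  assumes \<mu>: "0 < \<mu>" "real k < \<mu> + 1" and R: "0 \<le> R" and D: "0 \<le> D"
    and e: "0 < e" "e \<le> 1" and a0: "0 < a0"
  shows "source_modulus R \<mu> k D e (a0 * e powr (1 / (\<mu> + 1)))
    \<le> R * (2 * a0 powr \<mu> + D * a0 powr (\<mu> - real k)) * e powr (\<mu> / (\<mu> + 1))"
proof -
  have sc: "(a0 * e powr (1 / (\<mu> + 1))) powr z = a0 powr z * e powr (z / (\<mu> + 1))" for z
    using a0 by (simp add: powr_mult powr_powr)
  have "e * e powr ((\<mu> - real k) / (\<mu> + 1)) = e powr (1 + (\<mu> - real k) / (\<mu> + 1))"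
    using e by (simp add: powr_add)
  also have "\<dots> \<le> e powr (\<mu> / (\<mu> + 1))"
  proof (rule powr_mono')
    have "\<mu> / (\<mu> + 1) \<le> ((\<mu> + 1) + (\<mu> - real k)) / (\<mu> + 1)"
      using \<mu> by (intro divide_right_mono) auto
    then show "\<mu> / (\<mu> + 1) \<le> 1 + (\<mu> - real k) / (\<mu> + 1)"
      using \<mu> by (subst (asm) add_divide_distrib[of "\<mu> + 1"]) simp
  qed (use e in auto)
  finally have "D * a0 powr (\<mu> - real k) * (e * e powr ((\<mu> - real k) / (\<mu> + 1)))
      \<le> D * a0 powr (\<mu> - real k) * e powr (\<mu> / (\<mu> + 1))"
    using D by (intro mult_left_mono) auto
  then have "2 * (a0 powr \<mu> * e powr (\<mu> / (\<mu> + 1))) + D * e * (a0 powr (\<mu> - real k) * e powr ((\<mu> - real k) / (\<mu> + 1)))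
      \<le> (2 * a0 powr \<mu> + D * a0 powr (\<mu> - real k)) * e powr (\<mu> / (\<mu> + 1))"
    by (simp add: algebra_simps)
  then show ?thesis
    unfolding source_modulus_def sc mult.assoc[of R] using R by (intro mult_left_mono) auto
qed

lemma source_modulus_small:
  assumes \<mu>: "0 < \<mu>" "real k < \<mu> + 1" "0 < k" and R: "0 \<le> R" and D: "0 \<le> D"
    and e: "0 < e" "e \<le> 1" and a0: "0 < a0" "a0 \<le> 1"
    and \<alpha>: "0 < \<alpha>" "\<alpha> \<le> a0 * e powr (1 / (\<mu> + 1))"
  shows "\<alpha> * source_modulus R \<mu> k D e \<alpha> \<le> R * (2 + D) * a0 powr (\<mu> + 1 - real k) * e"
proof -
  let ?\<theta> = "\<mu> + 1 - real k"
  have \<theta>: "0 < ?\<theta>" "?\<theta> \<le> \<mu> + 1" using \<mu> by auto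
  have sc: "(a0 * e powr (1 / (\<mu> + 1))) powr z = a0 powr z * e powr (z / (\<mu> + 1))" for z
    using a0 by (simp add: powr_mult powr_powr)
  have "\<alpha> powr (\<mu> + 1) \<le> a0 powr (\<mu> + 1) * e"
    using powr_mono2[OF _ _ \<alpha>(2), of "\<mu> + 1"] sc[of "\<mu> + 1"] \<mu> \<alpha> e by simp
  also have "\<dots> \<le> a0 powr ?\<theta> * e"
    using e a0 \<theta> by (intro mult_right_mono powr_mono') auto
  finally have 1: "\<alpha> powr (\<mu> + 1) \<le> a0 powr ?\<theta> * e" .
  have "\<alpha> powr ?\<theta> \<le> a0 powr ?\<theta> * e powr (?\<theta> / (\<mu> + 1))"
    using powr_mono2[OF _ _ \<alpha>(2), of ?\<theta>] sc[of ?\<theta>] \<theta> \<alpha> by simp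
  also have "\<dots> \<le> a0 powr ?\<theta> * 1"
    using e \<theta> \<mu> by (intro mult_left_mono powr_le1) auto
  finally have 2: "\<alpha> powr ?\<theta> \<le> a0 powr ?\<theta>" by simp
  have "\<alpha> * source_modulus R \<mu> k D e \<alpha> = R * (2 * \<alpha> powr (\<mu> + 1) + D * e * \<alpha> powr ?\<theta>)"
  proof -
    have "\<alpha> powr (\<mu> + 1) = \<alpha> * \<alpha> powr \<mu>" using \<alpha> by (simp add: powr_add)
    moreover have "\<alpha> powr ?\<theta> = \<alpha> * \<alpha> powr (\<mu> - real k)"
      using \<alpha> powr_add[of \<alpha> 1 "\<mu> - real k"] by (simp add: algebra_simps)
    ultimately show ?thesis by (simp add: source_modulus_def algebra_simps)
  qed
  also have "\<dots> \<le> R * (2 * (a0 powr ?\<theta> * e) + D * e * a0 powr ?\<theta>)"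
    using 1 2 R D e by (intro mult_left_mono add_mono) auto
  also have "\<dots> = R * (2 + D) * a0 powr ?\<theta> * e" by (simp add: algebra_simps)
  finally show ?thesis .
qed

context population
begin

text \<open>
  Write \<open>\<beta> = A\<^sup>k w + (K\<^sup>k - A\<^sup>k) w + \<rho>\<close> with the spectral cutoff at level \<open>\<alpha>\<close>. On the first term
  the decay of \<open>f\<close> gains \<open>\<alpha>\<^sup>k\<close>, which compensates the size of \<open>w\<close>.
\<close>

lemma source_filter_bound:
  fixes A :: "'h \<Rightarrow> 'h"
  assumes spec: "finite_spectral A E t" and f: "\<And>x. 0 \<le> x \<Longrightarrow> \<bar>f x\<bar> \<le> B \<and> \<bar>f x\<bar> * x ^ k \<le> B * \<alpha> ^ k"
    and \<mu>: "0 < \<mu>" "\<mu> \<le> real k" and R: "0 < R" and \<alpha>: "0 < \<alpha>"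
    and src: "(\<lambda>j. (\<beta> \<bullet> v j)\<^sup>2 / l j powr (2 * \<mu>)) summable_on J"
      "(\<Sum>\<^sub>\<infinity>j\<in>J. (\<beta> \<bullet> v j)\<^sup>2 / l j powr (2 * \<mu>)) \<le> R\<^sup>2"
    and d: "\<And>w. norm ((A ^^ k) w - (K ^^ k) w) \<le> e * norm w" and e: "0 \<le> e"
  shows "norm (finite_spectral.fcalc E t f \<beta>) \<le> B * (R * (2 * \<alpha> powr \<mu> + e * \<alpha> powr (\<mu> - real k)))"
proof -
  interpret finite_spectral A E t by (rule spec)
  obtain w \<rho> where dec: "\<beta> = (K ^^ k) w + \<rho>" and w: "norm w \<le> R * \<alpha> powr (\<mu> - real k)"
    and \<rho>: "norm \<rho> \<le> R * \<alpha> powr \<mu>"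
    using source_cutoff[OF \<mu> R \<alpha> src] by (elim exE conjE) (rule that)
  have B: "B \<ge> 0" using f[of 0] by (auto intro: order_trans[OF abs_ge_zero])
  have bound: "norm (fcalc f c) \<le> B * norm c" for c
    by (rule norm_fcalc_bound) (use f tpos in \<open>auto simp: less_imp_le\<close>)
  have "\<beta> = (A ^^ k) w - ((A ^^ k) w - (K ^^ k) w) + \<rho>" using dec by simp
  then have split: "fcalc f \<beta> = fcalc f ((A ^^ k) w) - fcalc f ((A ^^ k) w - (K ^^ k) w) + fcalc f \<rho>"
    by (metis fcalc_add fcalc_diff)
  have "fcalc f ((A ^^ k) w) = fcalc (\<lambda>x. f x * x ^ k) w" unfolding A_pow fcalc_comp ..
  moreover have "norm (fcalc (\<lambda>x. f x * x ^ k) w) \<le> B * \<alpha> ^ k * norm w"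
    by (rule norm_fcalc_bound) (use f[OF less_imp_le[OF tpos]] f[of 0] tpos in \<open>auto simp: abs_mult power_abs less_imp_le\<close>)
  ultimately have 1: "norm (fcalc f ((A ^^ k) w)) \<le> B * \<alpha> ^ k * (R * \<alpha> powr (\<mu> - real k))"
    using mult_left_mono[OF w, of "B * \<alpha> ^ k"] B \<alpha> by simp
  have "\<alpha> ^ k * \<alpha> powr (\<mu> - real k) = \<alpha> powr \<mu>"
    using \<alpha> by (simp add: powr_realpow[symmetric] powr_add[symmetric])
  then have "B * \<alpha> ^ k * (R * \<alpha> powr (\<mu> - real k)) = B * (R * \<alpha> powr \<mu>)"
    by (metis mult.assoc mult.left_commute)
  with 1 have 1: "norm (fcalc f ((A ^^ k) w)) \<le> B * (R * \<alpha> powr \<mu>)" by simp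
  have "norm (fcalc f ((A ^^ k) w - (K ^^ k) w)) \<le> B * (e * norm w)"
    by (rule order_trans[OF bound mult_left_mono[OF d B]])
  also have "\<dots> \<le> B * (e * (R * \<alpha> powr (\<mu> - real k)))"
    by (intro mult_left_mono w e B)
  finally have 2: "norm (fcalc f ((A ^^ k) w - (K ^^ k) w)) \<le> B * (e * (R * \<alpha> powr (\<mu> - real k)))" .
  have 3: "norm (fcalc f \<rho>) \<le> B * (R * \<alpha> powr \<mu>)"
    by (rule order_trans[OF bound mult_left_mono[OF \<rho> B]])
  have "norm (fcalc f \<beta>) \<le> norm (fcalc f ((A ^^ k) w)) + norm (fcalc f ((A ^^ k) w - (K ^^ k) w)) + norm (fcalc f \<rho>)"
    unfolding split by (intro norm_triangle_le add_right_mono norm_triangle_ineq4)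
  also have "\<dots> \<le> B * (R * \<alpha> powr \<mu>) + B * (e * (R * \<alpha> powr (\<mu> - real k))) + B * (R * \<alpha> powr \<mu>)"
    by (intro add_mono 1 2 3)
  also have "\<dots> = B * (R * (2 * \<alpha> powr \<mu> + e * \<alpha> powr (\<mu> - real k)))" by (simp add: algebra_simps)
  finally show ?thesis .
qed

text \<open>
  The level is \<open>a = a0 * e powr (1/(\<mu>+1))\<close> with \<open>a0\<close> so small that, below \<open>a\<close>, the smoothness bound
  stays under the fraction \<open>(\<tau> - 1)/2\<close> of the noise level. For \<open>c0 = 0\<close> there is no noise level to
  compare with, and the stopped iterate solves the sample equation exactly.
\<close>

lemma pls_error_bound:
  fixes \<mu> R \<tau> L h c0 :: real and \<beta> :: 'h
  assumes \<mu>: "0 < \<mu>" and R: "0 < R" and \<tau>: "1 < \<tau>" and L: "0 \<le> L" and h: "0 \<le> h" and c0: "0 \<le> c0"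
    and src: "(\<lambda>j. (\<beta> \<bullet> v j)\<^sup>2 / l j powr (2 * \<mu>)) summable_on J"
      "(\<Sum>\<^sub>\<infinity>j\<in>J. (\<beta> \<bullet> v j)\<^sup>2 / l j powr (2 * \<mu>)) \<le> R\<^sup>2"
    and KL: "\<And>b. norm (K b) \<le> L * norm b"
  shows "\<exists>c\<ge>0. \<forall>n x y e. 0 < e \<longrightarrow> e \<le> 1 \<longrightarrow>
    (\<forall>b. norm (sample_cov n x b - K b) \<le> h * e * norm b) \<longrightarrow>
    norm (sample_cross_cov n x y - sample_cov n x \<beta>) \<le> c0 * e \<longrightarrow>
    norm (pls_estimator n x y (stopping_index n x y (\<tau> * (c0 * e))) - \<beta>) \<le> c * e powr (\<mu> / (\<mu> + 1))"
proof -
  define k where "k = nat \<lceil>\<mu>\<rceil>"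
  have k: "0 < k" "\<mu> \<le> real k" "real k < \<mu> + 1"
    using \<mu> unfolding k_def by linarith+
  \<comment> \<open>a common bound for both operator norms, at least \<open>1\<close> so that its powers increase\<close>
  define M where "M = 1 + L + h"
  define D where "D = real k * M ^ k * h"
  have M: "1 \<le> M" using L h by (simp add: M_def)
  have D: "0 \<le> D" using M h by (simp add: D_def)
  define C where "C = 1 + 2 * \<tau> / (\<tau> - 1)"
  have C: "0 \<le> C" unfolding C_def using \<tau> by (intro add_nonneg_nonneg divide_nonneg_nonneg) auto
  define \<theta> where "\<theta> = \<mu> + 1 - real k"
  have \<theta>: "0 < \<theta>" using k by (simp add: \<theta>_def)
  define Q where "Q = filter_const k * (R * (2 + D))"
  have Q: "Q > 0" using filter_const_ge[of k] R D by (simp add: Q_def)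
  define a0 where "a0 = (if c0 = 0 then 1 else min 1 (((\<tau> - 1) / 2 * c0 / Q) powr (1 / \<theta>)))"
  have a0: "0 < a0" "a0 \<le> 1" using c0 \<tau> Q by (auto simp: a0_def)
  have a0\<theta>: "Q * a0 powr \<theta> \<le> (\<tau> - 1) / 2 * c0" if "c0 > 0"
  proof -
    have "a0 powr \<theta> \<le> (((\<tau> - 1) / 2 * c0 / Q) powr (1 / \<theta>)) powr \<theta>"
      using that a0 \<theta> by (intro powr_mono2) (auto simp: a0_def)
    also have "\<dots> = (\<tau> - 1) / 2 * c0 / Q" using that \<theta> \<tau> Q by (simp add: powr_powr)
    finally show ?thesis using Q by (simp add: pos_le_divide_eq mult_ac)
  qed
  define c1 where "c1 = R * (2 * a0 powr \<mu> + D * a0 powr (\<mu> - real k))"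
  have c1: "0 \<le> c1" using R D by (simp add: c1_def)
  define c where "c = (C + 1 + \<tau>) * (c0 / a0) + (1 + C) * c1"
  have cnn: "0 \<le> c" using C \<tau> c0 a0 c1 by (simp add: c_def)
  have "norm (pls_estimator n x y (stopping_index n x y (\<tau> * (c0 * e))) - \<beta>) \<le> c * e powr (\<mu> / (\<mu> + 1))"
    if e: "0 < e" "e \<le> 1" and dA: "\<And>b. norm (sample_cov n x b - K b) \<le> h * e * norm b"
      and noise: "norm (sample_cross_cov n x y - sample_cov n x \<beta>) \<le> c0 * e" for n x y e
  proof -
    let ?A = "sample_cov n x" and ?r = "sample_cross_cov n x y" and ?b = "pls_estimator n x y"
    let ?m = "stopping_index n x y (\<tau> * (c0 * e))"
    let ?z = "e powr (\<mu> / (\<mu> + 1))"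
    let ?G = "source_modulus R \<mu> k D e"
    define a where "a = a0 * e powr (1 / (\<mu> + 1))"
    have a: "0 < a" using a0 e by (simp add: a_def)
    have Ga: "?G a \<le> c1 * ?z"
      unfolding a_def c1_def by (rule source_modulus_scaled) (use \<mu> k R D e a0 in auto)
    have KM: "norm (K b) \<le> M * norm b" for b
      by (rule order_trans[OF KL mult_right_mono]) (use h in \<open>auto simp: M_def\<close>)
    have AM: "norm (?A b) \<le> M * norm b" for b
    proof -
      have "norm (?A b) \<le> norm (?A b - K b) + norm (K b)"
        using norm_triangle_ineq[of "?A b - K b" "K b"] by simp
      also have "\<dots> \<le> h * e * norm b + L * norm b" by (intro add_mono dA KL)
      also have "\<dots> \<le> h * 1 * norm b + L * norm b"
        using h e by (intro add_right_mono mult_right_mono mult_left_mono) auto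
      also have "\<dots> \<le> M * norm b" by (simp add: M_def algebra_simps)
      finally show ?thesis .
    qed
    have dk: "norm ((?A ^^ k) w - (K ^^ k) w) \<le> D * e * norm w" for w
      using operator_power_diff[OF linear_sample_cov AM KM M dA, of k w] h e
      by (simp add: D_def mult_ac)
    obtain E t where mr: "minimal_residual ?A E t ?r ?b"
      using sample_minimal_residual[of n x y] by (elim exE) (rule that)
    interpret minimal_residual ?A E t ?r ?b by (rule mr)
    interpret minimal_residual_source ?A E t ?r ?b \<beta> k ?G "c0 * e" \<tau>
    proof unfold_locales
      fix f B \<alpha>
      assume "0 < (\<alpha>::real)" and "\<And>x. 0 \<le> x \<Longrightarrow> \<bar>f x\<bar> \<le> B \<and> \<bar>f x\<bar> * x ^ k \<le> B * \<alpha> ^ k"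
      then show "norm (fcalc f \<beta>) \<le> B * ?G \<alpha>"
        unfolding source_modulus_def
        by (intro source_filter_bound[OF finite_spectral_axioms _ \<mu> k(2) R _ src dk]) (use D e in auto)
    qed (use noise \<tau> k in auto)
    have thr: "0 \<le> \<tau> * (c0 * e)" using \<tau> c0 e by simp
    note stop = stopping_index_props[where n = n and x = x and y = y, OF thr]
    show ?thesis
    proof (cases "c0 = 0")
      case True
      have "norm (?b ?m - \<beta>) \<le> ?G a"
        by (rule noiseless_error[OF _ stop(1) a]) (simp add: True)
      also have "\<dots> \<le> c1 * ?z" by (rule Ga)
      also have "\<dots> \<le> c * ?z"
        using c1 C by (intro mult_right_mono) (simp_all add: c_def True mult_le_cancel_right1)
      finally show ?thesis .
    next
      case False
      have small: "filter_const k * \<alpha> * ?G \<alpha> \<le> (\<tau> - 1) / 2 * (c0 * e)" if \<alpha>: "0 < \<alpha>" "\<alpha> \<le> a" for \<alpha>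
      proof -
        have "\<alpha> * ?G \<alpha> \<le> R * (2 + D) * a0 powr (\<mu> + 1 - real k) * e"
          by (rule source_modulus_small) (use \<mu> k R D e a0 \<alpha> in \<open>auto simp: a_def\<close>)
        then have "filter_const k * (\<alpha> * ?G \<alpha>) \<le> filter_const k * (R * (2 + D) * a0 powr (\<mu> + 1 - real k) * e)"
          using filter_const_ge[of k] by (intro mult_left_mono) auto
        also have "\<dots> = Q * a0 powr \<theta> * e" by (simp add: Q_def \<theta>_def)
        also have "\<dots> \<le> (\<tau> - 1) / 2 * c0 * e"
          using a0\<theta> False c0 e by (intro mult_right_mono) auto
        finally show ?thesis by (simp add: mult_ac)
      qed
      have "norm (?b ?m - \<beta>) \<le> (C + 1 + \<tau>) * (c0 * e / a) + (1 + C) * ?G a"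
        unfolding C_def by (rule stopped_error[OF a small stop(2) stop(1)])
      also have "c0 * e / a = c0 / a0 * ?z"
      proof -
        have "?z * e powr (1 / (\<mu> + 1)) = e powr 1"
          using \<mu> unfolding powr_add[symmetric] add_divide_distrib[symmetric] by simp
        then have "e = ?z * e powr (1 / (\<mu> + 1))" using e by simp
        then show ?thesis unfolding a_def using a0 e by (simp add: field_simps)
      qed
      also have "(C + 1 + \<tau>) * (c0 / a0 * ?z) + (1 + C) * ?G a
          \<le> (C + 1 + \<tau>) * (c0 / a0 * ?z) + (1 + C) * (c1 * ?z)"
        using C by (intro add_left_mono mult_left_mono Ga) simp
      also have "\<dots> = c * ?z" by (simp add: c_def algebra_simps add_divide_distrib)
      finally show ?thesis .
    qed
  qed
  with cnn show ?thesis by (intro exI[of _ c]) simp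
qed

text \<open>
  The choice \<open>\<eta> = e powr (2/(\<mu>+1))\<close> balances the squared errors \<open>e\<^sup>2\<close> for \<open>s = 1\<close> and
  \<open>e powr (2 \<mu>/(\<mu>+1))\<close> for \<open>s = 0\<close>.
\<close>

theorem pls_rate:
  fixes \<mu> R \<tau> L h c0 s :: real and \<beta> :: 'h
  assumes \<mu>: "0 < \<mu>" and R: "0 < R" and \<tau>: "1 < \<tau>" and L: "0 \<le> L" and h: "0 \<le> h" and c0: "0 \<le> c0"
    and src: "(\<lambda>j. (\<beta> \<bullet> v j)\<^sup>2 / l j powr (2 * \<mu>)) summable_on J"
      "(\<Sum>\<^sub>\<infinity>j\<in>J. (\<beta> \<bullet> v j)\<^sup>2 / l j powr (2 * \<mu>)) \<le> R\<^sup>2"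
    and KL: "\<And>b. norm (K b) \<le> L * norm b" and s: "0 \<le> s" "s \<le> 1"
  shows "\<exists>c>0. \<forall>n x y e. 0 < e \<longrightarrow> e \<le> 1 \<longrightarrow>
    (\<forall>b. norm (sample_cov n x b - K b) \<le> h * e * norm b) \<longrightarrow>
    norm (sample_cross_cov n x y - sample_cov n x \<beta>) \<le> c0 * e \<longrightarrow>
    (norm (spectral_power J l v s (pls_estimator n x y (stopping_index n x y (\<tau> * (c0 * e))) - \<beta>)))\<^sup>2
      \<le> c * e powr (2 * ((\<mu> + s) / (\<mu> + 1)))"
proof -
  obtain c where c: "0 \<le> c" and err: "\<forall>n x y e. 0 < e \<longrightarrow> e \<le> 1 \<longrightarrow>
    (\<forall>b. norm (sample_cov n x b - K b) \<le> h * e * norm b) \<longrightarrow>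
    norm (sample_cross_cov n x y - sample_cov n x \<beta>) \<le> c0 * e \<longrightarrow>
    norm (pls_estimator n x y (stopping_index n x y (\<tau> * (c0 * e))) - \<beta>) \<le> c * e powr (\<mu> / (\<mu> + 1))"
    using pls_error_bound[OF \<mu> R \<tau> L h c0 src KL] by (elim exE conjE) (rule that)
  define c' where "c' = (1 + \<tau>) * c0 + h * c"
  have "(norm (spectral_power J l v s (pls_estimator n x y (stopping_index n x y (\<tau> * (c0 * e))) - \<beta>)))\<^sup>2
      \<le> (c'\<^sup>2 + c\<^sup>2 + 1) * e powr (2 * ((\<mu> + s) / (\<mu> + 1)))"
    if e: "0 < e" "e \<le> 1" and dA: "\<forall>b. norm (sample_cov n x b - K b) \<le> h * e * norm b"
      and noise: "norm (sample_cross_cov n x y - sample_cov n x \<beta>) \<le> c0 * e" for n x y e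
  proof -
    let ?A = "sample_cov n x" and ?r = "sample_cross_cov n x y"
    define b where "b = pls_estimator n x y (stopping_index n x y (\<tau> * (c0 * e)))"
    define u where "u = b - \<beta>"
    have thr: "0 \<le> \<tau> * (c0 * e)" using \<tau> c0 e by simp
    have stop: "norm (?r - ?A b) \<le> \<tau> * (c0 * e)"
      unfolding b_def by (rule stopping_index_props(1)[OF thr])
    have u: "norm u \<le> c * e powr (\<mu> / (\<mu> + 1))"
      unfolding u_def b_def using err e dA noise by simp
    have "e powr (\<mu> / (\<mu> + 1)) \<le> 1" using e \<mu> by (intro powr_le1) auto
    then have u1: "norm u \<le> c" using u c mult_left_mono[of "e powr (\<mu> / (\<mu> + 1))" 1 c] by simp
    have "?A u = (?r - ?A \<beta>) - (?r - ?A b)"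
      by (simp add: u_def linear_diff[OF linear_sample_cov])
    then have "norm (?A u) \<le> norm (?r - ?A \<beta>) + norm (?r - ?A b)"
      by (simp only: norm_triangle_ineq4)
    then have Au: "norm (?A u) \<le> (1 + \<tau>) * c0 * e"
      using noise stop by (simp add: algebra_simps)
    have "norm (K u) \<le> norm (?A u) + norm (?A u - K u)"
      using norm_triangle_ineq4[of "?A u" "?A u - K u"] by simp
    also have "\<dots> \<le> (1 + \<tau>) * c0 * e + h * e * c"
    proof (rule add_mono[OF Au])
      have "norm (?A u - K u) \<le> h * e * norm u" using dA by simp
      also have "\<dots> \<le> h * e * c" using u1 h e by (intro mult_left_mono) auto
      finally show "norm (?A u - K u) \<le> h * e * c" .
    qed
    also have "\<dots> = c' * e" by (simp add: c'_def algebra_simps)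
    finally have Ku: "norm (K u) \<le> c' * e" .
    define \<eta> where "\<eta> = e powr (2 / (\<mu> + 1))"
    have \<eta>: "0 < \<eta>" using e by (simp add: \<eta>_def)
    let ?w = "e powr (2 * \<mu> / (\<mu> + 1))"
    have w: "?w * \<eta> = e\<^sup>2" "(e powr (\<mu> / (\<mu> + 1)))\<^sup>2 = ?w"
    proof -
      have "?w * \<eta> = e powr 2"
      proof -
        have "\<mu> + 1 \<noteq> 0" using \<mu> by simp
        then have "2 * (\<mu> + 1) / (\<mu> + 1) = 2" by (rule nonzero_mult_div_cancel_right)
        then have "2 * \<mu> / (\<mu> + 1) + 2 / (\<mu> + 1) = 2"
          by (simp only: distrib_left add_divide_distrib mult_1_right)
        then show ?thesis unfolding \<eta>_def powr_add[symmetric] by (simp only:)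
      qed
      then show "?w * \<eta> = e\<^sup>2" using e by simp
      show "(e powr (\<mu> / (\<mu> + 1)))\<^sup>2 = ?w" using powr_square[OF e(1)] by simp
    qed
    have "(norm (K u))\<^sup>2 \<le> (c' * e)\<^sup>2" by (rule power_mono[OF Ku]) simp
    also have "\<dots> = (c'\<^sup>2 * ?w) * \<eta>" using w(1) by (simp add: power_mult_distrib mult.assoc)
    finally have 1: "(norm (K u))\<^sup>2 / \<eta> \<le> c'\<^sup>2 * ?w" using \<eta> by (simp add: pos_divide_le_eq)
    have "(norm u)\<^sup>2 \<le> (c * e powr (\<mu> / (\<mu> + 1)))\<^sup>2" by (rule power_mono[OF u]) simp
    then have 2: "(norm u)\<^sup>2 \<le> c\<^sup>2 * ?w" unfolding power_mult_distrib w(2) .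
    have "(norm (spectral_power J l v s u))\<^sup>2 \<le> \<eta> powr s * ((norm (K u))\<^sup>2 / \<eta> + (norm u)\<^sup>2)"
      by (rule spectral_power_interpolation[OF s \<eta>])
    also have "\<dots> \<le> \<eta> powr s * (c'\<^sup>2 * ?w + c\<^sup>2 * ?w)"
      by (intro mult_left_mono add_mono 1 2) simp
    also have "\<dots> \<le> \<eta> powr s * ((c'\<^sup>2 + c\<^sup>2 + 1) * ?w)"
      by (intro mult_left_mono) (simp_all add: algebra_simps)
    also have "\<dots> = (c'\<^sup>2 + c\<^sup>2 + 1) * (\<eta> powr s * ?w)" by simp
    also have "\<eta> powr s * ?w = e powr (2 * ((\<mu> + s) / (\<mu> + 1)))"
      unfolding \<eta>_def powr_powr powr_add[symmetric]
      by (rule arg_cong[where f = "\<lambda>z. e powr z"]) (simp add: add_divide_distrib algebra_simps)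
    finally show ?thesis unfolding u_def b_def .
  qed
  moreover have "0 < c'\<^sup>2 + c\<^sup>2 + 1" by (intro add_nonneg_pos add_nonneg_nonneg) auto
  ultimately show ?thesis by (intro exI[of _ "c'\<^sup>2 + c\<^sup>2 + 1"] conjI allI impI)
qed

end

section \<open>Means of independent vectors\<close>

lemma (in prob_space) indep_vars_pair:
  assumes "indep_vars M' Z I" "i \<in> I" "j \<in> I" "i \<noteq> j"
  shows "indep_var (M' i) (Z i) (M' j) (Z j)"
proof -
  have "indep_var (M' i) ((\<lambda>f. f i) \<circ> (\<lambda>w. restrict (\<lambda>i. Z i w) {i}))
      (M' j) ((\<lambda>f. f j) \<circ> (\<lambda>w. restrict (\<lambda>i. Z i w) {j}))"
    using assms
    by (intro indep_var_compose[OF indep_var_restrict[OF assms(1)]]) (auto intro: measurable_component_singleton)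
  then show ?thesis by (simp add: o_def)
qed

text \<open>
  The joint distribution is a product, and the inner integral of \<open>g a \<bullet> g b\<close> over \<open>b\<close> is the inner
  product of \<open>g a\<close> with the mean.
\<close>

lemma (in prob_space) indep_centered_inner:
  fixes g :: "'z::topological_space \<Rightarrow> 'h::{real_inner,banach,second_countable_topology}"
  assumes ind: "indep_var borel Z1 borel Z2" and d1: "distr M borel Z1 = D" and d2: "distr M borel Z2 = D"
    and g: "g \<in> borel_measurable borel" and mean: "has_bochner_integral D g 0"
    and int: "integrable M (\<lambda>w. g (Z1 w) \<bullet> g (Z2 w))"
  shows "(\<integral>w. g (Z1 w) \<bullet> g (Z2 w) \<partial>M) = 0"
proof -
  have Z: "Z1 \<in> measurable M borel" "Z2 \<in> measurable M borel"
    using indep_var_rv1[OF ind] indep_var_rv2[OF ind] by auto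
  interpret D: prob_space D unfolding d1[symmetric] by (rule prob_space_distr[OF Z(1)])
  interpret DD: pair_prob_space D D ..
  have sets_D: "sets D = sets borel" unfolding d1[symmetric] by simp
  have gD: "g \<in> borel_measurable D" using g by (simp add: measurable_cong_sets[OF sets_D refl])
  have DD: "D \<Otimes>\<^sub>M D = distr M (borel \<Otimes>\<^sub>M borel) (\<lambda>w. (Z1 w, Z2 w))"
    using ind unfolding indep_var_distribution_eq d1 d2 by simp
  have pm: "(\<lambda>w. (Z1 w, Z2 w)) \<in> measurable M (borel \<Otimes>\<^sub>M borel)" using Z by simp
  have gg: "(\<lambda>(a, b). g a \<bullet> g b) \<in> borel_measurable (borel \<Otimes>\<^sub>M borel)"
    using g by measurable
  have i: "integrable (D \<Otimes>\<^sub>M D) (\<lambda>(a, b). g a \<bullet> g b)"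
    unfolding DD using int by (subst integrable_distr_eq[OF pm gg]) simp
  have "(\<integral>w. g (Z1 w) \<bullet> g (Z2 w) \<partial>M) = (\<integral>z. (case z of (a, b) \<Rightarrow> g a \<bullet> g b) \<partial>(D \<Otimes>\<^sub>M D))"
    unfolding DD by (subst integral_distr[OF pm gg]) simp
  also have "\<dots> = (\<integral>a. (\<integral>b. g a \<bullet> g b \<partial>D) \<partial>D)"
    using DD.integral_fst'[OF i] by simp
  also have "\<dots> = 0"
    using mean by (simp add: has_bochner_integral_iff)
  finally show ?thesis .
qed

lemma abs_inner_le_squares: "\<bar>a \<bullet> b\<bar> \<le> (norm a)\<^sup>2 + (norm b)\<^sup>2" for a b :: "'h::real_inner"
proof -
  have "\<bar>a \<bullet> b\<bar> \<le> norm a * norm b" by (rule Cauchy_Schwarz_ineq2)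
  also have "\<dots> \<le> (norm a)\<^sup>2 + (norm b)\<^sup>2"
  proof -
    have "2 * (norm a * norm b) \<le> (norm a)\<^sup>2 + (norm b)\<^sup>2"
      using sum_squares_bound[of "norm a" "norm b"] by (simp add: mult.assoc)
    moreover have "0 \<le> norm a * norm b" by simp
    ultimately show ?thesis by linarith
  qed
  finally show ?thesis .
qed

lemma (in prob_space) iid_mean_second_moment:
  fixes g :: "'z::topological_space \<Rightarrow> 'h::{real_inner,banach,second_countable_topology}"
  assumes ind: "indep_vars (\<lambda>_. borel) Z {1..n}" and d: "\<And>i. i \<in> {1..n} \<Longrightarrow> distr M borel (Z i) = D"
    and g: "g \<in> borel_measurable borel" and mean: "has_bochner_integral D g 0"
    and sq: "integrable D (\<lambda>z. (norm (g z))\<^sup>2)" and n: "1 \<le> n"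
  shows "(\<integral>\<^sup>+w. ennreal ((norm ((1 / real n) *\<^sub>R (\<Sum>i=1..n. g (Z i w))))\<^sup>2) \<partial>M)
    = ennreal ((1 / real n) * (\<integral>z. (norm (g z))\<^sup>2 \<partial>D))"
proof -
  let ?v = "\<integral>z. (norm (g z))\<^sup>2 \<partial>D"
  have Z: "Z i \<in> measurable M borel" if "i \<in> {1..n}" for i
    using ind that unfolding indep_vars_def by blast
  have gZ: "(\<lambda>w. g (Z i w)) \<in> borel_measurable M" if "i \<in> {1..n}" for i
    using measurable_compose[OF Z[OF that] g] .
  have sqm: "(\<lambda>z. (norm (g z))\<^sup>2) \<in> borel_measurable borel" using g by measurable
  have sqZ: "integrable M (\<lambda>w. (norm (g (Z i w)))\<^sup>2)" if i: "i \<in> {1..n}" for i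
    using sq unfolding d[OF i, symmetric] by (subst (asm) integrable_distr_eq[OF Z[OF i] sqm]) simp
  have sqI: "(\<integral>w. (norm (g (Z i w)))\<^sup>2 \<partial>M) = ?v" if i: "i \<in> {1..n}" for i
    unfolding d[OF i, symmetric] by (subst integral_distr[OF Z[OF i] sqm]) simp
  have ii: "integrable M (\<lambda>w. g (Z i w) \<bullet> g (Z j w))" if "i \<in> {1..n}" "j \<in> {1..n}" for i j
  proof (rule Bochner_Integration.integrable_bound[OF Bochner_Integration.integrable_add[OF sqZ[OF that(1)] sqZ[OF that(2)]]])
    show "(\<lambda>w. g (Z i w) \<bullet> g (Z j w)) \<in> borel_measurable M"
      using gZ[OF that(1)] gZ[OF that(2)] by measurable
    show "AE w in M. norm (g (Z i w) \<bullet> g (Z j w)) \<le> norm ((norm (g (Z i w)))\<^sup>2 + (norm (g (Z j w)))\<^sup>2)"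
      using abs_inner_le_squares by (intro AE_I2) simp
  qed
  have cross: "(\<integral>w. g (Z i w) \<bullet> g (Z j w) \<partial>M) = (if j = i then ?v else 0)"
    if i: "i \<in> {1..n}" and j: "j \<in> {1..n}" for i j
  proof (cases "j = i")
    case True
    then show ?thesis using sqI[OF i] by (simp add: power2_norm_eq_inner)
  next
    case False
    then show ?thesis
      using indep_centered_inner[OF indep_vars_pair[OF ind i j] d[OF i] d[OF j] g mean ii[OF i j]] by simp
  qed
  let ?f = "\<lambda>w. (1 / real n)\<^sup>2 * (\<Sum>i=1..n. \<Sum>j=1..n. g (Z i w) \<bullet> g (Z j w))"
  have f: "(norm ((1 / real n) *\<^sub>R (\<Sum>i=1..n. g (Z i w))))\<^sup>2 = ?f w" for w
  proof -
    have "(\<Sum>i=1..n. g (Z i w)) \<bullet> (\<Sum>i=1..n. g (Z i w)) = (\<Sum>i=1..n. \<Sum>j=1..n. g (Z i w) \<bullet> g (Z j w))"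
      by (simp only: inner_sum_left) (simp only: inner_sum_right)
    then show ?thesis
      unfolding power2_norm_eq_inner
      by (simp only: inner_scaleR_left inner_scaleR_right power2_eq_square mult.assoc)
  qed
  have fi: "integrable M ?f"
    by (intro integrable_mult_right Bochner_Integration.integrable_sum ii)
  have "(\<integral>w. ?f w \<partial>M) = (1 / real n)\<^sup>2 * (\<Sum>i=1..n. \<Sum>j=1..n. (\<integral>w. g (Z i w) \<bullet> g (Z j w) \<partial>M))"
  proof -
    have "(\<integral>w. (\<Sum>i=1..n. \<Sum>j=1..n. g (Z i w) \<bullet> g (Z j w)) \<partial>M)
        = (\<Sum>i=1..n. (\<integral>w. (\<Sum>j=1..n. g (Z i w) \<bullet> g (Z j w)) \<partial>M))"
      by (rule Bochner_Integration.integral_sum) (intro Bochner_Integration.integrable_sum ii)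
    also have "\<dots> = (\<Sum>i=1..n. \<Sum>j=1..n. (\<integral>w. g (Z i w) \<bullet> g (Z j w) \<partial>M))"
      by (rule sum.cong[OF refl], rule Bochner_Integration.integral_sum) (rule ii)
    finally show ?thesis by (simp only: integral_mult_right_zero)
  qed
  also have "(\<Sum>i=1..n. \<Sum>j=1..n. (\<integral>w. g (Z i w) \<bullet> g (Z j w) \<partial>M)) = (\<Sum>i=1..n. ?v)"
  proof (rule sum.cong[OF refl])
    fix i assume i: "i \<in> {1..n}"
    have "(\<Sum>j=1..n. (\<integral>w. g (Z i w) \<bullet> g (Z j w) \<partial>M)) = (\<Sum>j=1..n. if j = i then ?v else 0)"
      by (rule sum.cong[OF refl]) (rule cross[OF i])
    then show "(\<Sum>j=1..n. (\<integral>w. g (Z i w) \<bullet> g (Z j w) \<partial>M)) = ?v"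
      using i by simp
  qed
  also have "(1 / real n)\<^sup>2 * (\<Sum>i=1..n. ?v) = (1 / real n) * ?v"
    using n by (simp add: power2_eq_square)
  finally have I: "(\<integral>w. ?f w \<partial>M) = (1 / real n) * ?v" .
  have "AE w in M. 0 \<le> ?f w" unfolding f[symmetric] by simp
  then show ?thesis
    unfolding f I[symmetric] by (rule nn_integral_eq_integral[OF fi])
qed

text \<open>
  The strict inequality in the event makes the bound valid also for \<open>c = 0\<close>, where \<open>f\<close> vanishes
  almost everywhere.
\<close>

lemma (in prob_space) markov_half:
  fixes f :: "'a \<Rightarrow> ennreal"
  assumes f: "f \<in> borel_measurable M" and e: "(\<integral>\<^sup>+w. f w \<partial>M) \<le> ennreal e" "0 \<le> e"
    and \<delta>: "0 < \<delta>" and c: "2 * e / \<delta> \<le> c"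
  shows "measure M {w \<in> space M. ennreal c < f w} \<le> \<delta> / 2"
proof (cases "e = 0")
  case True
  then have "(\<integral>\<^sup>+w. f w \<partial>M) = 0" using e by simp
  then have "AE w in M. f w = 0" using nn_integral_0_iff_AE[OF f] by simp
  then have "AE w in M. \<not> ennreal c < f w" by (rule AE_mp) (simp add: AE_I2)
  then have "measure M {w \<in> space M. ennreal c < f w} = 0"
    using f by (subst measure_eq_0_null_sets) (auto simp: AE_iff_null)
  then show ?thesis using \<delta> by simp
next
  case False
  then have c0: "0 < c" using e \<delta> c by (intro less_le_trans[OF _ c]) simp
  have "emeasure M {w \<in> space M. ennreal c < f w} \<le> emeasure M {w \<in> space M. 1 \<le> ennreal (1 / c) * f w}"
  proof (rule emeasure_mono)
    show "{w \<in> space M. ennreal c < f w} \<subseteq> {w \<in> space M. 1 \<le> ennreal (1 / c) * f w}"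
    proof safe
      fix w assume "ennreal c < f w"
      then have "ennreal (1 / c) * ennreal c \<le> ennreal (1 / c) * f w" by (intro mult_left_mono) auto
      then show "1 \<le> ennreal (1 / c) * f w" using c0 by (simp add: ennreal_mult[symmetric])
    qed
    show "{w \<in> space M. 1 \<le> ennreal (1 / c) * f w} \<in> sets M" using f by measurable
  qed
  also have "\<dots> \<le> ennreal (1 / c) * (\<integral>\<^sup>+w. f w * indicator (space M) w \<partial>M)"
    by (rule nn_integral_Markov_inequality) (use f in auto)
  also have "(\<integral>\<^sup>+w. f w * indicator (space M) w \<partial>M) = (\<integral>\<^sup>+w. f w \<partial>M)"
    by (rule nn_integral_cong) simp
  also have "ennreal (1 / c) * (\<integral>\<^sup>+w. f w \<partial>M) \<le> ennreal (1 / c) * ennreal e" by (intro mult_left_mono e) simp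
  also have "\<dots> = ennreal (e / c)" using c0 e by (simp add: ennreal_mult[symmetric])
  also have "\<dots> \<le> ennreal (\<delta> / 2)"
    using c c0 \<delta> by (intro ennreal_leI) (simp add: field_simps)
  finally show ?thesis using \<delta> by (simp add: emeasure_eq_measure)
qed

text \<open>
  The Cauchy-Schwarz inequality for the expansion of \<open>b\<close>. Square sums over an eigenbasis replace the operator norm: they are countable, hence measurable in the
  sample, and their expectation is a sum of second moments.
\<close>

lemma hilbert_schmidt_bound:
  fixes T :: "'h::{real_inner,banach} \<Rightarrow> 'h"
  assumes on: "orthonormal_family J v" and total: "\<And>b. (\<forall>j\<in>J. v j \<bullet> b = 0) \<Longrightarrow> b = 0"
    and T: "bounded_linear T" and c: "0 \<le> c"
    and hs: "\<And>F. finite F \<Longrightarrow> F \<subseteq> J \<Longrightarrow> (\<Sum>j\<in>F. (norm (T (v j)))\<^sup>2) \<le> c\<^sup>2"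
  shows "norm (T b) \<le> c * norm b"
proof -
  interpret T: bounded_linear T by (rule T)
  have "((\<lambda>j. T ((v j \<bullet> b) *\<^sub>R v j)) has_sum T b) J"
    using has_sum_bounded_linear[OF T complete_orthonormal_expansion[OF on total]] by (simp add: o_def)
  then have "((\<lambda>F. \<Sum>j\<in>F. T ((v j \<bullet> b) *\<^sub>R v j)) \<longlongrightarrow> T b) (finite_subsets_at_top J)"
    unfolding has_sum_def .
  then have lim: "((\<lambda>F. norm (\<Sum>j\<in>F. T ((v j \<bullet> b) *\<^sub>R v j))) \<longlongrightarrow> norm (T b)) (finite_subsets_at_top J)"
    by (rule tendsto_norm)
  have "norm (\<Sum>j\<in>F. T ((v j \<bullet> b) *\<^sub>R v j)) \<le> c * norm b" if F: "finite F" "F \<subseteq> J" for F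
  proof -
    have "norm (\<Sum>j\<in>F. T ((v j \<bullet> b) *\<^sub>R v j)) \<le> (\<Sum>j\<in>F. norm (T (v j)) * \<bar>v j \<bullet> b\<bar>)"
      by (rule order_trans[OF norm_sum]) (simp add: T.scaleR mult.commute)
    also have "\<dots> \<le> norm b * c"
    proof (rule power2_le_imp_le)
      have "(\<Sum>j\<in>F. norm (T (v j)) * \<bar>v j \<bullet> b\<bar>)\<^sup>2 \<le> (\<Sum>j\<in>F. (norm (T (v j)))\<^sup>2) * (\<Sum>j\<in>F. \<bar>v j \<bullet> b\<bar>\<^sup>2)"
        by (rule Cauchy_Schwarz_ineq_sum)
      also have "\<dots> \<le> c\<^sup>2 * (norm b)\<^sup>2"
        using bessel_finite[OF orthonormal_family_subset[OF on F(2)] F(1), of b] hs[OF F]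
        by (intro mult_mono) (auto intro: sum_nonneg)
      finally show "(\<Sum>j\<in>F. norm (T (v j)) * \<bar>v j \<bullet> b\<bar>)\<^sup>2 \<le> (norm b * c)\<^sup>2"
        by (simp add: power_mult_distrib mult.commute)
    qed (use c in simp)
    finally show ?thesis by (simp add: mult.commute)
  qed
  then have "\<forall>\<^sub>F F in finite_subsets_at_top J. norm (\<Sum>j\<in>F. T ((v j \<bullet> b) *\<^sub>R v j)) \<le> c * norm b"
    by (intro eventually_finite_subsets_at_top_weakI) auto
  then show ?thesis by (rule tendsto_upperbound[OF lim]) simp
qed

section \<open>Deviations of the sample and the rate in probability\<close>

lemma (in prob_space) integrable_norm_square:
  fixes X :: "'a \<Rightarrow> 'h::{real_inner,second_countable_topology}"
  assumes X: "X \<in> borel_measurable M" and X4: "integrable M (\<lambda>w. norm (X w) ^ 4)"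
  shows "integrable M (\<lambda>w. (norm (X w))\<^sup>2)"
proof (rule Bochner_Integration.integrable_bound[OF Bochner_Integration.integrable_add[OF integrable_const[of 1] X4]])
  show "(\<lambda>w. (norm (X w))\<^sup>2) \<in> borel_measurable M" using X by measurable
  have "z\<^sup>2 \<le> 1 + z ^ 4" for z :: real
  proof -
    have "0 \<le> (z\<^sup>2 - 1)\<^sup>2" by simp
    then have "2 * z\<^sup>2 \<le> 1 + z ^ 4" by (simp add: power2_eq_square power4_eq_xxxx algebra_simps)
    moreover have "0 \<le> z\<^sup>2" by simp
    ultimately show ?thesis by linarith
  qed
  then show "AE w in M. norm ((norm (X w))\<^sup>2) \<le> norm (1 + norm (X w) ^ 4)"
    by (intro AE_I2) simp
qed

lemma norm_rank_one_le: "norm ((x \<bullet> b) *\<^sub>R x) \<le> (norm x)\<^sup>2 * norm b" for x b :: "'h::real_inner"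
proof -
  have "norm ((x \<bullet> b) *\<^sub>R x) \<le> (norm x * norm b) * norm x"
    unfolding norm_scaleR by (intro mult_right_mono Cauchy_Schwarz_ineq2) simp
  then show ?thesis by (simp add: power2_eq_square mult_ac)
qed

lemma (in prob_space) integrable_rank_one:
  fixes X :: "'a \<Rightarrow> 'h::{real_inner,banach,second_countable_topology}"
  assumes X: "X \<in> borel_measurable M" and X2: "integrable M (\<lambda>w. (norm (X w))\<^sup>2)"
  shows "integrable M (\<lambda>w. (X w \<bullet> b) *\<^sub>R X w)"
proof (rule Bochner_Integration.integrable_bound[OF integrable_mult_left[OF X2, of "norm b"]])
  show "(\<lambda>w. (X w \<bullet> b) *\<^sub>R X w) \<in> borel_measurable M" using X by measurable
  show "AE w in M. norm ((X w \<bullet> b) *\<^sub>R X w) \<le> norm ((norm (X w))\<^sup>2 * norm b)"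
    using norm_rank_one_le by (intro AE_I2) (simp add: abs_mult)
qed

lemma (in prob_space) norm_covariance_op_le:
  fixes X :: "'a \<Rightarrow> 'h::{real_inner,banach,second_countable_topology}"
  assumes X: "X \<in> borel_measurable M" and X2: "integrable M (\<lambda>w. (norm (X w))\<^sup>2)"
  shows "norm (covariance_op M X b) \<le> (\<integral>w. (norm (X w))\<^sup>2 \<partial>M) * norm b"
proof -
  have "norm (covariance_op M X b) \<le> (\<integral>w. norm ((X w \<bullet> b) *\<^sub>R X w) \<partial>M)"
    unfolding covariance_op_def by (rule integral_norm_bound)
  also have "\<dots> \<le> (\<integral>w. (norm (X w))\<^sup>2 * norm b \<partial>M)"
    by (intro integral_mono integrable_norm integrable_rank_one[OF X X2] integrable_mult_left[OF X2] norm_rank_one_le)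
  finally show ?thesis by simp
qed

text \<open>
  The factor \<open>(norm (X w))\<^sup>2\<close> is measurable with respect to \<open>X\<close>, so under the integral the squared error
  may be replaced by its conditional expectation.
\<close>

lemma (in prob_space) conditional_variance_bound:
  fixes X :: "'a \<Rightarrow> 'h::{real_inner,banach,second_countable_topology}" and \<epsilon> :: "'a \<Rightarrow> real"
  assumes X: "X \<in> borel_measurable M" and e: "\<epsilon> \<in> borel_measurable M"
    and X2: "integrable M (\<lambda>w. (norm (X w))\<^sup>2)"
    and cv: "AE w in M. nn_cond_exp M (vimage_algebra (space M) X borel)
           (\<lambda>w. ennreal ((\<epsilon> w)\<^sup>2)) w \<le> ennreal (\<sigma>\<^sup>2)"
  shows "(\<integral>\<^sup>+w. ennreal ((norm (\<epsilon> w *\<^sub>R X w))\<^sup>2) \<partial>M) \<le> ennreal (\<sigma>\<^sup>2 * (\<integral>w. (norm (X w))\<^sup>2 \<partial>M))"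
proof -
  let ?F = "vimage_algebra (space M) X borel"
  have "subalgebra M ?F"
    unfolding subalgebra_def using X by (auto simp: sets_vimage_algebra2 measurable_sets)
  then interpret finite_measure_subalgebra M ?F by unfold_locales
  have XF: "X \<in> borel_measurable ?F" by (rule measurable_vimage_algebra1) simp
  have f: "(\<lambda>w. ennreal ((norm (X w))\<^sup>2)) \<in> borel_measurable ?F" using XF by measurable
  have g: "(\<lambda>w. ennreal ((\<epsilon> w)\<^sup>2)) \<in> borel_measurable M" using e by measurable
  have "(\<integral>\<^sup>+w. ennreal ((norm (\<epsilon> w *\<^sub>R X w))\<^sup>2) \<partial>M)
      = (\<integral>\<^sup>+w. ennreal ((norm (X w))\<^sup>2) * ennreal ((\<epsilon> w)\<^sup>2) \<partial>M)"
    by (rule nn_integral_cong) (simp add: power_mult_distrib ennreal_mult[symmetric] mult.commute)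
  also have "\<dots> = (\<integral>\<^sup>+w. ennreal ((norm (X w))\<^sup>2) * nn_cond_exp M ?F (\<lambda>w. ennreal ((\<epsilon> w)\<^sup>2)) w \<partial>M)"
    by (rule nn_cond_exp_intg[OF f g, symmetric])
  also have "\<dots> \<le> (\<integral>\<^sup>+w. ennreal ((norm (X w))\<^sup>2) * ennreal (\<sigma>\<^sup>2) \<partial>M)"
    by (rule nn_integral_mono_AE) (use cv in eventually_elim, rule mult_left_mono, simp_all)
  also have "\<dots> = (\<integral>\<^sup>+w. ennreal ((norm (X w))\<^sup>2 * \<sigma>\<^sup>2) \<partial>M)"
    by (simp add: ennreal_mult)
  also have "\<dots> = ennreal (\<integral>w. (norm (X w))\<^sup>2 * \<sigma>\<^sup>2 \<partial>M)"
    by (rule nn_integral_eq_integral[OF integrable_mult_left[OF X2]]) simp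
  finally show ?thesis by (simp add: mult.commute)
qed

lemma iid_copies_measurable:
  fixes Xs :: "nat \<Rightarrow> 'b \<Rightarrow> 'h::{real_inner,second_countable_topology}" and Ys :: "nat \<Rightarrow> 'b \<Rightarrow> real"
  assumes iid: "iid_copies N n Xs Ys M X Y" and i: "i \<in> {1..n}"
  shows "Xs i \<in> borel_measurable N" "Ys i \<in> borel_measurable N"
proof -
  interpret N: prob_space N using iid by (simp add: iid_copies_def)
  have XY: "(\<lambda>w. (Xs i w, Ys i w)) \<in> measurable N borel"
    using iid i unfolding iid_copies_def N.indep_vars_def by blast
  have "(\<lambda>z :: 'h \<times> real. fst z) \<in> borel_measurable borel" "(\<lambda>z :: 'h \<times> real. snd z) \<in> borel_measurable borel"
    by (intro borel_measurable_continuous_onI continuous_intros)+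
  from this[THEN measurable_compose[OF XY]]
  show "Xs i \<in> borel_measurable N" "Ys i \<in> borel_measurable N" by simp_all
qed

lemma iid_copies_second_moment:
  fixes X :: "'a \<Rightarrow> 'h::{real_inner,second_countable_topology}" and Y :: "'a \<Rightarrow> real"
    and g :: "'h \<times> real \<Rightarrow> 'k::{real_inner,banach,second_countable_topology}"
  assumes X: "X \<in> borel_measurable M" and Y: "Y \<in> borel_measurable M"
    and iid: "iid_copies N n Xs Ys M X Y" and n: "1 \<le> n" and g: "g \<in> borel_measurable borel"
    and mean: "has_bochner_integral M (\<lambda>w. g (X w, Y w)) 0"
    and sq: "integrable M (\<lambda>w. (norm (g (X w, Y w)))\<^sup>2)"
  shows "(\<integral>\<^sup>+w. ennreal ((norm ((1 / real n) *\<^sub>R (\<Sum>i=1..n. g (Xs i w, Ys i w))))\<^sup>2) \<partial>N)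
    = ennreal ((1 / real n) * (\<integral>w. (norm (g (X w, Y w)))\<^sup>2 \<partial>M))"
proof -
  let ?D = "distr M borel (\<lambda>w. (X w, Y w))"
  interpret N: prob_space N using iid by (simp add: iid_copies_def)
  have XY: "(\<lambda>w. (X w, Y w)) \<in> measurable M borel" by (rule borel_measurable_Pair[OF X Y])
  have sqm: "(\<lambda>z. (norm (g z))\<^sup>2) \<in> borel_measurable borel" using g by measurable
  have "has_bochner_integral ?D g 0"
    using mean unfolding has_bochner_integral_iff
    by (simp add: integrable_distr_eq[OF XY g] integral_distr[OF XY g])
  moreover have "integrable ?D (\<lambda>z. (norm (g z))\<^sup>2)"
    using sq by (simp add: integrable_distr_eq[OF XY sqm])
  ultimately have "(\<integral>\<^sup>+w. ennreal ((norm ((1 / real n) *\<^sub>R (\<Sum>i=1..n. g (Xs i w, Ys i w))))\<^sup>2) \<partial>N)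
      = ennreal ((1 / real n) * (\<integral>z. (norm (g z))\<^sup>2 \<partial>?D))"
    by (intro N.iid_mean_second_moment[where Z = "\<lambda>i w. (Xs i w, Ys i w)"] g n)
       (use iid in \<open>auto simp: iid_copies_def\<close>)
  then show ?thesis by (simp add: integral_distr[OF XY sqm])
qed

text \<open>
  The noise vector is the sample mean of \<open>(Y - \<beta> \<bullet> X) X\<close>, a function of the observations that equals
  \<open>\<epsilon> X\<close> almost everywhere.
\<close>

lemma cross_cov_deviation:
  fixes X :: "'a \<Rightarrow> 'h::{real_inner,banach,second_countable_topology}" and Y \<epsilon> :: "'a \<Rightarrow> real"
  assumes M: "prob_space M" and X: "X \<in> borel_measurable M" and Y: "Y \<in> borel_measurable M"
    and e: "\<epsilon> \<in> borel_measurable M" and model: "AE w in M. Y w = \<beta> \<bullet> X w + \<epsilon> w"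
    and mean: "has_bochner_integral M (\<lambda>w. \<epsilon> w *\<^sub>R X w) 0"
    and X2: "integrable M (\<lambda>w. (norm (X w))\<^sup>2)"
    and cv: "AE w in M. nn_cond_exp M (vimage_algebra (space M) X borel)
           (\<lambda>w. ennreal ((\<epsilon> w)\<^sup>2)) w \<le> ennreal (\<sigma>\<^sup>2)"
    and iid: "iid_copies N n Xs Ys M X Y" and n: "1 \<le> n"
  shows "(\<integral>\<^sup>+w. ennreal ((norm (sample_cross_cov n (\<lambda>i. Xs i w) (\<lambda>i. Ys i w)
      - sample_cov n (\<lambda>i. Xs i w) \<beta>))\<^sup>2) \<partial>N)
    \<le> ennreal (\<sigma>\<^sup>2 * (\<integral>w. (norm (X w))\<^sup>2 \<partial>M) / real n)"
proof -
  interpret prob_space M by (rule M)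
  let ?g = "\<lambda>z :: 'h \<times> real. (snd z - \<beta> \<bullet> fst z) *\<^sub>R fst z"
  have g: "?g \<in> borel_measurable borel"
    by (intro borel_measurable_continuous_onI continuous_intros)
  have XY: "(\<lambda>w. (X w, Y w)) \<in> measurable M borel" by (rule borel_measurable_Pair[OF X Y])
  have gm: "(\<lambda>w. ?g (X w, Y w)) \<in> borel_measurable M" by (rule measurable_compose[OF XY g])
  have eX: "(\<lambda>w. \<epsilon> w *\<^sub>R X w) \<in> borel_measurable M" using e X by measurable
  have ae: "AE w in M. \<epsilon> w *\<^sub>R X w = ?g (X w, Y w)" using model by eventually_elim simp
  have m: "has_bochner_integral M (\<lambda>w. ?g (X w, Y w)) 0"
    using mean by (rule has_bochner_integralI_AE[OF _ gm ae])
  have nn: "(\<integral>\<^sup>+w. ennreal ((norm (?g (X w, Y w)))\<^sup>2) \<partial>M) \<le> ennreal (\<sigma>\<^sup>2 * (\<integral>w. (norm (X w))\<^sup>2 \<partial>M))"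
  proof -
    have "(\<integral>\<^sup>+w. ennreal ((norm (?g (X w, Y w)))\<^sup>2) \<partial>M) = (\<integral>\<^sup>+w. ennreal ((norm (\<epsilon> w *\<^sub>R X w))\<^sup>2) \<partial>M)"
      by (rule nn_integral_cong_AE) (use ae in eventually_elim, simp only:)
    then show ?thesis using conditional_variance_bound[OF X e X2 cv] by simp
  qed
  have sq: "integrable M (\<lambda>w. (norm (?g (X w, Y w)))\<^sup>2)"
  proof (rule integrableI_bounded)
    show "(\<lambda>w. (norm (?g (X w, Y w)))\<^sup>2) \<in> borel_measurable M" using gm by measurable
    show "(\<integral>\<^sup>+w. ennreal (norm ((norm (?g (X w, Y w)))\<^sup>2)) \<partial>M) < \<infinity>"
      using le_less_trans[OF nn ennreal_less_top] by simp
  qed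
  have "ennreal (\<integral>w. (norm (?g (X w, Y w)))\<^sup>2 \<partial>M) \<le> ennreal (\<sigma>\<^sup>2 * (\<integral>w. (norm (X w))\<^sup>2 \<partial>M))"
    using nn nn_integral_eq_integral[OF sq] by simp
  moreover have s0: "0 \<le> \<sigma>\<^sup>2 * (\<integral>w. (norm (X w))\<^sup>2 \<partial>M)" by simp
  ultimately have sqb: "(\<integral>w. (norm (?g (X w, Y w)))\<^sup>2 \<partial>M) \<le> \<sigma>\<^sup>2 * (\<integral>w. (norm (X w))\<^sup>2 \<partial>M)"
    by (simp add: ennreal_le_iff)
  have mean_eq: "sample_cross_cov n (\<lambda>i. Xs i w) (\<lambda>i. Ys i w) - sample_cov n (\<lambda>i. Xs i w) \<beta>
      = (1 / real n) *\<^sub>R (\<Sum>i=1..n. ?g (Xs i w, Ys i w))" for w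
    unfolding sample_cross_cov_def sample_cov_def
    by (simp only: fst_conv snd_conv scaleR_diff_left sum_subtractf scaleR_diff_right inner_commute[of _ \<beta>])
  show ?thesis
    unfolding mean_eq iid_copies_second_moment[OF X Y iid n g m sq]
    using mult_left_mono[OF sqb, of "1 / real n"] by (intro ennreal_leI) simp
qed

lemma suminf_bessel:
  fixes J :: "nat set"
  assumes on: "orthonormal_family J v"
  shows "(\<Sum>j. ennreal (if j \<in> J then (v j \<bullet> b)\<^sup>2 else 0)) \<le> ennreal ((norm b)\<^sup>2)"
  unfolding suminf_eq_SUP
proof (rule SUP_least)
  fix m
  have "(\<Sum>j<m. ennreal (if j \<in> J then (v j \<bullet> b)\<^sup>2 else 0)) = ennreal (\<Sum>j<m. if j \<in> J then (v j \<bullet> b)\<^sup>2 else 0)"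
    by (rule sum_ennreal) simp
  also have "(\<Sum>j<m. if j \<in> J then (v j \<bullet> b)\<^sup>2 else 0) = (\<Sum>j\<in>{..<m} \<inter> J. (v j \<bullet> b)\<^sup>2)"
    by (simp add: sum.inter_restrict)
  also have "ennreal \<dots> \<le> ennreal ((norm b)\<^sup>2)"
    by (intro ennreal_leI bessel_finite orthonormal_family_subset[OF on]) auto
  finally show "(\<Sum>j<m. ennreal (if j \<in> J then (v j \<bullet> b)\<^sup>2 else 0)) \<le> ennreal ((norm b)\<^sup>2)" .
qed

lemma (in prob_space) centered_second_moment_le:
  fixes f :: "'a \<Rightarrow> 'h::{real_inner,banach,second_countable_topology}"
  assumes f: "integrable M f" and f2: "integrable M (\<lambda>w. (norm (f w))\<^sup>2)"
  defines "m \<equiv> (\<integral>w. f w \<partial>M)"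
  shows "has_bochner_integral M (\<lambda>w. f w - m) 0" "integrable M (\<lambda>w. (norm (f w - m))\<^sup>2)"
    "(\<integral>w. (norm (f w - m))\<^sup>2 \<partial>M) \<le> (\<integral>w. (norm (f w))\<^sup>2 \<partial>M)"
proof -
  show "has_bochner_integral M (\<lambda>w. f w - m) 0"
    unfolding has_bochner_integral_iff using f by (simp add: m_def prob_space)
  have eq: "(norm (f w - m))\<^sup>2 = (norm (f w))\<^sup>2 - 2 * (f w \<bullet> m) + m \<bullet> m" for w
    unfolding power2_norm_eq_inner by (simp add: inner_diff_left inner_diff_right inner_commute)
  have fm: "integrable M (\<lambda>w. f w \<bullet> m)" by (rule integrable_inner_left) (use f in simp)
  show "integrable M (\<lambda>w. (norm (f w - m))\<^sup>2)"
    unfolding eq using f2 fm by simp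
  have "(\<integral>w. (norm (f w - m))\<^sup>2 \<partial>M) = (\<integral>w. (norm (f w))\<^sup>2 \<partial>M) - 2 * (m \<bullet> m) + m \<bullet> m"
    unfolding eq using f2 fm f by (simp add: m_def prob_space)
  then show "(\<integral>w. (norm (f w - m))\<^sup>2 \<partial>M) \<le> (\<integral>w. (norm (f w))\<^sup>2 \<partial>M)"
    using inner_ge_zero[of m] by linarith
qed

text \<open>
  For each \<open>j\<close> the vector \<open>(A - K) (v j)\<close> is a centered sample mean with second moment at most
  \<open>E (v j \<bullet> X)\<^sup>2 \<parallel>X\<parallel>\<^sup>2 / n\<close>. Bessel's inequality bounds the sum over \<open>j\<close> by \<open>E \<parallel>X\<parallel>\<^sup>4 / n\<close>.
\<close>

lemma covariance_deviation:
  fixes X :: "'a \<Rightarrow> 'h::{real_inner,banach,second_countable_topology}" and Y :: "'a \<Rightarrow> real"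
  assumes M: "prob_space M" and X: "X \<in> borel_measurable M" and Y: "Y \<in> borel_measurable M"
    and X4: "integrable M (\<lambda>w. norm (X w) ^ 4)" and on: "orthonormal_family J v"
    and iid: "iid_copies N n Xs Ys M X Y" and n: "1 \<le> n"
  shows "(\<integral>\<^sup>+w. (\<Sum>j. ennreal (if j \<in> J then
      (norm (sample_cov n (\<lambda>i. Xs i w) (v j) - covariance_op M X (v j)))\<^sup>2 else 0)) \<partial>N)
    \<le> ennreal ((\<integral>w. norm (X w) ^ 4 \<partial>M) / real n)"
proof -
  let ?K = "covariance_op M X"
  let ?d = "\<lambda>j w. ennreal (if j \<in> J then (norm (sample_cov n (\<lambda>i. Xs i w) (v j) - ?K (v j)))\<^sup>2 else 0)"
  interpret prob_space M by (rule M)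
  note X2 = integrable_norm_square[OF X X4]
  note Xs = iid_copies_measurable(1)[OF iid]
  have meas: "(\<lambda>w. ?d j w) \<in> borel_measurable N" for j
    using measurable_sample_cov[where Xs = Xs and g = "\<lambda>_. v j", OF Xs borel_measurable_const]
    by (cases "j \<in> J") simp_all
  let ?q = "\<lambda>j w. (if j \<in> J then (v j \<bullet> X w)\<^sup>2 else 0)"
  let ?f = "\<lambda>j w. ennreal (1 / real n) * (ennreal (?q j w) * ennreal ((norm (X w))\<^sup>2))"
  have X2m [measurable]: "(\<lambda>w. (norm (X w))\<^sup>2) \<in> borel_measurable M"
    by (rule borel_measurable_integrable[OF X2])
  have qm [measurable]: "(\<lambda>w. ennreal (?q j w)) \<in> borel_measurable M" for j
    using measurable_compose[OF borel_measurable_power[OF borel_measurable_inner[OF borel_measurable_const X]]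
        measurable_ennreal, of "v j" 2] by (cases "j \<in> J") simp_all
  have each: "(\<integral>\<^sup>+w. ?d j w \<partial>N)
      \<le> (\<integral>\<^sup>+w. ?f j w \<partial>M)" for j
  proof (cases "j \<in> J")
    case True
    let ?g = "\<lambda>z :: 'h \<times> real. (fst z \<bullet> v j) *\<^sub>R fst z - ?K (v j)"
    have g: "?g \<in> borel_measurable borel"
      by (intro borel_measurable_continuous_onI continuous_intros)
    have nsq: "(norm ((X w \<bullet> v j) *\<^sub>R X w))\<^sup>2 = (v j \<bullet> X w)\<^sup>2 * (norm (X w))\<^sup>2" for w
      by (simp add: power_mult_distrib inner_commute)
    have f2: "integrable M (\<lambda>w. (norm ((X w \<bullet> v j) *\<^sub>R X w))\<^sup>2)"
    proof (rule Bochner_Integration.integrable_bound[OF X4])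
      show "(\<lambda>w. (norm ((X w \<bullet> v j) *\<^sub>R X w))\<^sup>2) \<in> borel_measurable M" using X by measurable
      have "norm ((X w \<bullet> v j) *\<^sub>R X w) \<le> (norm (X w))\<^sup>2" for w
        using norm_rank_one_le[of "X w" "v j"] norm_orthonormal[OF on True] by simp
      then have "(norm ((X w \<bullet> v j) *\<^sub>R X w))\<^sup>2 \<le> ((norm (X w))\<^sup>2)\<^sup>2" for w
        by (intro power_mono) auto
      then show "AE w in M. norm ((norm ((X w \<bullet> v j) *\<^sub>R X w))\<^sup>2) \<le> norm (norm (X w) ^ 4)"
        by (intro AE_I2) simp
    qed
    note c = centered_second_moment_le[OF integrable_rank_one[OF X X2, of "v j"] f2,
        unfolded covariance_op_def[of M X "v j", symmetric]]
    have mean_eq: "sample_cov n (\<lambda>i. Xs i w) (v j) - ?K (v j)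
        = (1 / real n) *\<^sub>R (\<Sum>i=1..n. ?g (Xs i w, Ys i w))" for w
      unfolding sample_cov_def using n
      by (simp add: sum_subtractf scaleR_diff_right sum_constant_scaleR)
    have "(\<integral>\<^sup>+w. ennreal ((norm (sample_cov n (\<lambda>i. Xs i w) (v j) - ?K (v j)))\<^sup>2) \<partial>N)
        = ennreal ((1 / real n) * (\<integral>w. (norm (?g (X w, Y w)))\<^sup>2 \<partial>M))"
      unfolding mean_eq by (rule iid_copies_second_moment[OF X Y iid n g]) (use c in auto)
    also have "\<dots> \<le> ennreal ((1 / real n) * (\<integral>w. (norm ((X w \<bullet> v j) *\<^sub>R X w))\<^sup>2 \<partial>M))"
      using c(3) by (intro ennreal_leI mult_left_mono) auto
    also have "\<dots> = ennreal (1 / real n) * ennreal (\<integral>w. (norm ((X w \<bullet> v j) *\<^sub>R X w))\<^sup>2 \<partial>M)"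
      by (rule ennreal_mult) auto
    also have "\<dots> = ennreal (1 / real n) * (\<integral>\<^sup>+w. ennreal ((norm ((X w \<bullet> v j) *\<^sub>R X w))\<^sup>2) \<partial>M)"
      using nn_integral_eq_integral[OF f2] by simp
    also have "\<dots> = (\<integral>\<^sup>+w. ennreal (1 / real n) * ennreal ((norm ((X w \<bullet> v j) *\<^sub>R X w))\<^sup>2) \<partial>M)"
      by (rule nn_integral_cmult[symmetric])
         (rule measurable_compose[OF borel_measurable_integrable[OF f2] measurable_ennreal])
    also have "\<dots> = (\<integral>\<^sup>+w. ?f j w \<partial>M)"
      by (rule nn_integral_cong)
         (simp only: nsq True if_True ennreal_mult[OF zero_le_power2 zero_le_power2])
    finally show ?thesis using True by simp
  qed simp
  have "(\<integral>\<^sup>+w. (\<Sum>j. ?d j w) \<partial>N)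
      \<le> (\<Sum>j. (\<integral>\<^sup>+w. ?f j w \<partial>M))"
    unfolding nn_integral_suminf[OF meas] by (intro suminf_le each) auto
  also have "\<dots> = (\<integral>\<^sup>+w. (\<Sum>j. ?f j w) \<partial>M)"
    by (rule nn_integral_suminf[symmetric]) measurable
  also have "\<dots> \<le> (\<integral>\<^sup>+w. ennreal (1 / real n) * ennreal (norm (X w) ^ 4) \<partial>M)"
  proof (rule nn_integral_mono)
    fix w
    have "(\<Sum>j. ennreal (?q j w)) * ennreal ((norm (X w))\<^sup>2) \<le> ennreal ((norm (X w))\<^sup>2) * ennreal ((norm (X w))\<^sup>2)"
      by (intro mult_right_mono suminf_bessel[OF on]) simp
    also have "\<dots> = ennreal (norm (X w) ^ 4)"
      by (simp add: ennreal_mult[symmetric] power_add[symmetric])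
    finally show "(\<Sum>j. ?f j w)
        \<le> ennreal (1 / real n) * ennreal (norm (X w) ^ 4)"
      by (simp only: ennreal_suminf_cmult ennreal_suminf_multc) (rule mult_left_mono, simp_all)
  qed
  also have "\<dots> = ennreal (1 / real n) * ennreal (\<integral>w. norm (X w) ^ 4 \<partial>M)"
    using nn_integral_cmult[OF measurable_compose[OF borel_measurable_integrable[OF X4] measurable_ennreal],
        of "ennreal (1 / real n)"] nn_integral_eq_integral[OF X4] by simp
  also have "\<dots> = ennreal ((\<integral>w. norm (X w) ^ 4 \<partial>M) / real n)"
    by (simp add: ennreal_mult[symmetric])
  finally show ?thesis .
qed

theorem theorem3:
  fixes M :: "'a measure"
    and X :: "'a \<Rightarrow> 'h::{real_inner,banach,second_countable_topology}"
    and Y \<epsilon> :: "'a \<Rightarrow> real"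
    and \<beta> :: 'h
    and J :: "nat set" and l :: "nat \<Rightarrow> real" and v :: "nat \<Rightarrow> 'h"
    and \<sigma> \<mu> R C \<tau> s :: real
  assumes "prob_space M"
    and "X \<in> borel_measurable M" and "Y \<in> borel_measurable M" and "\<epsilon> \<in> borel_measurable M"
    and "AE \<omega> in M. Y \<omega> = \<beta> \<bullet> X \<omega> + \<epsilon> \<omega>"
    and "has_bochner_integral M (\<lambda>\<omega>. \<epsilon> \<omega> *\<^sub>R X \<omega>) 0"
    and "has_bochner_integral M X 0"
    and "integrable M (\<lambda>\<omega>. norm (X \<omega>) ^ 4)"
    and "\<sigma> \<ge> 0"
    and "AE \<omega> in M. nn_cond_exp M (vimage_algebra (space M) X borel)
           (\<lambda>\<omega>. ennreal ((\<epsilon> \<omega>)\<^sup>2)) \<omega> \<le> ennreal (\<sigma>\<^sup>2)"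
    and "eigen_decomposition (covariance_op M X) J l v"
    and "\<not> is_eigenvalue (covariance_op M X) 0"
    and "\<mu> > 0" and "R > 0" and "C > 0"
    and "(\<lambda>j. (\<beta> \<bullet> v j)\<^sup>2 / l j powr (2 * \<mu>)) summable_on J"
    and "(\<Sum>\<^sub>\<infinity>j\<in>J. (\<beta> \<bullet> v j)\<^sup>2 / l j powr (2 * \<mu>)) \<le> R\<^sup>2"
    and "l summable_on J" and "(\<Sum>\<^sub>\<infinity>j\<in>J. l j) \<le> C"
    and "\<tau> > 1"
    and "s \<in> {0..1}"
  shows "\<exists>c>0. \<forall>(n::nat) (\<delta>::real) (N :: 'b measure) Xs Ys.
           n \<ge> 1 \<and> 0 < \<delta> \<and> \<delta> < 1 \<and> \<delta> \<ge> 1 / real n \<and> iid_copies N n Xs Ys M X Y \<longrightarrow>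
           measure N {\<omega> \<in> space N.
             let x = (\<lambda>i. Xs i \<omega>); y = (\<lambda>i. Ys i \<omega>);
                 m = stopping_index n x y
                       (\<tau> * \<sigma> * sqrt (2 * (\<integral>\<omega>. (norm (X \<omega>))\<^sup>2 \<partial>M) / (\<delta> * real n)))
             in (norm (spectral_power J l v s (pls_estimator n x y m - \<beta>)))\<^sup>2
                  \<le> c * (\<delta> * real n) powr (- ((\<mu> + s) / (\<mu> + 1)))}
           \<ge> 1 - \<delta>"
proof -
  interpret prob_space M by fact
  note X = assms(2) and Y = assms(3) and X4 = assms(8)
  note X2 = integrable_norm_square[OF X X4]
  define K where "K = covariance_op M X"
  interpret population K J l v
    unfolding K_def by unfold_locales (rule assms)+
  define L where "L = (\<integral>w. (norm (X w))\<^sup>2 \<partial>M)"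
  define V where "V = (\<integral>w. norm (X w) ^ 4 \<partial>M)"
  have LV: "0 \<le> L" "0 \<le> V" by (simp_all add: L_def V_def)
  have KL: "norm (K b) \<le> L * norm b" for b
    unfolding K_def L_def by (rule norm_covariance_op_le[OF X X2])
  have s: "0 \<le> s" "s \<le> 1" using assms(21) by auto
  define c0 where "c0 = \<sigma> * sqrt (2 * L)"
  define h where "h = sqrt (2 * V)"
  have c0: "0 \<le> c0" and h: "0 \<le> h" using assms(9) LV by (simp_all add: c0_def h_def)
  obtain c where c: "0 < c" and rate: "\<forall>n x y \<epsilon>. 0 < \<epsilon> \<longrightarrow> \<epsilon> \<le> 1 \<longrightarrow>
    (\<forall>b. norm (sample_cov n x b - K b) \<le> h * \<epsilon> * norm b) \<longrightarrow>
    norm (sample_cross_cov n x y - sample_cov n x \<beta>) \<le> c0 * \<epsilon> \<longrightarrow>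
    (norm (spectral_power J l v s (pls_estimator n x y (stopping_index n x y (\<tau> * (c0 * \<epsilon>))) - \<beta>)))\<^sup>2
      \<le> c * \<epsilon> powr (2 * ((\<mu> + s) / (\<mu> + 1)))"
    using pls_rate[OF assms(13,14,20) LV(1) h c0 assms(16,17) KL s] by (elim exE conjE) (rule that)
  have blK: "bounded_linear K"
    by (rule bounded_linear_intro[where K = L]) (simp_all add: K_add K_scale KL mult.commute)
  have "1 - \<delta> \<le> measure N {w \<in> space N.
             let x = (\<lambda>i. Xs i w); y = (\<lambda>i. Ys i w);
                 m = stopping_index n x y
                       (\<tau> * \<sigma> * sqrt (2 * (\<integral>w. (norm (X w))\<^sup>2 \<partial>M) / (\<delta> * real n)))
             in (norm (spectral_power J l v s (pls_estimator n x y m - \<beta>)))\<^sup>2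
                  \<le> c * (\<delta> * real n) powr (- ((\<mu> + s) / (\<mu> + 1)))}"
    if n: "1 \<le> n" and \<delta>: "0 < \<delta>" "\<delta> < 1" "1 / real n \<le> \<delta>" and iid: "iid_copies N n Xs Ys M X Y"
    for n :: nat and \<delta> :: real and N :: "'b measure" and Xs Ys
  proof -
    interpret N: prob_space N using iid by (simp add: iid_copies_def)
    note Xs = iid_copies_measurable(1)[OF iid] and Ys = iid_copies_measurable(2)[OF iid]
    define e where "e = 1 / sqrt (\<delta> * real n)"
    have dn: "1 \<le> \<delta> * real n" using \<delta> n by (simp add: field_simps)
    have e: "0 < e" "e \<le> 1" "e\<^sup>2 = 1 / (\<delta> * real n)"
      using dn by (simp_all add: e_def power_divide)
    have thr: "\<tau> * \<sigma> * sqrt (2 * (\<integral>w. (norm (X w))\<^sup>2 \<partial>M) / (\<delta> * real n)) = \<tau> * (c0 * e)"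
      by (simp add: c0_def e_def L_def real_sqrt_divide)
    have pw: "e powr (2 * ((\<mu> + s) / (\<mu> + 1))) = (\<delta> * real n) powr (- ((\<mu> + s) / (\<mu> + 1)))"
    proof -
      have "e = (\<delta> * real n) powr (- (1 / 2))"
        unfolding e_def powr_minus_divide using powr_half_sqrt[of "\<delta> * real n"] dn by simp
      moreover have "- (1 / 2) * (2 * q) = - q" for q :: real by simp
      ultimately show ?thesis by (simp only: powr_powr)
    qed
    define res where "res = (\<lambda>w. sample_cross_cov n (\<lambda>i. Xs i w) (\<lambda>i. Ys i w) - sample_cov n (\<lambda>i. Xs i w) \<beta>)"
    define hs where "hs = (\<lambda>w. \<Sum>j. ennreal (if j \<in> J then
      (norm (sample_cov n (\<lambda>i. Xs i w) (v j) - K (v j)))\<^sup>2 else 0))"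
    have Am: "(\<lambda>w. sample_cov n (\<lambda>i. Xs i w) b) \<in> borel_measurable N" for b
      by (rule measurable_sample_cov[where Xs = Xs and g = "\<lambda>_. b", OF Xs borel_measurable_const])
    have resm: "res \<in> borel_measurable N"
      unfolding res_def
      by (rule borel_measurable_diff[OF measurable_sample_cross_cov[where Xs = Xs and Ys = Ys, OF Xs Ys] Am])
    have hsm: "hs \<in> borel_measurable N"
      unfolding hs_def
    proof (rule borel_measurable_suminf_order)
      fix j show "(\<lambda>w. ennreal (if j \<in> J then
        (norm (sample_cov n (\<lambda>i. Xs i w) (v j) - K (v j)))\<^sup>2 else 0)) \<in> borel_measurable N"
        using Am[of "v j"] by (cases "j \<in> J") simp_all
    qed
    let ?B1 = "{w \<in> space N. ennreal ((c0 * e)\<^sup>2) < ennreal ((norm (res w))\<^sup>2)}"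
    let ?B2 = "{w \<in> space N. ennreal ((h * e)\<^sup>2) < hs w}"
    \<comment> \<open>for \<open>\<sigma> = 0\<close> or \<open>X = 0\<close> the threshold is \<open>0\<close> and the noise vanishes almost surely\<close>
    have B1: "measure N ?B1 \<le> \<delta> / 2"
    proof (rule N.markov_half)
      show "(\<lambda>w. ennreal ((norm (res w))\<^sup>2)) \<in> borel_measurable N" using resm by measurable
      show "(\<integral>\<^sup>+w. ennreal ((norm (res w))\<^sup>2) \<partial>N) \<le> ennreal (\<sigma>\<^sup>2 * L / real n)"
        unfolding res_def L_def
        by (rule cross_cov_deviation[OF assms(1-6) X2 assms(10) iid n])
      show "2 * (\<sigma>\<^sup>2 * L / real n) / \<delta> \<le> (c0 * e)\<^sup>2"
        using LV by (simp add: c0_def power_mult_distrib e(3) mult_ac)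
    qed (use LV \<delta> in auto)
    have B2: "measure N ?B2 \<le> \<delta> / 2"
    proof (rule N.markov_half[OF hsm])
      show "(\<integral>\<^sup>+w. hs w \<partial>N) \<le> ennreal (V / real n)"
        unfolding hs_def V_def K_def
        by (rule covariance_deviation[OF assms(1) X Y X4 on_v iid n])
      show "2 * (V / real n) / \<delta> \<le> (h * e)\<^sup>2"
        using LV by (simp add: h_def power_mult_distrib e(3) mult_ac)
    qed (use LV \<delta> in auto)
    let ?b = "\<lambda>w. pls_estimator n (\<lambda>i. Xs i w) (\<lambda>i. Ys i w)
        (stopping_index n (\<lambda>i. Xs i w) (\<lambda>i. Ys i w) (\<tau> * (c0 * e)))"
    let ?S = "{w \<in> space N. (norm (spectral_power J l v s
      (?b w - \<beta>)))\<^sup>2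
      \<le> c * e powr (2 * ((\<mu> + s) / (\<mu> + 1)))}"
    have S: "?S \<in> sets N"
    proof -
      have spm: "spectral_power J l v s \<in> borel_measurable borel"
        by (intro borel_measurable_continuous_onI linear_continuous_on bounded_linear_spectral_power[OF s KL])
      have "(\<lambda>w. ?b w - \<beta>) \<in> borel_measurable N"
        by (rule borel_measurable_diff[OF measurable_pls_stopped[where Xs = Xs and Ys = Ys, OF Xs Ys] borel_measurable_const])
      from measurable_compose[OF this spm]
      have "(\<lambda>w. (norm (spectral_power J l v s (?b w - \<beta>)))\<^sup>2) \<in> borel_measurable N"
        by (intro borel_measurable_power measurable_compose[OF _ borel_measurable_norm])
      then show ?thesis by (rule borel_measurable_le[OF _ borel_measurable_const])
    qed
    have B1s: "?B1 \<in> sets N" using resm by measurable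
    have B2s: "?B2 \<in> sets N" using hsm by measurable
    have "space N - (?B1 \<union> ?B2) \<subseteq> ?S"
    proof
      fix w assume w: "w \<in> space N - (?B1 \<union> ?B2)"
      then have o: "w \<in> space N" by simp
      have "ennreal ((norm (res w))\<^sup>2) \<le> ennreal ((c0 * e)\<^sup>2)" using w by (simp add: not_less)
      then have "(norm (res w))\<^sup>2 \<le> (c0 * e)\<^sup>2" by (simp add: ennreal_le_iff)
      then have noise: "norm (res w) \<le> c0 * e"
        by (rule power2_le_imp_le) (use c0 e in simp)
      have hsle: "hs w \<le> ennreal ((h * e)\<^sup>2)" using w by (simp add: not_less)
      let ?T = "\<lambda>b. sample_cov n (\<lambda>i. Xs i w) b - K b"
      have "norm (?T b) \<le> h * e * norm b" for b
      proof (rule hilbert_schmidt_bound[OF on_v total_v])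
        show "bounded_linear ?T" by (rule bounded_linear_sub[OF bounded_linear_sample_cov blK])
        show "0 \<le> h * e" using h e by simp
        fix F assume F: "finite F" "F \<subseteq> J"
        have "ennreal (\<Sum>j\<in>F. (norm (?T (v j)))\<^sup>2) = (\<Sum>j\<in>F. ennreal ((norm (?T (v j)))\<^sup>2))"
          by (rule sum_ennreal[symmetric]) simp
        also have "\<dots> = (\<Sum>j\<in>F. ennreal (if j \<in> J then (norm (?T (v j)))\<^sup>2 else 0))"
          by (rule sum.cong) (use F in auto)
        also have "\<dots> \<le> hs w" unfolding hs_def by (rule sum_le_suminf) (use F in auto)
        also note hsle
        finally show "(\<Sum>j\<in>F. (norm (?T (v j)))\<^sup>2) \<le> (h * e)\<^sup>2" by (simp add: ennreal_le_iff)
      qed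
      then show "w \<in> ?S" using rate e noise o unfolding res_def by simp
    qed
    then have "N.prob (space N - (?B1 \<union> ?B2)) \<le> N.prob ?S" by (rule N.finite_measure_mono[OF _ S])
    moreover have "N.prob (space N - (?B1 \<union> ?B2)) = 1 - N.prob (?B1 \<union> ?B2)"
      by (rule N.prob_compl) (use B1s B2s in auto)
    moreover have "N.prob (?B1 \<union> ?B2) \<le> N.prob ?B1 + N.prob ?B2"
      by (rule measure_Un_le[OF B1s B2s])
    ultimately have "1 - \<delta> \<le> N.prob ?S" using B1 B2 by linarith
    then show ?thesis unfolding Let_def thr pw .
  qed
  with c show ?thesis by (intro exI[of _ c]) simp
qed

end
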